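(* Let $B,T,b>0$ and $u_0$ be as in the existence theorem for regular solutions. Then the regular solution of $$u_t-u_{xx}+uu_x+u_{xxx}+u_{xyy}=0 \text{ in }\mathcal{S}\times(0,T),\quad u(x,0,t)=u(x,B,t)=0,\quad u(x,y,0)=u_0(x,y),$$ in the class $u\in L^\infty(0,T;L^2(\mathcal{S}))$, $u_x\in L^2(0,T;L^2(\mathcal{S}))$, $e^{bx}u,e^{bx}u_x\in L^\infty(0,T;H^2(\mathcal{S}))\cap L^2(0,T;H^3(\mathcal{S}))$, $e^{bx}u_t\in L^\infty(0,T;L^2(\mathcal{S}))\cap L^2(0,T;H^1(\mathcal{S}))$, is unique: if $u_1,u_2$ are two such solutions then $u_1=u_2$ a.e. in $\mathcal{S}\times(0,T)$.
   Context: $\mathcal{S}=\mathbb{R}\times(0,B)$. The existence theorem assumes $u_0(x,0)=u_0(x,B)=0$ and $J_0=\int_{\mathcal{S}}\{u_0^2+e^{2bx}[u_0^2+|\nabla u_0|^2+|\nabla u_{0x}|^2+u_0^2u_{0x}^2+|\Delta u_{0x}|^2]\}\,dx\,dy<\infty$ for some $b>0$. A regular solution is a function in the stated class satisfying the boundary and initial conditions and, for a.e. $t$, $\int_{\mathcal{S}}e^{bx}[u_t-u_{xx}+u_{xxx}+uu_x+u_{xyy}]\phi\,dx\,dy=0$ for all $\phi\in L^2(\mathcal{S})$. *)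

theory Defs
  imports "HOL-Analysis.Analysis"
begin

definition strip :: "real \<Rightarrow> (real \<times> real) set" where
  "strip B = {p. 0 < snd p \<and> snd p < B}"

definition pdir :: "bool \<Rightarrow> (real \<times> real \<Rightarrow> real) \<Rightarrow> real \<times> real \<Rightarrow> real" where
  "pdir d f p = (if d then deriv (\<lambda>s. f (s, snd p)) (fst p)
                 else deriv (\<lambda>s. f (fst p, s)) (snd p))"

fun pdw :: "bool list \<Rightarrow> (real \<times> real \<Rightarrow> real) \<Rightarrow> real \<times> real \<Rightarrow> real" where
  "pdw [] f = f"
| "pdw (d # ds) f = pdir d (pdw ds f)"

definition pd :: "nat \<Rightarrow> nat \<Rightarrow> (real \<times> real \<Rightarrow> real) \<Rightarrow> real \<times> real \<Rightarrow> real" where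
  "pd i j f = (pdir True ^^ i) ((pdir False ^^ j) f)"

definition smooth2 :: "(real \<times> real \<Rightarrow> real) \<Rightarrow> bool" where
  "smooth2 f \<longleftrightarrow>
     (\<forall>ds. continuous_on UNIV (pdw ds f)) \<and>
     (\<forall>ds p. (\<lambda>s. pdw ds f (s, snd p)) differentiable (at (fst p)) \<and>
             (\<lambda>s. pdw ds f (fst p, s)) differentiable (at (snd p)))"

definition test2 :: "(real \<times> real) set \<Rightarrow> (real \<times> real \<Rightarrow> real) \<Rightarrow> bool" where
  "test2 U f \<longleftrightarrow> smooth2 f \<and> (\<exists>K. compact K \<and> K \<subseteq> U \<and> (\<forall>p. p \<notin> K \<longrightarrow> f p = 0))"

definition smooth1 :: "(real \<Rightarrow> real) \<Rightarrow> bool" where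
  "smooth1 f \<longleftrightarrow> (\<forall>n t. ((deriv ^^ n) f) differentiable (at t))"

definition loc_int :: "(real \<times> real) set \<Rightarrow> (real \<times> real \<Rightarrow> real) \<Rightarrow> bool" where
  "loc_int U f \<longleftrightarrow> (\<forall>K. compact K \<and> K \<subseteq> U \<longrightarrow> set_integrable lebesgue K f)"

definition L2 :: "(real \<times> real) set \<Rightarrow> (real \<times> real \<Rightarrow> real) \<Rightarrow> bool" where
  "L2 U f \<longleftrightarrow> set_borel_measurable lebesgue U f \<and> set_integrable lebesgue U (\<lambda>p. (f p)\<^sup>2)"

definition L2norm2 :: "(real \<times> real) set \<Rightarrow> (real \<times> real \<Rightarrow> real) \<Rightarrow> real" where
  "L2norm2 U f = (LINT p:U|lebesgue. (f p)\<^sup>2)"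

text \<open>g is the weak (distributional) derivative  sum c * d_x^i d_y^j  of f on U,
  for a linear constant-coefficient operator given as a list of (c,i,j).\<close>
definition weak_op :: "(real \<times> real) set \<Rightarrow> (real \<times> real \<Rightarrow> real) \<Rightarrow> (real \<times> nat \<times> nat) list
                        \<Rightarrow> (real \<times> real \<Rightarrow> real) \<Rightarrow> bool" where
  "weak_op U f L g \<longleftrightarrow> loc_int U f \<and> loc_int U g \<and>
     (\<forall>\<phi>. test2 U \<phi> \<longrightarrow>
        (LINT p:U|lebesgue. f p * (\<Sum>(c,i,j)\<leftarrow>L. c * (-1)^(i+j) * pd i j \<phi> p))
        = (LINT p:U|lebesgue. g p * \<phi> p))"

definition weak_pd :: "(real \<times> real) set \<Rightarrow> (real \<times> real \<Rightarrow> real) \<Rightarrow> nat \<Rightarrow> nat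
                        \<Rightarrow> (real \<times> real \<Rightarrow> real) \<Rightarrow> bool" where
  "weak_pd U f i j g \<longleftrightarrow> weak_op U f [(1, i, j)] g"

text \<open>The weak derivative d_x^i d_y^j f (a representative; unique a.e. when it exists).\<close>
definition wd :: "(real \<times> real) set \<Rightarrow> (real \<times> real \<Rightarrow> real) \<Rightarrow> nat \<Rightarrow> nat \<Rightarrow> real \<times> real \<Rightarrow> real" where
  "wd U f i j = (SOME g. weak_pd U f i j g)"

definition wop :: "(real \<times> real) set \<Rightarrow> (real \<times> real \<Rightarrow> real) \<Rightarrow> (real \<times> nat \<times> nat) list \<Rightarrow> real \<times> real \<Rightarrow> real" where
  "wop U f L = (SOME g. weak_op U f L g)"

definition Hk :: "nat \<Rightarrow> (real \<times> real) set \<Rightarrow> (real \<times> real \<Rightarrow> real) \<Rightarrow> bool" where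
  "Hk k U f \<longleftrightarrow> L2 U f \<and> (\<forall>i j. i + j \<le> k \<longrightarrow> (\<exists>g. weak_pd U f i j g \<and> L2 U g))"

definition Hk_norm2 :: "nat \<Rightarrow> (real \<times> real) set \<Rightarrow> (real \<times> real \<Rightarrow> real) \<Rightarrow> real" where
  "Hk_norm2 k U f = (\<Sum>(i,j)\<in>{(i,j). i + j \<le> k}. L2norm2 U (wd U f i j))"

definition Linf_time :: "real \<Rightarrow> ((real \<times> real \<Rightarrow> real) \<Rightarrow> bool) \<Rightarrow> ((real \<times> real \<Rightarrow> real) \<Rightarrow> real)
                         \<Rightarrow> (real \<Rightarrow> real \<times> real \<Rightarrow> real) \<Rightarrow> bool" where
  "Linf_time T X N f \<longleftrightarrow> (AE t in lebesgue. t \<in> {0<..<T} \<longrightarrow> X (f t)) \<and>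
                         (\<exists>C. AE t in lebesgue. t \<in> {0<..<T} \<longrightarrow> N (f t) \<le> C)"

text \<open>f t in X for a.e. t, and the squared norm is integrable over (0,T).\<close>
definition L2_time :: "real \<Rightarrow> ((real \<times> real \<Rightarrow> real) \<Rightarrow> bool) \<Rightarrow> ((real \<times> real \<Rightarrow> real) \<Rightarrow> real)
                         \<Rightarrow> (real \<Rightarrow> real \<times> real \<Rightarrow> real) \<Rightarrow> bool" where
  "L2_time T X N f \<longleftrightarrow> (AE t in lebesgue. t \<in> {0<..<T} \<longrightarrow> X (f t)) \<and>
                        set_integrable lebesgue {0<..<T} (\<lambda>t. N (f t))"

definition jmeas :: "real \<Rightarrow> real \<Rightarrow> (real \<Rightarrow> real \<times> real \<Rightarrow> real) \<Rightarrow> bool" where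
  "jmeas B T f \<longleftrightarrow> set_borel_measurable lebesgue ({0<..<T} \<times> strip B) (\<lambda>z. f (fst z) (snd z))"

text \<open>Homogeneous Dirichlet condition on the lines y = 0 and y = B in the trace sense,
  expressed through Green's formula: the y-integration by parts over S holds against
  every test function on the whole plane (boundary term = trace times test function).\<close>
definition vanish_y :: "real \<Rightarrow> (real \<times> real \<Rightarrow> real) \<Rightarrow> bool" where
  "vanish_y B f \<longleftrightarrow> (\<exists>g. weak_pd (strip B) f 0 1 g \<and>
     (\<forall>\<phi>. test2 UNIV \<phi> \<longrightarrow>
        (LINT p:strip B|lebesgue. f p * pd 0 1 \<phi> p) = - (LINT p:strip B|lebesgue. g p * \<phi> p)))"

definition wt :: "real \<Rightarrow> (real \<Rightarrow> real \<times> real \<Rightarrow> real) \<Rightarrow> real \<Rightarrow> real \<times> real \<Rightarrow> real" where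
  "wt b f t p = exp (b * fst p) * f t p"

definition J0_integrand :: "real \<Rightarrow> real \<Rightarrow> (real \<times> real \<Rightarrow> real) \<Rightarrow> real \<times> real \<Rightarrow> real" where
  "J0_integrand B b u0 p =
     (u0 p)\<^sup>2 + exp (2 * b * fst p) *
       ((u0 p)\<^sup>2 + (wd (strip B) u0 1 0 p)\<^sup>2 + (wd (strip B) u0 0 1 p)\<^sup>2
        + (wd (strip B) u0 2 0 p)\<^sup>2 + (wd (strip B) u0 1 1 p)\<^sup>2
        + (u0 p)\<^sup>2 * (wd (strip B) u0 1 0 p)\<^sup>2
        + (wop (strip B) u0 [(1,3,0),(1,1,2)] p)\<^sup>2)"

definition initial_ok :: "real \<Rightarrow> real \<Rightarrow> (real \<times> real \<Rightarrow> real) \<Rightarrow> bool" where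
  "initial_ok B b u0 \<longleftrightarrow>
     (\<forall>i j. (i,j) \<in> {(1,0),(0,1),(2,0),(1,1)} \<longrightarrow> (\<exists>g. weak_pd (strip B) u0 i j g)) \<and>
     (\<exists>g. weak_op (strip B) u0 [(1,3,0),(1,1,2)] g) \<and>
     vanish_y B u0 \<and>
     set_integrable lebesgue (strip B) (J0_integrand B b u0)"

definition regular_solution ::
  "real \<Rightarrow> real \<Rightarrow> real \<Rightarrow> (real \<times> real \<Rightarrow> real) \<Rightarrow> (real \<Rightarrow> real \<times> real \<Rightarrow> real) \<Rightarrow> bool" where
  "regular_solution B T b u0 u \<longleftrightarrow>
   (\<exists>w. \<comment> \<open>w is (a representative of) u_t\<close>
     jmeas B T u \<and> jmeas B T w \<and>
     \<comment> \<open>u in L^inf(0,T;L^2(S))\<close>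
     Linf_time T (L2 (strip B)) (L2norm2 (strip B)) u \<and>
     \<comment> \<open>u_x in L^2(0,T;L^2(S))\<close>
     L2_time T (\<lambda>f. \<exists>g. weak_pd (strip B) f 1 0 g \<and> L2 (strip B) g)
               (\<lambda>f. L2norm2 (strip B) (wd (strip B) f 1 0)) u \<and>
     \<comment> \<open>e^{bx} u in L^inf(0,T;H^2) and L^2(0,T;H^3)\<close>
     Linf_time T (Hk 2 (strip B)) (Hk_norm2 2 (strip B)) (wt b u) \<and>
     L2_time T (Hk 3 (strip B)) (Hk_norm2 3 (strip B)) (wt b u) \<and>
     \<comment> \<open>e^{bx} u_x in L^inf(0,T;H^2) and L^2(0,T;H^3)\<close>
     Linf_time T (Hk 2 (strip B)) (Hk_norm2 2 (strip B)) (wt b (\<lambda>t. wd (strip B) (u t) 1 0)) \<and>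
     L2_time T (Hk 3 (strip B)) (Hk_norm2 3 (strip B)) (wt b (\<lambda>t. wd (strip B) (u t) 1 0)) \<and>
     \<comment> \<open>e^{bx} u_t in L^inf(0,T;L^2) and L^2(0,T;H^1)\<close>
     Linf_time T (L2 (strip B)) (L2norm2 (strip B)) (wt b w) \<and>
     L2_time T (Hk 1 (strip B)) (Hk_norm2 1 (strip B)) (wt b w) \<and>
     \<comment> \<open>boundary conditions u(x,0,t) = u(x,B,t) = 0\<close>
     (AE t in lebesgue. t \<in> {0<..<T} \<longrightarrow> vanish_y B (u t)) \<and>
     \<comment> \<open>w is the time derivative of u (as an S-distribution valued function) and u(0) = u0\<close>
     (\<forall>\<phi> \<eta>. test2 (strip B) \<phi> \<longrightarrow> smooth1 \<eta> \<longrightarrow>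
        (\<exists>K. compact K \<and> K \<subseteq> {..<T} \<and> (\<forall>t. t \<notin> K \<longrightarrow> \<eta> t = 0)) \<longrightarrow>
        (LINT t:{0<..<T}|lebesgue. (LINT p:strip B|lebesgue. u t p * \<phi> p) * deriv \<eta> t)
          + (LINT p:strip B|lebesgue. u0 p * \<phi> p) * \<eta> 0
        = - (LINT t:{0<..<T}|lebesgue. (LINT p:strip B|lebesgue. w t p * \<phi> p) * \<eta> t)) \<and>
     \<comment> \<open>the equation in the weighted weak sense, for a.e. t\<close>
     (AE t in lebesgue. t \<in> {0<..<T} \<longrightarrow>
        (\<forall>\<phi>. L2 (strip B) \<phi> \<longrightarrow>
          (LINT p:strip B|lebesgue. exp (b * fst p) *
             (w t p - wd (strip B) (u t) 2 0 p + wd (strip B) (u t) 3 0 p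
              + u t p * wd (strip B) (u t) 1 0 p + wd (strip B) (u t) 1 2 p) * \<phi> p) = 0)))"

end

theory Submission
  imports Defs
begin

text \<open>For two solutions put \<open>z = u\<^sub>1 - u\<^sub>2\<close>, \<open>v = exp (b x) z\<close> and \<open>q = exp (b x) z\<^sub>x = v\<^sub>x - b v\<close>.
  Testing the difference of the two equations with \<open>exp (2 b x) z\<close> gives

  \<open>1/2 d/dt \<parallel>v\<parallel>\<^sup>2 = - (1 + 3 b) \<parallel>q\<parallel>\<^sup>2 - b \<parallel>v\<^sub>y\<parallel>\<^sup>2 + (2 b\<^sup>2 + 4 b\<^sup>3) \<parallel>v\<parallel>\<^sup>2 - R\<close>,

  where the nonlinear term satisfies \<open>\<bar>R\<bar> \<le> M(t) \<parallel>v\<^sup>2\<parallel>\<close> for a square integrable function \<open>M\<close> of time.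
  Ladyzhenskaya's inequality bounds \<open>\<parallel>v\<^sup>2\<parallel>\<close> by \<open>2 \<parallel>v\<parallel> (\<parallel>v\<^sub>x\<parallel> + \<parallel>v\<^sub>y\<parallel> + \<parallel>v\<parallel>)\<close>, so that \<open>R\<close> is absorbed by the
  dissipation at the cost of \<open>C (1 + M(t)\<^sup>2) \<parallel>v\<parallel>\<^sup>2\<close>, and Gronwall's inequality yields \<open>v = 0\<close>.

  All integrations by parts, in \<open>x\<close>, in \<open>y\<close> and in time, are carried out on lines: by a du Bois-Reymond
  lemma with a parameter, a weakly differentiable function is absolutely continuous on almost every line,
  and in \<open>y\<close> the boundary condition says that the extension by zero still has this property.\<close>

section \<open>Smooth bump functions and the fundamental lemma\<close>

text \<open>The weight makes the estimate close. Integrated against \<open>exp (2 b x) z\<close>,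
  the terms u_xxx and u_xyy yield the dissipation \<open>3 b \<parallel>q\<parallel>\<^sup>2\<close>
  and \<open>b \<parallel>v\<^sub>y\<parallel>\<^sup>2\<close>; for b = 0 nothing would control v_y,
  which Ladyzhenskaya's inequality brings in. The term R comes from u_1 u_1x - u_2 u_2x = z u_1x +
  u_2 z_x. The second part integrates by parts to -(u_2x, v^2)/2 - b (u_2, v^2), so that M involves
  only the L2 norms of u_1x, u_2x and u_2. The obstacle is low regularity: second and third
  derivatives of u are square integrable only with the weight, and the integrability of u v q is
  read off from the equation itself. Absolute continuity on lines replaces density arguments and
  trace theorems: products obey the Leibniz rule, and a derivative has integral zero over a line as
  soon as it and the function are integrable. Applied in time at almost every point of the strip,
  the same principle gives z^2 as the integral of 2 z z_t, and Fubini turns this into a formula for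
  the norm of v.\<close>

lemma smooth1_coinduct:
  assumes "f \<in> C" and step: "\<And>g. g \<in> C \<Longrightarrow> (\<forall>t. g differentiable (at t)) \<and> deriv g \<in> C"
  shows "smooth1 f"
proof -
  have "(deriv ^^ n) f \<in> C" for n
    by (induction n) (use assms in auto)
  then show ?thesis unfolding smooth1_def using step by blast
qed

lemma smooth1_differentiable: "smooth1 f \<Longrightarrow> f differentiable (at t)"
  unfolding smooth1_def by (metis funpow_0)

lemma smooth1_has_deriv: "smooth1 f \<Longrightarrow> (f has_real_derivative deriv f t) (at t)"
  using smooth1_differentiable DERIV_deriv_iff_real_differentiable by blast

lemma smooth1_deriv: "smooth1 f \<Longrightarrow> smooth1 (deriv f)"
  unfolding smooth1_def by (metis funpow_Suc_right o_apply)

lemma smooth1_continuous: "smooth1 f \<Longrightarrow> continuous_on A f"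
  by (meson DERIV_isCont continuous_at_imp_continuous_on smooth1_has_deriv)

lemma smooth1_measurable [measurable_dest]: "smooth1 f \<Longrightarrow> f \<in> borel_measurable borel"
  using smooth1_continuous borel_measurable_continuous_onI by blast

lemma smooth1_lincomb:
  assumes "smooth1 f" "smooth1 g" shows "smooth1 (\<lambda>t. a * f t + g t)"
proof (rule smooth1_coinduct[where C="{(\<lambda>t. a * f t + g t) |f g. smooth1 f \<and> smooth1 g}"])
  fix h assume "h \<in> {(\<lambda>t. a * f t + g t) |f g. smooth1 f \<and> smooth1 g}"
  then obtain f g where h: "h = (\<lambda>t. a * f t + g t)" and fg: "smooth1 f" "smooth1 g" by auto
  have D: "(h has_real_derivative a * deriv f t + deriv g t) (at t)" for t
    unfolding h using fg by (auto intro!: derivative_eq_intros smooth1_has_deriv)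
  then have "deriv h = (\<lambda>t. a * deriv f t + deriv g t)"
    using DERIV_imp_deriv by blast
  then show "(\<forall>t. h differentiable (at t)) \<and> deriv h \<in> {(\<lambda>t. a * f t + g t) |f g. smooth1 f \<and> smooth1 g}"
    using D fg smooth1_deriv real_differentiable_def by blast
qed (use assms in blast)

text \<open>Products f g alone are not closed under differentiation, because the Leibniz rule
  returns a sum. Closing them under sums gives an invariant set for
  \<open>smooth1_coinduct\<close>.\<close>

inductive mult_span :: "(real \<Rightarrow> real) \<Rightarrow> bool" where
  "smooth1 f \<Longrightarrow> smooth1 g \<Longrightarrow> mult_span (\<lambda>t. f t * g t)"
| "mult_span f \<Longrightarrow> mult_span g \<Longrightarrow> mult_span (\<lambda>t. f t + g t)"

lemma mult_span_deriv:
  assumes "mult_span f"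
  shows "\<exists>f'. mult_span f' \<and> (\<forall>t. (f has_real_derivative f' t) (at t))"
  using assms
proof induction
  case (1 f g)
  have "\<forall>t. ((\<lambda>t. f t * g t) has_real_derivative deriv f t * g t + f t * deriv g t) (at t)"
    using 1 by (auto intro!: derivative_eq_intros smooth1_has_deriv)
  moreover have "mult_span (\<lambda>t. deriv f t * g t + f t * deriv g t)"
    by (intro mult_span.intros smooth1_deriv 1)
  ultimately show ?case by blast
next
  case (2 f g)
  then obtain f' g' where "mult_span f'" "mult_span g'" "\<forall>t. (f has_real_derivative f' t) (at t)"
    "\<forall>t. (g has_real_derivative g' t) (at t)" by blast
  then show ?case
    by (intro exI[of _ "\<lambda>t. f' t + g' t"]) (auto intro!: derivative_eq_intros mult_span.intros)
qed

lemma smooth1_mult: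
  assumes "smooth1 f" "smooth1 g" shows "smooth1 (\<lambda>t. f t * g t)"
proof (rule smooth1_coinduct[where C="Collect mult_span"])
  fix h assume "h \<in> Collect mult_span"
  then obtain h' where "mult_span h'" and D: "\<forall>t. (h has_real_derivative h' t) (at t)"
    using mult_span_deriv by blast
  moreover have "deriv h = h'" using D DERIV_imp_deriv by blast
  ultimately show "(\<forall>t. h differentiable (at t)) \<and> deriv h \<in> Collect mult_span"
    using real_differentiable_def by auto
qed (use assms mult_span.intros in auto)

lemma smooth1_affine:
  assumes "smooth1 f" shows "smooth1 (\<lambda>t. f (a * t + c))"
\<comment> \<open>The scalar \<open>k\<close> collects the factors \<open>a\<close> produced by the
  chain rule.\<close>
proof (rule smooth1_coinduct[where C="{(\<lambda>t. k * f (a * t + c)) |f k. smooth1 f}"])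
  fix h assume "h \<in> {(\<lambda>t. k * f (a * t + c)) |f k. smooth1 f}"
  then obtain f k where h: "h = (\<lambda>t. k * f (a * t + c))" and f: "smooth1 f" by auto
  have D: "(h has_real_derivative (k * a) * deriv f (a * t + c)) (at t)" for t
  proof -
    have "((\<lambda>t. f (a * t + c)) has_real_derivative deriv f (a * t + c) * a) (at t)"
      by (rule DERIV_chain2[OF smooth1_has_deriv[OF f]]) (auto intro!: derivative_eq_intros)
    then have "((\<lambda>t. k * f (a * t + c)) has_real_derivative k * (deriv f (a * t + c) * a)) (at t)"
      by (rule DERIV_cmult)
    then show ?thesis unfolding h by (simp add: mult_ac)
  qed
  then have "deriv h = (\<lambda>t. (k * a) * deriv f (a * t + c))"
    using DERIV_imp_deriv by blast
  then show "(\<forall>t. h differentiable (at t)) \<and> deriv h \<in> {(\<lambda>t. k * f (a * t + c)) |f k. smooth1 f}"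
    using D f smooth1_deriv real_differentiable_def by blast
next
  have "(\<lambda>t. f (a * t + c)) = (\<lambda>t. 1 * f (a * t + c))" by simp
  then show "(\<lambda>t. f (a * t + c)) \<in> {(\<lambda>t. k * f (a * t + c)) |f k. smooth1 f}"
    using assms by blast
qed

lemma smooth1_exp: "smooth1 (\<lambda>t. exp (c * t))"
proof (rule smooth1_coinduct[where C="{(\<lambda>t. k * exp (c * t)) |k. True}"])
  fix h assume "h \<in> {(\<lambda>t. k * exp (c * t)) |k. True}"
  then obtain k where h: "h = (\<lambda>t. k * exp (c * t))" by auto
  have D: "(h has_real_derivative (k * c) * exp (c * t)) (at t)" for t
    unfolding h by (auto intro!: derivative_eq_intros)
  then have "deriv h = (\<lambda>t. (k * c) * exp (c * t))"
    using DERIV_imp_deriv by blast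
  then show "(\<forall>t. h differentiable (at t)) \<and> deriv h \<in> {(\<lambda>t. k * exp (c * t)) |k. True}"
    using D real_differentiable_def by blast
qed (auto intro: exI[of _ 1])

text \<open>\<open>flat 0\<close> is the standard smooth, non-analytic cutoff. The powers of 1/t are
  those that its derivatives produce, so the linear span of the family is closed under
  differentiation.\<close>

definition flat :: "nat \<Rightarrow> real \<Rightarrow> real" where
  "flat n t = (if t > 0 then (1/t)^n * exp (-(1/t)) else 0)"

text \<open>Substituting s = 1/t turns this into the limit of s^n / exp s at infinity.\<close>

lemma flat_tendsto_0: "(flat n \<longlongrightarrow> 0) (at_right 0)"
proof -
  have "((\<lambda>s::real. s ^ n / exp s) \<longlongrightarrow> 0) at_top" by (rule tendsto_power_div_exp_0)
  then have "((\<lambda>t::real. (inverse t) ^ n / exp (inverse t)) \<longlongrightarrow> 0) (at_right 0)"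
    by (rule filterlim_compose) (rule filterlim_inverse_at_top_right)
  moreover have "\<forall>\<^sub>F t in at_right 0. (inverse t) ^ n / exp (inverse t) = flat n t"
    by (simp add: flat_def eventually_at_right_field exp_minus divide_inverse) (meson gt_ex)
  ultimately show ?thesis by (rule Lim_transform_eventually)
qed

lemma flat_deriv: "(flat n has_real_derivative flat (n + 2) t - real n * flat (n + 1) t) (at t)"
proof -
  consider "t > 0" | "t < 0" | "t = 0" by linarith
  then show ?thesis
  proof cases
    case 1
    have "((\<lambda>t. (1/t)^n * exp (-(1/t))) has_real_derivative flat (n + 2) t - real n * flat (n + 1) t) (at t)"
      using 1 by (auto intro!: derivative_eq_intros simp: flat_def field_simps power2_eq_square)
        (cases n; simp add: field_simps)
    then show ?thesis
    proof (rule DERIV_cong_ev[OF refl _ refl, THEN iffD1, rotated])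
      show "\<forall>\<^sub>F x in nhds t. (1/x)^n * exp (-(1/x)) = flat n x"
        using 1 by (auto simp: flat_def eventually_nhds intro!: exI[of _ "{0<..}"])
    qed
  next
    case 2
    have "((\<lambda>t. 0) has_real_derivative flat (n + 2) t - real n * flat (n + 1) t) (at t)"
      using 2 by (auto simp: flat_def)
    then show ?thesis
    proof (rule DERIV_cong_ev[OF refl _ refl, THEN iffD1, rotated])
      show "\<forall>\<^sub>F x in nhds t. 0 = flat n x"
        using 2 by (auto simp: flat_def eventually_nhds intro!: exI[of _ "{..<0}"])
    qed
  next
    case 3
    \<comment> \<open>At the origin the difference quotient of \<open>flat n\<close> is
      \<open>flat (Suc n)\<close> on the right, which tends to 0, and is identically 0 on the
      left.\<close>
    have "((\<lambda>h. flat n h / h) \<longlongrightarrow> 0) (at_right 0)"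
    proof (rule Lim_transform_eventually[OF flat_tendsto_0[of "Suc n"]])
      show "\<forall>\<^sub>F t in at_right 0. flat (Suc n) t = flat n t / t"
        by (simp add: flat_def eventually_at_right_field) (meson gt_ex)
    qed
    moreover have "((\<lambda>h. flat n h / h) \<longlongrightarrow> 0) (at_left 0)"
    proof (rule Lim_transform_eventually[OF tendsto_const])
      show "\<forall>\<^sub>F t in at_left 0. 0 = flat n t / t"
        by (simp add: flat_def eventually_at_left_field) (meson lt_ex)
    qed
    ultimately have "((\<lambda>h. flat n h / h) \<longlongrightarrow> 0) (at 0)"
      by (simp add: filterlim_split_at)
    then show ?thesis using 3 by (simp add: DERIV_def flat_def)
  qed
qed

inductive flat_span :: "(real \<Rightarrow> real) \<Rightarrow> bool" where
  "flat_span (\<lambda>t. c * flat n t)"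
| "flat_span f \<Longrightarrow> flat_span g \<Longrightarrow> flat_span (\<lambda>t. f t + g t)"

lemma flat_span_deriv:
  assumes "flat_span f"
  shows "\<exists>f'. flat_span f' \<and> (\<forall>t. (f has_real_derivative f' t) (at t))"
  using assms
proof induction
  case (1 c n)
  have "((\<lambda>t. c * flat n t) has_real_derivative c * flat (n + 2) t + (- c * real n) * flat (n + 1) t) (at t)" for t
    using DERIV_cmult[OF flat_deriv[of n t], of c] by (simp add: algebra_simps)
  then show ?case using flat_span.intros by blast
next
  case (2 f g)
  then obtain f' g' where "flat_span f'" "flat_span g'" "\<forall>t. (f has_real_derivative f' t) (at t)"
    "\<forall>t. (g has_real_derivative g' t) (at t)" by blast
  then show ?case
    by (intro exI[of _ "\<lambda>t. f' t + g' t"]) (auto intro!: derivative_eq_intros flat_span.intros)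
qed

lemma smooth1_flat: "smooth1 (flat n)"
proof (rule smooth1_coinduct[where C="Collect flat_span"])
  fix h assume "h \<in> Collect flat_span"
  then obtain h' where "flat_span h'" and D: "\<forall>t. (h has_real_derivative h' t) (at t)"
    using flat_span_deriv by blast
  moreover have "deriv h = h'" using D DERIV_imp_deriv by blast
  ultimately show "(\<forall>t. h differentiable (at t)) \<and> deriv h \<in> Collect flat_span"
    using real_differentiable_def by auto
next
  show "flat n \<in> Collect flat_span" using flat_span.intros(1)[of 1 n] by simp
qed

text \<open>The factor \<open>n\<close> only sharpens the rise at both ends: the support stays in
  [a, b], the values in [0, 1], and the pointwise limit is the indicator of the open interval.
  Indicators are thus approximated from within, with no convolution.\<close>

definition bump1 :: "nat \<Rightarrow> real \<Rightarrow> real \<Rightarrow> real \<Rightarrow> real" where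
  "bump1 n a b t = flat 0 (real n * (t - a)) * flat 0 (real n * (b - t))"

lemma flat0_bounds: "0 \<le> flat 0 t" "flat 0 t \<le> 1"
  by (auto simp: flat_def)

lemma bump1_bounds: "0 \<le> bump1 n a b t" "bump1 n a b t \<le> 1"
  by (auto simp: bump1_def flat0_bounds intro!: mult_nonneg_nonneg mult_le_one)

lemma bump1_outside: "t \<notin> {a<..<b} \<Longrightarrow> bump1 n a b t = 0"
  by (auto simp: bump1_def flat_def zero_less_mult_iff)

lemma bump1_pos: "n > 0 \<Longrightarrow> t \<in> {a<..<b} \<Longrightarrow> bump1 n a b t > 0"
  by (auto simp: bump1_def flat_def)

lemma smooth1_bump1: "smooth1 (bump1 n a b)"
proof -
  have "smooth1 (\<lambda>t. flat 0 (real n * t + (- real n * a)) * flat 0 ((- real n) * t + real n * b))"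
    by (intro smooth1_mult smooth1_affine smooth1_flat)
  then show ?thesis by (simp add: bump1_def[abs_def] algebra_simps)
qed

lemma flat0_scaled_tendsto: "t > 0 \<Longrightarrow> (\<lambda>n. flat 0 (real n * t)) \<longlonglongrightarrow> 1"
proof -
  assume t: "t > 0"
  have "(\<lambda>n. exp (- (1 / (real n * t)))) \<longlonglongrightarrow> exp (- 0)"
  proof (intro tendsto_intros)
    have "(\<lambda>n. (1 / t) * (1 / real n)) \<longlonglongrightarrow> (1 / t) * 0"
      by (intro tendsto_intros lim_1_over_n)
    then show "(\<lambda>n. 1 / (real n * t)) \<longlonglongrightarrow> 0" by (simp add: mult.commute)
  qed
  moreover have "\<forall>\<^sub>F n in sequentially. exp (- (1 / (real n * t))) = flat 0 (real n * t)"
    using eventually_gt_at_top[of 0] by eventually_elim (use t in \<open>auto simp: flat_def\<close>)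
  ultimately show ?thesis using Lim_transform_eventually by fastforce
qed

lemma bump1_tendsto: "(\<lambda>n. bump1 n a b t) \<longlonglongrightarrow> indicator {a<..<b} t"
proof (cases "t \<in> {a<..<b}")
  case True
  have "(\<lambda>n. bump1 n a b t) \<longlonglongrightarrow> 1 * 1"
    unfolding bump1_def using True by (intro tendsto_mult flat0_scaled_tendsto) auto
  then show ?thesis using True by simp
qed (simp add: bump1_outside)

text \<open>The product form splits a test function on a product space into a factor in the
  distinguished variable and one in the parameter (\<open>bump_Pair\<close>), as the du Bois-Reymond
  lemma requires.\<close>

definition bump :: "nat \<Rightarrow> 'a::euclidean_space \<Rightarrow> 'a \<Rightarrow> 'a \<Rightarrow> real" where
  "bump n a b x = (\<Prod>i\<in>Basis. bump1 n (a \<bullet> i) (b \<bullet> i) (x \<bullet> i))"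

lemma bump_real [simp]: "bump n a b (x::real) = bump1 n a b x"
  by (simp add: bump_def)

lemma bump_Pair:
  fixes a1 b1 x1 :: "'a::euclidean_space" and a2 b2 x2 :: "'b::euclidean_space"
  shows "bump n (a1, a2) (b1, b2) (x1, x2) = bump n a1 b1 x1 * bump n a2 b2 x2"
proof -
  have D: "(\<lambda>u::'a. (u, 0::'b)) ` Basis \<inter> (\<lambda>v::'b. (0::'a, v)) ` Basis = {}"
    by auto
  have "inj_on (\<lambda>u::'a. (u, 0::'b)) Basis" "inj_on (\<lambda>v::'b. (0::'a, v)) Basis"
    by (auto simp: inj_on_def)
  then show ?thesis unfolding bump_def Basis_prod_def
    by (subst prod.union_disjoint) (use D in \<open>auto simp: prod.reindex\<close>)
qed

lemma bump_bounds: "0 \<le> bump n a b x" "bump n a b x \<le> 1"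
  unfolding bump_def using bump1_bounds by (auto intro!: prod_nonneg prod_le_1)

lemma bump_outside: "x \<notin> box a b \<Longrightarrow> bump n a b x = 0"
proof -
  assume "x \<notin> box a b"
  then obtain i where "i \<in> Basis" "x \<bullet> i \<notin> {a \<bullet> i<..<b \<bullet> i}" by (auto simp: mem_box)
  then show ?thesis unfolding bump_def
    by (intro prod_zero) (auto intro!: bexI[of _ i] bump1_outside simp del: greaterThanLessThan_iff)
qed

lemma bump_measurable [measurable]: "bump n a b \<in> borel_measurable borel"
proof -
  have "(\<lambda>x. \<Prod>i\<in>Basis. bump1 n (a \<bullet> i) (b \<bullet> i) (x \<bullet> i)) \<in> borel_measurable borel"
    using smooth1_measurable[OF smooth1_bump1] by measurable
  then show ?thesis by (simp add: bump_def[abs_def])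
qed

lemma bump_tendsto: "(\<lambda>n. bump n a b x) \<longlonglongrightarrow> indicator (box a b) x"
proof -
  have "(\<lambda>n. bump n a b x) \<longlonglongrightarrow> (\<Prod>i\<in>Basis. indicator {a \<bullet> i<..<b \<bullet> i} (x \<bullet> i))"
    unfolding bump_def by (intro tendsto_prod bump1_tendsto)
  also have "(\<Prod>i\<in>Basis. indicator {a \<bullet> i<..<b \<bullet> i} (x \<bullet> i) :: real) = indicator (box a b) x"
  proof (cases "x \<in> box a b")
    case False
    then obtain i where "i \<in> Basis" "x \<bullet> i \<notin> {a \<bullet> i<..<b \<bullet> i}" by (auto simp: mem_box)
    then have "(\<Prod>i\<in>Basis. indicator {a \<bullet> i<..<b \<bullet> i} (x \<bullet> i) :: real) = 0"
      by (intro prod_zero) (auto intro!: bexI[of _ i])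
    then show ?thesis using False by simp
  qed (auto simp: mem_box)
  finally show ?thesis .
qed

text \<open>\<open>ennreal\<close> sends negative numbers to 0, so \<open>M1\<close> and
  \<open>M2\<close> have as densities the positive and the negative part of \<open>h\<close>. They
  are finite and equal on boxes, an intersection-stable generator of the Borel sets, hence equal
  everywhere. Equality of the two densities forces both parts to vanish.\<close>

lemma AE_zero_if_box_integrals_zero:
  fixes h :: "'a::euclidean_space \<Rightarrow> real"
  assumes int: "integrable lborel h"
    and zero: "\<And>a b. (LBINT x. indicator (box a b) x * h x) = 0"
  shows "AE x in lborel. h x = 0"
proof -
  have [measurable]: "h \<in> borel_measurable borel" using borel_measurable_integrable[OF int] by simp
  define M1 where "M1 = density lborel (\<lambda>x. ennreal (h x))"
  define M2 where "M2 = density lborel (\<lambda>x. ennreal (- h x))"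
  have intb: "integrable lborel (\<lambda>x. indicator (box a b) x * h x)" for a b :: 'a
    using integrable_mult_indicator[OF _ int, of "box a b"] by simp
  have eq: "emeasure M1 (box a b) = emeasure M2 (box a b)" for a b :: 'a
  proof -
    have 1: "(\<integral>\<^sup>+ x. ennreal (indicator (box a b) x * h x) \<partial>lborel) = emeasure M1 (box a b)"
      unfolding M1_def
      by (subst emeasure_density) (auto intro!: nn_integral_cong simp: indicator_def split: if_splits)
    have 2: "(\<integral>\<^sup>+ x. ennreal (- (indicator (box a b) x * h x)) \<partial>lborel) = emeasure M2 (box a b)"
      unfolding M2_def
      by (subst emeasure_density) (auto intro!: nn_integral_cong simp: indicator_def split: if_splits)
    have f1: "emeasure M1 (box a b) \<noteq> \<infinity>" "emeasure M2 (box a b) \<noteq> \<infinity>"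
      using real_integrable_def[THEN iffD1, OF intb[of a b]] unfolding 1 2 by auto
    have "enn2real (emeasure M1 (box a b)) - enn2real (emeasure M2 (box a b)) = 0"
      using real_lebesgue_integral_def[OF intb[of a b]] zero[of a b] 1 2 by simp
    then show ?thesis using f1
      by (metis ennreal_enn2real eq_iff_diff_eq_0 infinity_ennreal_def top.not_eq_extremum)
  qed
  have fin: "emeasure M1 (box a b) \<noteq> \<infinity>" for a b :: 'a
  proof -
    have "emeasure M1 (box a b) \<le> (\<integral>\<^sup>+ x. ennreal (norm (h x)) \<partial>lborel)"
      unfolding M1_def by (subst emeasure_density) (auto intro!: nn_integral_mono simp: indicator_def ennreal_leI)
    also have "\<dots> < \<infinity>" using int by (simp add: integrable_iff_bounded)
    finally show ?thesis by simp
  qed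
  have "M1 = M2"
  proof (rule measure_eqI_generator_eq[where \<Omega>=UNIV and A="\<lambda>i. box (- (real i *\<^sub>R One)) (real i *\<^sub>R One :: 'a)"])
    show "Int_stable (range (\<lambda>(a, b). box a b :: 'a set))"
      unfolding Int_stable_def by (auto simp: box_Int_box)
    show "\<And>X. X \<in> range (\<lambda>(a, b). box a b) \<Longrightarrow> emeasure M1 X = emeasure M2 X"
      using eq by auto
    show "sets M1 = sigma_sets UNIV (range (\<lambda>(a, b). box a b))" "sets M2 = sigma_sets UNIV (range (\<lambda>(a, b). box a b))"
      unfolding M1_def M2_def by (simp_all add: borel_eq_box)
    show "(\<Union>i. box (- (real i *\<^sub>R One)) (real i *\<^sub>R One)) = (UNIV :: 'a set)"
      by (rule UN_box_eq_UNIV)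
  qed (use fin in auto)
  moreover have "(\<integral>\<^sup>+ x. ennreal (h x) \<partial>lborel) \<noteq> \<infinity>"
    using int by (auto simp: real_integrable_def)
  ultimately have "AE x in lborel. ennreal (h x) = ennreal (- h x)"
    unfolding M1_def M2_def by (subst (asm) finite_density_unique) auto
  then show ?thesis
  proof eventually_elim
    case (elim x)
    then show ?case by (cases "h x \<ge> 0") (auto simp: ennreal_neg)
  qed
qed

text \<open>By Lindelof's theorem countably many open boxes with closure in \<open>U\<close> cover
  \<open>U\<close>, so the exceptional null sets add up to a null set.\<close>

lemma AE_open_if_AE_cbox:
  fixes U :: "'a::euclidean_space set"
  assumes "open U" and "\<And>a b. cbox a b \<subseteq> U \<Longrightarrow> AE x in lborel. x \<in> box a b \<longrightarrow> P x"
  shows "AE x in lborel. x \<in> U \<longrightarrow> P x"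
proof -
  let ?F = "{box a b |a b. cbox a b \<subseteq> U}"
  have "\<exists>D\<subseteq>?F. countable D \<and> \<Union>D = \<Union>?F"
    by (rule Lindelof[of ?F]) (auto simp: open_box)
  then obtain D where sub: "D \<subseteq> ?F" and D: "countable D" "\<Union>D = \<Union>?F" by (elim exE conjE)
  have U: "\<Union>?F = U"
  proof
    show "\<Union>?F \<subseteq> U"
      by (intro Union_least) (use box_subset_cbox in fastforce)
    show "U \<subseteq> \<Union>?F"
    proof
      fix x assume "x \<in> U"
      then obtain a b where "cbox a b \<subseteq> U" "x \<in> box a b"
        using open_contains_cbox[of U] assms(1) by metis
      then show "x \<in> \<Union>?F" by (intro UnionI[of "box a b"]) auto
    qed
  qed
  have "AE x in lborel. \<forall>X\<in>D. x \<in> X \<longrightarrow> P x"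
  proof (subst AE_ball_countable[OF D(1)], intro ballI)
    fix X assume "X \<in> D"
    then obtain a b where "X = box a b" "cbox a b \<subseteq> U" using sub by auto
    then show "AE x in lborel. x \<in> X \<longrightarrow> P x" using assms(2) by simp
  qed
  then show ?thesis
  proof eventually_elim
    case (elim x)
    have "x \<in> U \<Longrightarrow> \<exists>X\<in>D. x \<in> X" using D(2) U by (metis UnionE)
    then show ?case using elim by auto
  qed
qed

text \<open>Only box bumps serve as test functions. By dominated convergence they approach the
  indicators of smaller boxes, which reduces the claim to vanishing box integrals.\<close>

lemma fundamental_lemma:
  fixes h :: "'a::euclidean_space \<Rightarrow> real"
  assumes U: "open U" and int: "\<And>a b. cbox a b \<subseteq> U \<Longrightarrow> set_integrable lborel (box a b) h"
    and zero: "\<And>n a b. cbox a b \<subseteq> U \<Longrightarrow> (LBINT x. h x * bump n a b x) = 0"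
  shows "AE x in lborel. x \<in> U \<longrightarrow> h x = 0"
proof (rule AE_open_if_AE_cbox[OF U])
  fix a b assume ab: "cbox a b \<subseteq> U"
  let ?h = "\<lambda>x. indicator (box a b) x * h x"
  have i: "integrable lborel ?h" using int[OF ab] by (simp add: set_integrable_def)
  have [measurable]: "?h \<in> borel_measurable borel" using borel_measurable_integrable[OF i] by simp
  have "AE x in lborel. ?h x = 0"
  proof (rule AE_zero_if_box_integrals_zero[OF i])
    fix c d
    define c' d' where "c' = (\<Sum>i\<in>Basis. max (a \<bullet> i) (c \<bullet> i) *\<^sub>R i)" and "d' = (\<Sum>i\<in>Basis. min (b \<bullet> i) (d \<bullet> i) *\<^sub>R i)"
    have B: "box a b \<inter> box c d = box c' d'" by (auto simp: box_Int_box c'_def d'_def)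
    show "(LBINT x. indicator (box c d) x * ?h x) = 0"
    proof (cases "box c' d' = {}")
      case True
      then have "(\<lambda>x. indicator (box c d) x * ?h x) = (\<lambda>x. 0)"
        using B by (auto simp: indicator_def fun_eq_iff)
      then show ?thesis by (simp only:) simp
    next
      case False
      have sub: "box c' d' \<subseteq> box a b" using B by auto
      then have "cbox c' d' \<subseteq> cbox a b"
        using False closure_mono[OF sub] closure_box by (metis subset_empty)
      then have z: "(LBINT x. h x * bump n c' d' x) = 0" for n using zero ab by (meson order_trans)
      have "(\<lambda>n. LINT x|lborel. ?h x * bump n c' d' x) \<longlonglongrightarrow> (LBINT x. ?h x * indicator (box c' d') x)"
      proof (rule integral_dominated_convergence[where w="\<lambda>x. norm (?h x)"])
        show "AE x in lborel. (\<lambda>n. ?h x * bump n c' d' x) \<longlonglongrightarrow> ?h x * indicator (box c' d') x"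
          by (intro AE_I2 tendsto_intros bump_tendsto)
        show "AE x in lborel. norm (?h x * bump n c' d' x) \<le> norm (?h x)" for n
          using bump_bounds[of n c' d'] by (intro AE_I2) (auto simp: abs_mult intro!: mult_left_le)
      qed (use i in \<open>auto simp: integrable_norm\<close>)
      moreover have "(\<lambda>x. ?h x * bump n c' d' x) = (\<lambda>x. h x * bump n c' d' x)" for n
        using bump_outside[of _ c' d' n] sub by (auto simp: indicator_def fun_eq_iff)
      ultimately have "(\<lambda>n. 0) \<longlonglongrightarrow> (LBINT x. ?h x * indicator (box c' d') x)"
        by (simp only: z)
      then have "(LBINT x. ?h x * indicator (box c' d') x) = 0"
        by (simp only: LIMSEQ_const_iff)
      moreover have "(\<lambda>x. ?h x * indicator (box c' d') x) = (\<lambda>x. indicator (box c d) x * ?h x)"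
        unfolding B[symmetric] by (auto simp: indicator_def fun_eq_iff)
      ultimately show ?thesis by (simp only:)
    qed
  qed
  then show "AE x in lborel. x \<in> box a b \<longrightarrow> h x = 0"
    by eventually_elim (auto simp: indicator_def split: if_splits)
qed

section \<open>Absolutely continuous functions on an interval\<close>

lemma integrable_indicator_Ioo: "integrable lborel (indicator {a<..<c} :: real \<Rightarrow> real)"
  using emeasure_bounded_finite[of "{a<..<c}"] by (intro integrable_real_indicator) auto

lemma integrable_lborel_pair_mult:
  fixes p :: "'a::euclidean_space \<Rightarrow> real" and q :: "'b::euclidean_space \<Rightarrow> real"
  assumes p: "integrable lborel p" and q: "integrable lborel q"
  shows "integrable (lborel \<Otimes>\<^sub>M lborel) (\<lambda>(x, y). p x * q y)"
proof -
  have [measurable]: "p \<in> borel_measurable borel" "q \<in> borel_measurable borel"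
    using p q by auto
  show ?thesis
    by (rule lborel_pair.Fubini_integrable) (use p q in \<open>auto simp: abs_mult\<close>)
qed

text \<open>Fubini on the two halves r < s and r > s of the plane; the diagonal is a null set. With
  primitives P, Q from minus infinity this is integration by parts, (int p)(int q) = int p Q + int q
  P, for functions that are merely integrable.\<close>

lemma integral_product_split:
  fixes p q :: "real \<Rightarrow> real"
  assumes p: "integrable lborel p" and q: "integrable lborel q"
  shows "(LBINT x. p x) * (LBINT x. q x)
    = (LBINT s. p s * (LBINT r. indicator {..<s} r * q r))
      + (LBINT s. q s * (LBINT r. indicator {..<s} r * p r))"
    and "integrable lborel (\<lambda>s. p s * (LBINT r. indicator {..<s} r * q r))"
proof -
  have [measurable]: "p \<in> borel_measurable borel" "q \<in> borel_measurable borel"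
    using p q by auto
  have int1: "integrable (lborel \<Otimes>\<^sub>M lborel) (\<lambda>(s, r). p s * (indicator {s<..} r * q r))"
    by (rule Bochner_Integration.integrable_bound[OF integrable_lborel_pair_mult[OF p q]])
      (auto simp: indicator_def abs_mult)
  have int2: "integrable (lborel \<Otimes>\<^sub>M lborel) (\<lambda>(s, r). p s * (indicator {..<s} r * q r))"
    by (rule Bochner_Integration.integrable_bound[OF integrable_lborel_pair_mult[OF p q]])
      (auto simp: indicator_def abs_mult)
  have q1: "integrable lborel (\<lambda>r. indicator {..<s} r * q r)" "integrable lborel (\<lambda>r. indicator {s<..} r * q r)" for s
    using integrable_mult_indicator[OF _ q, of "{..<s}"] integrable_mult_indicator[OF _ q, of "{s<..}"] by simp_all
  have split: "(LBINT r. q r) = (LBINT r. indicator {..<s} r * q r) + (LBINT r. indicator {s<..} r * q r)" for s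
  proof -
    have "(LBINT r. q r) = (LBINT r. indicator {..<s} r * q r + indicator {s<..} r * q r)"
    proof (rule integral_cong_AE)
      show "AE r in lborel. q r = indicator {..<s} r * q r + indicator {s<..} r * q r"
        using AE_lborel_singleton[of s] by eventually_elim (auto simp: indicator_def)
    qed auto
    then show ?thesis using q1 by simp
  qed
  show i2: "integrable lborel (\<lambda>s. p s * (LBINT r. indicator {..<s} r * q r))"
    using lborel_pair.integrable_fst'[OF int2] by simp
  have i1: "integrable lborel (\<lambda>s. p s * (LBINT r. indicator {s<..} r * q r))"
    using lborel_pair.integrable_fst'[OF int1] by simp
  have "(LBINT s. p s * (LBINT r. indicator {s<..} r * q r))
      = (LBINT s. (LBINT r. p s * (indicator {s<..} r * q r)))" by simp
  also have "\<dots> = (LBINT r. (LBINT s. p s * (indicator {s<..} r * q r)))"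
    using lborel_pair.Fubini_integral[OF int1] by simp
  also have "\<dots> = (LBINT r. q r * (LBINT s. indicator {..<r} s * p s))"
  proof (rule Bochner_Integration.integral_cong[OF refl])
    fix r
    have "(\<lambda>s. p s * (indicator {s<..} r * q r)) = (\<lambda>s. q r * (indicator {..<r} s * p s))"
      by (auto simp: indicator_def)
    then show "(LBINT s. p s * (indicator {s<..} r * q r)) = q r * (LBINT s. indicator {..<r} s * p s)"
      by simp
  qed
  finally have sw: "(LBINT s. p s * (LBINT r. indicator {s<..} r * q r))
     = (LBINT r. q r * (LBINT s. indicator {..<r} s * p s))" .
  have "(LBINT x. p x) * (LBINT x. q x) = (LBINT s. p s * (LBINT x. q x))"
    by simp
  also have "\<dots> = (LBINT s. p s * (LBINT r. indicator {..<s} r * q r) + p s * (LBINT r. indicator {s<..} r * q r))"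
  proof (rule Bochner_Integration.integral_cong[OF refl])
    fix s
    show "p s * (LBINT x. q x) = p s * (LBINT r. indicator {..<s} r * q r) + p s * (LBINT r. indicator {s<..} r * q r)"
      by (subst split[of s]) (simp only: distrib_left)
  qed
  also have "\<dots> = (LBINT s. p s * (LBINT r. indicator {..<s} r * q r))
      + (LBINT s. p s * (LBINT r. indicator {s<..} r * q r))"
    by (rule Bochner_Integration.integral_add[OF i2 i1])
  finally show "(LBINT x. p x) * (LBINT x. q x)
    = (LBINT s. p s * (LBINT r. indicator {..<s} r * q r))
      + (LBINT s. q s * (LBINT r. indicator {..<s} r * p r))"
    unfolding sw .
qed

text \<open>\<open>k\<close> and \<open>l\<close> are the values at \<open>a\<close> and \<open>c\<close> of the continuous representative of \<open>f\<close>.\<close>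
definition acI :: "real \<Rightarrow> real \<Rightarrow> real \<Rightarrow> real \<Rightarrow> (real \<Rightarrow> real) \<Rightarrow> (real \<Rightarrow> real) \<Rightarrow> bool" where
  "acI a c k l f g \<longleftrightarrow> set_integrable lborel {a<..<c} g \<and> l = k + (LINT s:{a<..<c}|lborel. g s) \<and>
     (AE t in lborel. t \<in> {a<..<c} \<longrightarrow> f t = k + (LINT s:{a<..<t}|lborel. g s))"

text \<open>With primitives \<open>G1\<close>, \<open>G2\<close> of the derivatives the product is
  (k1 + G1)(k2 + G2), and its only quadratic term G1 G2 is rewritten by
  \<open>integral_product_split\<close>. Inside the integral \<open>f1\<close> and \<open>f2\<close>
  may stand for k1 + G1 and k2 + G2, since they agree almost everywhere.\<close>

lemma acI_product:
  assumes 1: "acI a c k1 l1 f1 g1" and 2: "acI a c k2 l2 f2 g2"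
    and [measurable]: "f1 \<in> borel_measurable borel" "f2 \<in> borel_measurable borel"
      "g1 \<in> borel_measurable borel" "g2 \<in> borel_measurable borel"
  shows "acI a c (k1 * k2) (l1 * l2) (\<lambda>t. f1 t * f2 t) (\<lambda>t. g1 t * f2 t + f1 t * g2 t)"
proof -
  define G1 G2 where "G1 t = (LINT s:{a<..<t}|lborel. g1 s)" and "G2 t = (LINT s:{a<..<t}|lborel. g2 s)" for t
  have i1: "set_integrable lborel {a<..<t} g1" and i2: "set_integrable lborel {a<..<t} g2" if "t \<le> c" for t
    using 1 2 that by (auto simp: acI_def intro: set_integrable_subset)
  have ae1: "AE t in lborel. t \<in> {a<..<c} \<longrightarrow> f1 t = k1 + G1 t"
    and ae2: "AE t in lborel. t \<in> {a<..<c} \<longrightarrow> f2 t = k2 + G2 t"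
    using 1 2 by (auto simp: acI_def G1_def G2_def)
  \<comment> \<open>Proved for every t <= c: values t < c give the identity on the interval, t = c
    gives integrability and the right end value.\<close>
  have key: "set_integrable lborel {a<..<t} (\<lambda>s. g1 s * f2 s + f1 s * g2 s) \<and>
      k1 * k2 + (LINT s:{a<..<t}|lborel. g1 s * f2 s + f1 s * g2 s) = (k1 + G1 t) * (k2 + G2 t)"
    if t: "t \<le> c" for t
  proof -
    \<comment> \<open>Cutting both derivatives to (a, t) turns the tails \<open>{..<s}\<close> of
      \<open>integral_product_split\<close> into primitives from \<open>a\<close>.\<close>
    define p q where "p s = indicator {a<..<t} s * g1 s" and "q s = indicator {a<..<t} s * g2 s" for s
    have [measurable]: "p \<in> borel_measurable borel" "q \<in> borel_measurable borel"
      unfolding p_def[abs_def] q_def[abs_def] by measurable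
    have ip: "integrable lborel p" and iq: "integrable lborel q"
      using i1[OF t] i2[OF t] by (simp_all add: p_def[abs_def] q_def[abs_def] set_integrable_def)
    have P: "(LBINT r. indicator {..<s} r * p r) = G1 s" and Q: "(LBINT r. indicator {..<s} r * q r) = G2 s"
      if "s \<in> {a<..<t}" for s
    proof -
      have "(\<lambda>r. indicator {..<s} r * p r) = (\<lambda>r. indicator {a<..<s} r *\<^sub>R g1 r)"
        "(\<lambda>r. indicator {..<s} r * q r) = (\<lambda>r. indicator {a<..<s} r *\<^sub>R g2 r)"
        using that by (auto simp: p_def q_def indicator_def fun_eq_iff)
      then show "(LBINT r. indicator {..<s} r * p r) = G1 s" "(LBINT r. indicator {..<s} r * q r) = G2 s"
        by (simp_all add: G1_def G2_def set_lebesgue_integral_def)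
    qed
    note S1 = integral_product_split[OF ip iq] and S2 = integral_product_split[OF iq ip]
    have sp: "(LBINT x. p x) = G1 t" "(LBINT x. q x) = G2 t"
      by (simp_all add: p_def q_def G1_def G2_def set_lebesgue_integral_def)
    let ?A = "\<lambda>s. p s * (LBINT r. indicator {..<s} r * q r)"
    let ?B = "\<lambda>s. q s * (LBINT r. indicator {..<s} r * p r)"
    let ?R = "\<lambda>s. k2 * p s + ?A s + (k1 * q s + ?B s)"
    have iA: "integrable lborel ?A" and iB: "integrable lborel ?B" using S1(2) S2(2) by simp_all
    have iR: "integrable lborel ?R"
      by (intro Bochner_Integration.integrable_add integrable_mult_right ip iq iA iB)
    have ae: "AE s in lborel. indicator {a<..<t} s *\<^sub>R (g1 s * f2 s + f1 s * g2 s) = ?R s"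
      using ae1 ae2
    proof eventually_elim
      case (elim s)
      show ?case
      proof (cases "s \<in> {a<..<t}")
        case True
        then have "f1 s = k1 + G1 s" "f2 s = k2 + G2 s" using elim t by auto
        then show ?thesis using True P[OF True] Q[OF True]
          by (simp add: p_def q_def algebra_simps)
      qed (auto simp: p_def q_def)
    qed
    have int: "integrable lborel (\<lambda>s. indicator {a<..<t} s *\<^sub>R (g1 s * f2 s + f1 s * g2 s))"
      by (rule integrable_cong_AE_imp[OF iR]) (use ae in \<open>auto simp: eq_commute\<close>)
    have "(LINT s:{a<..<t}|lborel. g1 s * f2 s + f1 s * g2 s) = (LBINT s. ?R s)"
      unfolding set_lebesgue_integral_def
      by (rule integral_cong_AE) (use ae iR in auto)
    also have "\<dots> = k2 * G1 t + k1 * G2 t + (integral\<^sup>L lborel ?A + integral\<^sup>L lborel ?B)"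
      using ip iq iA iB by (simp add: sp)
    also have "integral\<^sup>L lborel ?A + integral\<^sup>L lborel ?B = G1 t * G2 t"
      using S1(1) sp by simp
    finally show ?thesis using int by (simp add: set_integrable_def algebra_simps)
  qed
  have "AE t in lborel. t \<in> {a<..<c} \<longrightarrow> f1 t * f2 t = k1 * k2 + (LINT s:{a<..<t}|lborel. g1 s * f2 s + f1 s * g2 s)"
    using ae1 ae2 by eventually_elim (use key in auto)
  moreover have "l1 * l2 = k1 * k2 + (LINT s:{a<..<c}|lborel. g1 s * f2 s + f1 s * g2 s)"
    using key[of c] 1 2 by (simp add: acI_def G1_def G2_def)
  ultimately show ?thesis using key[of c] unfolding acI_def by simp
qed

lemma integrable_tail_tendsto:
  fixes h :: "real \<Rightarrow> real"
  assumes h: "integrable lborel h"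
  shows "(\<lambda>n. \<integral>s. indicator {..<- real n} s * h s \<partial>lborel) \<longlonglongrightarrow> 0"
    and "(\<lambda>n. \<integral>s. indicator {real n<..} s * h s \<partial>lborel) \<longlonglongrightarrow> 0"
proof -
  have [measurable]: "h \<in> borel_measurable borel" using h by auto
  have ev: "\<forall>\<^sub>F n in sequentially. indicator {..<- real n} s * h s = 0"
    "\<forall>\<^sub>F n in sequentially. indicator {real n<..} s * h s = 0" for s
  proof -
    obtain N where N: "\<bar>s\<bar> < real N" using reals_Archimedean2 by blast
    then have "indicator {..<- real n} s * h s = 0" "indicator {real n<..} s * h s = 0" if "n \<ge> N" for n
    proof -
      have "real N \<le> real n" using that by simp
      then show "indicator {..<- real n} s * h s = 0" "indicator {real n<..} s * h s = 0"
        using N by (auto simp: indicator_def)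
    qed
    then show "\<forall>\<^sub>F n in sequentially. indicator {..<- real n} s * h s = 0"
      "\<forall>\<^sub>F n in sequentially. indicator {real n<..} s * h s = 0"
      by (auto simp: eventually_sequentially)
  qed
  have "(\<lambda>n. \<integral>s. indicator {..<- real n} s * h s \<partial>lborel) \<longlonglongrightarrow> (\<integral>s. 0 \<partial>(lborel :: real measure))"
    by (rule integral_dominated_convergence[where w="\<lambda>s. norm (h s)"])
      (use h in \<open>auto intro!: AE_I2 tendsto_eventually ev simp del: indicator_simps mult_eq_0_iff simp: abs_mult indicator_le_1 mult_left_le_one_le\<close>)
  then show "(\<lambda>n. \<integral>s. indicator {..<- real n} s * h s \<partial>lborel) \<longlonglongrightarrow> 0" by simp
  have "(\<lambda>n. \<integral>s. indicator {real n<..} s * h s \<partial>lborel) \<longlonglongrightarrow> (\<integral>s. 0 \<partial>(lborel :: real measure))"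
    by (rule integral_dominated_convergence[where w="\<lambda>s. norm (h s)"])
      (use h in \<open>auto intro!: AE_I2 tendsto_eventually ev simp del: indicator_simps mult_eq_0_iff simp: abs_mult indicator_le_1 mult_left_le_one_le\<close>)
  then show "(\<lambda>n. \<integral>s. indicator {real n<..} s * h s \<partial>lborel) \<longlonglongrightarrow> 0" by simp
qed

text \<open>Averaging f = c + G over an interval of length 1 gives |c| <= int |f| + sup |G| there.
  When both are controlled by integrals over a tail \<open>A\<close>, letting the tail recede forces
  c = 0.\<close>

lemma const_bound_by_tail:
  fixes f :: "real \<Rightarrow> real"
  assumes f: "integrable lborel f" and w: "integrable lborel w" and I: "\<And>t. t \<in> {u<..<u + 1} \<Longrightarrow> \<bar>G t\<bar> \<le> (LBINT s. indicator A s * w s)"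
    and w0: "\<And>s. w s \<ge> 0" and A: "{u<..<u + 1} \<subseteq> A" "A \<in> sets borel"
    and G[measurable]: "G \<in> borel_measurable borel"
    and ae: "AE t in lborel. t \<in> {u<..<u + 1} \<longrightarrow> f t = c + G t"
  shows "\<bar>c\<bar> \<le> (LBINT s. indicator A s * (\<bar>f s\<bar> + w s))"
proof -
  have [measurable]: "f \<in> borel_measurable borel" "w \<in> borel_measurable borel" "A \<in> sets borel" using f w A by auto
  define J where "J = {u<..<u + 1}"
  let ?W = "\<integral>s. indicator A s * w s \<partial>lborel"
  have iJ: "integrable lborel (\<lambda>s. indicator J s * k)" for k :: real
    unfolding J_def by (intro integrable_mult_left integrable_indicator_Ioo)
  have iA: "integrable lborel (\<lambda>s. indicator A s * h s)" if "integrable lborel h" for h :: "real \<Rightarrow> real"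
    using integrable_mult_indicator[OF _ that, of A] A by simp
  have iJf: "integrable lborel (\<lambda>s. indicator J s * \<bar>f s\<bar>)"
    using integrable_mult_indicator[of J lborel "\<lambda>s. \<bar>f s\<bar>"] f by (simp add: J_def)
  have "\<bar>c\<bar> = (LBINT s. indicator J s * \<bar>c\<bar>)" by (simp add: J_def)
  also have "\<dots> \<le> (LBINT s. indicator J s * \<bar>f s\<bar> + indicator J s * ?W)"
  proof (rule integral_mono_AE[OF iJ Bochner_Integration.integrable_add[OF iJf iJ]])
    show "AE s in lborel. indicator J s * \<bar>c\<bar> \<le> indicator J s * \<bar>f s\<bar> + indicator J s * ?W"
      using ae
    proof eventually_elim
      case (elim s)
      then show ?case using I[of s] by (auto simp: indicator_def J_def)
    qed
  qed
  also have "\<dots> = (LBINT s. indicator J s * \<bar>f s\<bar>) + ?W"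
    using iJf iJ by (subst Bochner_Integration.integral_add) (auto simp: J_def)
  also have "\<dots> \<le> (LBINT s. indicator A s * \<bar>f s\<bar>) + ?W"
  proof -
    have "(LBINT s. indicator J s * \<bar>f s\<bar>) \<le> (LBINT s. indicator A s * \<bar>f s\<bar>)"
      by (rule integral_mono[OF iJf iA]) (use f A in \<open>auto simp: J_def indicator_def\<close>)
    then show ?thesis by simp
  qed
  also have "\<dots> = (LBINT s. indicator A s * (\<bar>f s\<bar> + w s))"
    using f w by (simp add: distrib_left iA)
  finally show ?thesis .
qed

text \<open>The primitive from minus infinity differs from \<open>f\<close> by one constant on the
  whole line. An integrable \<open>f\<close> cannot have a nonzero limit, and its limits at the two
  ends are this constant and, once that is 0, the integral of \<open>g\<close>.\<close>

lemma acI_line: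
  assumes ac: "\<And>n::nat. \<exists>k l. acI (- real n) (real n) k l f g"
    and f: "integrable lborel f" and g: "integrable lborel g"
  shows "AE t in lborel. f t = (LBINT s. indicator {..<t} s * g s)"
    and "(LBINT s. g s) = 0"
proof -
  have [measurable]: "f \<in> borel_measurable borel" "g \<in> borel_measurable borel" using f g by auto
  define G where "G t = (LBINT s. indicator {..<t} s * g s)" for t
  have [measurable]: "G \<in> borel_measurable borel"
  proof -
    have "(\<lambda>t. \<integral>s. (if s < t then 1 else 0) * g s \<partial>lborel) \<in> borel_measurable borel" by measurable
    then show ?thesis unfolding G_def[abs_def] by (simp add: indicator_def lessThan_iff)
  qed
  have ii: "integrable lborel (\<lambda>s. indicator A s * g s)" if "A \<in> sets borel" for A
    using integrable_mult_indicator[OF _ g, of A] that by simp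
  have G_split: "(LINT s:{u<..<t}|lborel. g s) = G t - G u" if "u < t" for u t
  proof -
    have "G t = (LBINT s. indicator {..<u} s * g s + indicator {u<..<t} s * g s)"
      unfolding G_def
    proof (rule integral_cong_AE)
      show "AE s in lborel. indicator {..<t} s * g s = indicator {..<u} s * g s + indicator {u<..<t} s * g s"
        using AE_lborel_singleton[of u] by eventually_elim (use that in \<open>auto simp: indicator_def\<close>)
    qed auto
    also have "\<dots> = G u + (LINT s:{u<..<t}|lborel. g s)"
      using ii by (simp add: G_def set_lebesgue_integral_def)
    finally show ?thesis by simp
  qed
  have "\<exists>c. AE t in lborel. t \<in> {- real n<..<real n} \<longrightarrow> f t = c + G t" for n :: nat
  proof -
    obtain k l where "acI (- real n) (real n) k l f g" using ac by blast
    then have "AE t in lborel. t \<in> {- real n<..<real n} \<longrightarrow> f t = k + (LINT s:{- real n<..<t}|lborel. g s)"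
      by (auto simp: acI_def)
    then have "AE t in lborel. t \<in> {- real n<..<real n} \<longrightarrow> f t = (k - G (- real n)) + G t"
      by eventually_elim (auto simp: G_split)
    then show ?thesis by blast
  qed
  then obtain C where C: "AE t in lborel. t \<in> {- real n<..<real n} \<longrightarrow> f t = C n + G t" for n :: nat
    by metis
  define c where "c = C 1"
  \<comment> \<open>The constants are compared on (-1, 1), which lies in every interval with n > 0
    and is not a null set.\<close>
  have Cc: "C n = c" if "n > 0" for n
  proof (rule ccontr)
    assume "C n \<noteq> c"
    have "AE t in lborel. t \<notin> {-1<..<1::real}"
      using C[of n] C[of 1]
    proof eventually_elim
      case (elim t)
      have "1 \<le> real n" using that by simp
      then show ?case using elim \<open>C n \<noteq> c\<close> by (auto simp: c_def)
    qed
    then have "{-1<..<1::real} \<in> null_sets lborel" by (simp add: AE_iff_null_sets)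
    then show False by (auto simp: null_sets_def)
  qed
  have "AE t in lborel. \<forall>n. n > 0 \<longrightarrow> t \<in> {- real n<..<real n} \<longrightarrow> f t = c + G t"
  proof (subst AE_all_countable, intro allI)
    fix n :: nat
    show "AE t in lborel. n > 0 \<longrightarrow> t \<in> {- real n<..<real n} \<longrightarrow> f t = c + G t"
      using C[of n] by eventually_elim (use Cc[of n] in auto)
  qed
  then have ae: "AE t in lborel. f t = c + G t"
  proof eventually_elim
    case (elim t)
    obtain N where "\<bar>t\<bar> < real N" using reals_Archimedean2 by blast
    then show ?case using elim by (intro elim[rule_format, of N]) auto
  qed
  have Gl: "\<bar>G t\<bar> \<le> (LBINT s. indicator {..<u} s * \<bar>g s\<bar>)" if "t \<le> u" for t u
  proof -
    have "\<bar>G t\<bar> \<le> (LBINT s. \<bar>indicator {..<t} s * g s\<bar>)"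
      unfolding G_def by (rule integral_abs_bound)
    also have "\<dots> \<le> (LBINT s. indicator {..<u} s * \<bar>g s\<bar>)"
    proof (rule integral_mono)
      show "integrable lborel (\<lambda>s. indicator {..<u} s * \<bar>g s\<bar>)"
        using integrable_mult_indicator[of "{..<u}" lborel "\<lambda>s. \<bar>g s\<bar>"] g by simp
      show "integrable lborel (\<lambda>s. \<bar>indicator {..<t} s * g s\<bar>)" using ii by simp
    qed (use that in \<open>auto simp: indicator_def\<close>)
    finally show ?thesis .
  qed
  have Gr: "\<bar>G t - integral\<^sup>L lborel g\<bar> \<le> (LBINT s. indicator {u<..} s * \<bar>g s\<bar>)" if "u \<le> t" for t u
  proof -
    have "integral\<^sup>L lborel g = (LBINT s. indicator {..<t} s * g s + indicator {t<..} s * g s)"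
    proof (rule integral_cong_AE)
      show "AE s in lborel. g s = indicator {..<t} s * g s + indicator {t<..} s * g s"
        using AE_lborel_singleton[of t] by eventually_elim (auto simp: indicator_def)
    qed auto
    also have "\<dots> = G t + (LBINT s. indicator {t<..} s * g s)"
      using ii by (simp add: G_def)
    finally have "\<bar>G t - integral\<^sup>L lborel g\<bar> = \<bar>\<integral>s. indicator {t<..} s * g s \<partial>lborel\<bar>" by simp
    also have "\<dots> \<le> (LBINT s. \<bar>indicator {t<..} s * g s\<bar>)" by (rule integral_abs_bound)
    also have "\<dots> \<le> (LBINT s. indicator {u<..} s * \<bar>g s\<bar>)"
    proof (rule integral_mono)
      show "integrable lborel (\<lambda>s. indicator {u<..} s * \<bar>g s\<bar>)"
        using integrable_mult_indicator[of "{u<..}" lborel "\<lambda>s. \<bar>g s\<bar>"] g by simp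
      show "integrable lborel (\<lambda>s. \<bar>indicator {t<..} s * g s\<bar>)" using ii by simp
    qed (use that in \<open>auto simp: indicator_def\<close>)
    finally show ?thesis .
  qed
  have iw: "integrable lborel (\<lambda>s. \<bar>f s\<bar> + \<bar>g s\<bar>)" using f g by auto
  \<comment> \<open>The unit interval ends at -n, inside the left tail, where |G| is at most the
    tail integral of |g|.\<close>
  have "\<bar>c\<bar> \<le> (LBINT s. indicator {..<- real n} s * (\<bar>f s\<bar> + \<bar>g s\<bar>))" for n
    by (rule const_bound_by_tail[where u="- real n - 1" and G=G, OF f integrable_abs[OF g]])
      (use Gl ae in \<open>auto elim: eventually_mono\<close>)
  then have "\<bar>c\<bar> \<le> 0"
    using integrable_tail_tendsto(1)[OF iw] by (intro LIMSEQ_le_const) auto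
  then have c: "c = 0" by simp
  show "AE t in lborel. f t = (LBINT s. indicator {..<t} s * g s)"
    using ae unfolding c G_def by simp
  have "\<bar>integral\<^sup>L lborel g\<bar> \<le> (LBINT s. indicator {real n<..} s * (\<bar>f s\<bar> + \<bar>g s\<bar>))" for n
    by (rule const_bound_by_tail[where u="real n" and G="\<lambda>t. G t - integral\<^sup>L lborel g", OF f integrable_abs[OF g]])
      (use Gr ae c in \<open>auto elim: eventually_mono\<close>)
  then have "\<bar>integral\<^sup>L lborel g\<bar> \<le> 0"
    using integrable_tail_tendsto(2)[OF iw] by (intro LIMSEQ_le_const) auto
  then show "(LBINT s. g s) = 0" by simp
qed

section \<open>The du Bois-Reymond lemma with a parameter\<close>

lemma borel_measurable_fst [measurable]: "fst \<in> (borel :: ('a::second_countable_topology \<times> 'b::second_countable_topology) measure) \<rightarrow>\<^sub>M borel"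
  and borel_measurable_snd [measurable]: "snd \<in> (borel :: ('a::second_countable_topology \<times> 'b::second_countable_topology) measure) \<rightarrow>\<^sub>M borel"
  by (auto intro!: borel_measurable_continuous_onI continuous_intros)

lemma
  fixes f :: "'a::euclidean_space \<times> 'b::euclidean_space \<Rightarrow> real"
  assumes f: "integrable lborel f"
  shows AE_integrable_lborel_fst: "AE x in lborel. integrable lborel (\<lambda>y. f (x, y))"
    and integrable_lborel_fst: "integrable lborel (\<lambda>x. \<integral>y. f (x, y) \<partial>lborel)"
    and integral_lborel_fst: "(LBINT x. (LBINT y. f (x, y))) = integral\<^sup>L lborel f"
    and AE_integrable_lborel_snd: "AE y in lborel. integrable lborel (\<lambda>x. f (x, y))"
    and integrable_lborel_snd: "integrable lborel (\<lambda>y. \<integral>x. f (x, y) \<partial>lborel)"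
    and integral_lborel_snd: "(LBINT y. (LBINT x. f (x, y))) = integral\<^sup>L lborel f"
proof -
  have f': "integrable (lborel \<Otimes>\<^sub>M lborel) (\<lambda>(x, y). f (x, y))" using f by (simp add: lborel_prod)
  show "AE x in lborel. integrable lborel (\<lambda>y. f (x, y))"
    by (rule lborel_pair.AE_integrable_fst[OF f'])
  show "integrable lborel (\<lambda>x. \<integral>y. f (x, y) \<partial>lborel)"
    by (rule lborel_pair.integrable_fst[OF f'])
  show "(LBINT x. (LBINT y. f (x, y))) = integral\<^sup>L lborel f"
    using lborel_pair.integral_fst[OF f'] by (simp add: lborel_prod)
  show "AE y in lborel. integrable lborel (\<lambda>x. f (x, y))"
    by (rule lborel_pair.AE_integrable_snd[OF f'])
  show "integrable lborel (\<lambda>y. \<integral>x. f (x, y) \<partial>lborel)"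
    by (rule lborel_pair.integrable_snd[OF f'])
  show "(LBINT y. (LBINT x. f (x, y))) = integral\<^sup>L lborel f"
    using lborel_pair.integral_snd[OF f'] by (simp add: lborel_prod)
qed

lemma integrable_lborel_mult_pair:
  fixes p :: "'a::euclidean_space \<Rightarrow> real" and q :: "'b::euclidean_space \<Rightarrow> real"
  assumes "integrable lborel p" "integrable lborel q"
  shows "integrable lborel (\<lambda>z. p (fst z) * q (snd z))"
  using integrable_lborel_pair_mult[OF assms] by (simp add: lborel_prod case_prod_unfold)

lemma AE_lborel_pair:
  fixes P :: "'a::euclidean_space \<times> 'b::euclidean_space \<Rightarrow> bool"
  assumes "AE z in lborel. P z"
  shows "AE x in lborel. AE y in lborel. P (x, y)" and "AE y in lborel. AE x in lborel. P (x, y)"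
proof -
  have *: "AE z in lborel \<Otimes>\<^sub>M lborel. P z" using assms unfolding lborel_prod .
  show "AE x in lborel. AE y in lborel. P (x, y)" using lborel_pair.AE_pair[OF *] .
  have "AE z in distr (lborel \<Otimes>\<^sub>M lborel) (lborel \<Otimes>\<^sub>M lborel) (\<lambda>(x, y). (y, x)). P z"
    using lborel_pair.distr_pair_swap[where ?'a='a and ?'b='b] * by argo
  then have "AE z in lborel \<Otimes>\<^sub>M lborel. P (case z of (x, y) \<Rightarrow> (y, x))"
    by (rule AE_distrD[rotated]) (rule measurable_pair_swap')
  then have "AE y in lborel. AE x in lborel. P (case (y, x) of (x, y) \<Rightarrow> (y, x))"
    by (rule lborel_pair.AE_pair)
  then show "AE y in lborel. AE x in lborel. P (x, y)" by simp
qed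

text \<open>Null sections imply a null set only for measurable sets, whence the first
  premise.\<close>

lemma AE_lborel_pairI:
  fixes P :: "'a::euclidean_space \<times> 'b::euclidean_space \<Rightarrow> bool"
  assumes "{z. P z} \<in> sets borel" "AE x in lborel. AE y in lborel. P (x, y)"
  shows "AE z in lborel. P z"
proof -
  have "AE z in lborel \<Otimes>\<^sub>M lborel. P z"
  proof (rule lborel_pair.AE_pair_measure)
    have "{z. P z} \<in> sets (lborel :: ('a \<times> 'b) measure)" using assms by simp
    then show "{x \<in> space (lborel \<Otimes>\<^sub>M lborel). P x} \<in> sets (lborel \<Otimes>\<^sub>M lborel)"
      unfolding lborel_prod by simp
  qed (rule assms(2))
  then show ?thesis unfolding lborel_prod .
qed

lemma AE_lborel_pairI_snd:
  fixes P :: "'a::euclidean_space \<times> 'b::euclidean_space \<Rightarrow> bool"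
  assumes P: "{z. P z} \<in> sets borel" and ae: "AE y in lborel. AE x in lborel. P (x, y)"
  shows "AE z in lborel. P z"
proof (rule AE_lborel_pairI[OF P])
  have "{z \<in> space (lborel \<Otimes>\<^sub>M lborel). P (fst z, snd z)} \<in> sets (lborel \<Otimes>\<^sub>M (lborel :: 'b measure))"
    unfolding lborel_prod using P by simp
  from lborel_pair.AE_commute[OF this] ae show "AE x in lborel. AE y in lborel. P (x, y)" by simp
qed

text \<open>Smooth functions with compact support in the open interval from \<open>a\<close> to
  \<open>c\<close>. Explicit support bounds make sums and the fundamental theorem of calculus easy
  to handle.\<close>

definition ctest :: "real \<Rightarrow> real \<Rightarrow> (real \<Rightarrow> real) \<Rightarrow> bool" where
  "ctest a c \<eta> \<longleftrightarrow> smooth1 \<eta> \<and> (\<exists>r s. a < r \<and> r \<le> s \<and> s < c \<and> (\<forall>t. t < r \<or> s < t \<longrightarrow> \<eta> t = 0))"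

lemma ctest_bump1: "a < r \<Longrightarrow> r \<le> s \<Longrightarrow> s < c \<Longrightarrow> ctest a c (bump1 n r s)"
  unfolding ctest_def using smooth1_bump1 bump1_outside
  by (metis greaterThanLessThan_iff less_asym)

lemma ctest_outside: "ctest a c \<eta> \<Longrightarrow> t \<notin> {a<..<c} \<Longrightarrow> \<eta> t = 0"
  unfolding ctest_def by fastforce

lemma ctest_lincomb:
  assumes "ctest a c \<alpha>" "ctest a c \<beta>" shows "ctest a c (\<lambda>t. k * \<alpha> t + \<beta> t)"
proof -
  obtain r s r' s' where "a < r" "r \<le> s" "s < c" "\<And>t. t < r \<or> s < t \<Longrightarrow> \<alpha> t = 0"
    and "a < r'" "r' \<le> s'" "s' < c" "\<And>t. t < r' \<or> s' < t \<Longrightarrow> \<beta> t = 0"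
    using assms unfolding ctest_def by metis
  then have "a < min r r' \<and> min r r' \<le> max s s' \<and> max s s' < c \<and>
    (\<forall>t. t < min r r' \<or> max s s' < t \<longrightarrow> k * \<alpha> t + \<beta> t = 0)" by auto
  then show ?thesis using assms smooth1_lincomb unfolding ctest_def by blast
qed

lemma ctest_integrable: assumes "ctest a c \<alpha>" shows "integrable lborel \<alpha>"
proof -
  obtain r s where "\<And>t. t < r \<or> s < t \<Longrightarrow> \<alpha> t = 0" and "smooth1 \<alpha>"
    using assms unfolding ctest_def by metis
  then have nz: "\<And>t. \<alpha> t \<noteq> 0 \<Longrightarrow> r \<le> t \<and> t \<le> s" by (meson not_le)
  have "integrable lborel (\<lambda>x. indicator {r..s} x *\<^sub>R \<alpha> x)" using \<open>smooth1 \<alpha>\<close>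
    by (intro borel_integrable_compact smooth1_continuous) auto
  then show ?thesis
    by (rule back_subst[of "integrable lborel"]) (auto simp: indicator_def fun_eq_iff dest: nz)
qed

lemma ctest_bounded: assumes "ctest a c \<alpha>" obtains M where "\<And>t. \<bar>\<alpha> t\<bar> \<le> M"
proof -
  obtain r s where rs: "\<And>t. t < r \<or> s < t \<Longrightarrow> \<alpha> t = 0" and "smooth1 \<alpha>"
    using assms unfolding ctest_def by metis
  then have "compact (\<alpha> ` {r..s})"
    by (intro compact_continuous_image smooth1_continuous) auto
  then obtain M where M: "\<forall>x\<in>\<alpha> ` {r..s}. norm x \<le> M"
    using compact_imp_bounded bounded_iff by metis
  have "\<bar>\<alpha> t\<bar> \<le> max M 0" for t
  proof (cases "t \<in> {r..s}")
    case True
    then have "norm (\<alpha> t) \<le> M" using M by blast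
    then show ?thesis by simp
  qed (use rs in \<open>auto simp: not_le\<close>)
  then show ?thesis using that by blast
qed

lemma ctest_deriv: assumes "ctest a c \<alpha>" shows "ctest a c (deriv \<alpha>)"
proof -
  obtain r s where rs: "a < r" "r \<le> s" "s < c" "\<And>t. t < r \<or> s < t \<Longrightarrow> \<alpha> t = 0" and sm: "smooth1 \<alpha>"
    using assms unfolding ctest_def by metis
  have "deriv \<alpha> t = 0" if "t < r \<or> s < t" for t
  proof -
    have "\<forall>\<^sub>F x in nhds t. \<alpha> x = 0"
      unfolding eventually_nhds using rs(4) that
      by (intro exI[of _ "- {r..s}"]) (auto simp: open_Compl not_le)
    then have "deriv \<alpha> t = deriv (\<lambda>_. 0) t" by (rule deriv_cong_ev) simp
    then show ?thesis by simp
  qed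
  then show ?thesis using rs smooth1_deriv[OF sm] unfolding ctest_def by blast
qed

lemma ctest_tail_integral:
  assumes "ctest a c \<eta>"
  shows "(LBINT r. indicator {..<t} r * deriv \<eta> r) = \<eta> t" and "(LBINT r. deriv \<eta> r) = 0"
proof -
  obtain r s where rs: "r \<le> s" "\<And>t. t < r \<or> s < t \<Longrightarrow> \<eta> t = 0" and sm: "smooth1 \<eta>"
    using assms unfolding ctest_def by metis
  obtain r' s' where rs': "r' \<le> s'" "\<And>t. t < r' \<or> s' < t \<Longrightarrow> deriv \<eta> t = 0"
    using ctest_deriv[OF assms] unfolding ctest_def by metis
  then have nz: "\<And>t. deriv \<eta> t \<noteq> 0 \<Longrightarrow> r' \<le> t \<and> t \<le> s'" by (meson not_le)
  have [measurable]: "deriv \<eta> \<in> borel_measurable borel" using smooth1_measurable[OF smooth1_deriv[OF sm]] .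
  have FTC: "(LBINT x. deriv \<eta> x * indicator {u .. v} x) = \<eta> v - \<eta> u" if "u \<le> v" for u v
    by (rule integral_FTC_Icc_real[OF that smooth1_has_deriv[OF sm]])
      (use DERIV_isCont[OF smooth1_has_deriv[OF smooth1_deriv[OF sm]]] in auto)
  \<comment> \<open>The lower limit is placed to the left of the supports of \<eta> and of its
    derivative.\<close>
  obtain u where u: "u < t" "u < r" "u < r'" by (rule that[of "min t (min r r') - 1"]) auto
  have "(LBINT r. indicator {..<t} r * deriv \<eta> r) = (LBINT x. deriv \<eta> x * indicator {u .. t} x)"
  proof (rule integral_cong_AE)
    show "AE x in lborel. indicator {..<t} x * deriv \<eta> x = deriv \<eta> x * indicator {u..t} x"
      using AE_lborel_singleton[of t]
      by eventually_elim (use rs'(2) u in \<open>auto simp: indicator_def\<close>)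
  qed auto
  then show "(LBINT r. indicator {..<t} r * deriv \<eta> r) = \<eta> t"
    using FTC[of u t] rs(2)[of u] u by simp
  obtain v where v: "v < r" "v < r'" by (rule that[of "min r r' - 1"]) auto
  obtain w where w: "s < w" "s' < w" by (rule that[of "max s s' + 1"]) auto
  have "(LBINT x. deriv \<eta> x) = (LBINT x. deriv \<eta> x * indicator {v .. w} x)"
    by (rule Bochner_Integration.integral_cong) (use v w in \<open>force simp: indicator_def dest: nz\<close>)+
  then show "(LBINT x. deriv \<eta> x) = 0"
    using FTC[of v w] rs v w by simp
qed

lemma smooth1_antideriv:
  assumes "\<And>t. (F has_real_derivative \<gamma> t) (at t)" "smooth1 \<gamma>"
  shows "smooth1 F"
proof (rule smooth1_coinduct[where C="insert F (Collect smooth1)"])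
  have "deriv F = \<gamma>" using assms(1) DERIV_imp_deriv by blast
  then show "(\<forall>t. g differentiable (at t)) \<and> deriv g \<in> insert F (Collect smooth1)"
    if "g \<in> insert F (Collect smooth1)" for g
    using that assms smooth1_deriv smooth1_differentiable real_differentiable_def by auto
qed simp

text \<open>The primitive starting left of the support is constant to the right of it, equal to the
  integral of \<gamma>. Mean zero is thus exactly what makes it compactly supported.\<close>

lemma ctest_antideriv:
  assumes "ctest a c \<gamma>" "(LBINT t. \<gamma> t) = 0"
  obtains \<eta> where "ctest a c \<eta>" "deriv \<eta> = \<gamma>"
proof -
  obtain r s where rs: "a < r" "r \<le> s" "s < c" "\<And>t. t < r \<or> s < t \<Longrightarrow> \<gamma> t = 0" and sm: "smooth1 \<gamma>"
    using assms unfolding ctest_def by metis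
  have nz: "\<And>t. \<gamma> t \<noteq> 0 \<Longrightarrow> r \<le> t \<and> t \<le> s" by (meson not_le rs(4))
  have cont: "isCont \<gamma> x" for x using DERIV_isCont[OF smooth1_has_deriv[OF sm]] .
  have "\<exists>F. \<forall>x :: real. -\<infinity> < ereal x \<longrightarrow> ereal x < \<infinity> \<longrightarrow> (F has_vector_derivative \<gamma> x) (at x)"
    by (rule einterval_antiderivative) (auto simp: cont)
  then obtain F where F: "\<And>x. (F has_real_derivative \<gamma> x) (at x)"
    by (auto simp: has_real_derivative_iff_has_vector_derivative)
  have FTC: "(LBINT x. \<gamma> x * indicator {u .. v} x) = F v - F u" if "u \<le> v" for u v
    by (rule integral_FTC_Icc_real[OF that F]) (rule cont)
  define \<eta> where "\<eta> t = F t - F r" for t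
  have D: "(\<eta> has_real_derivative \<gamma> t) (at t)" for t
    unfolding \<eta>_def using F by (auto intro!: derivative_eq_intros)
  have "\<eta> t = 0" if t: "t < r \<or> s < t" for t
  proof (cases "t < r")
    case True
    have "(LBINT x. \<gamma> x * indicator {t .. r} x) = (\<integral>x. 0 \<partial>(lborel :: real measure))"
    proof (rule integral_cong_AE)
      show "AE x in lborel. \<gamma> x * indicator {t..r} x = 0"
        using AE_lborel_singleton[of r] by eventually_elim (use rs(4) in \<open>auto simp: indicator_def\<close>)
    qed (use smooth1_measurable[OF sm] in auto)
    then show ?thesis using FTC[of t r] True by (simp add: \<eta>_def)
  next
    case False
    have "(LBINT x. \<gamma> x * indicator {r .. t} x) = (LBINT x. \<gamma> x)"
      by (rule Bochner_Integration.integral_cong) (use t False in \<open>force simp: indicator_def dest: nz\<close>)+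
    then show ?thesis using FTC[of r t] False assms by (simp add: \<eta>_def)
  qed
  then have "ctest a c \<eta>" using rs smooth1_antideriv[OF D sm] unfolding ctest_def by blast
  moreover have "deriv \<eta> = \<gamma>" using D DERIV_imp_deriv by blast
  ultimately show ?thesis using that by blast
qed

text \<open>The difference \<open>D\<close> of \<open>f\<close> and the primitive of \<open>g\<close> has weak derivative \<open>0\<close> in \<open>t\<close>. If \<open>\<beta>\<close> has
  integral \<open>1\<close>, then \<open>\<alpha> - (\<integral>\<alpha>) \<beta>\<close> is the derivative of a test function, so \<open>D\<close> agrees almost everywhere
  with its \<open>\<beta>\<close>-mean \<open>C\<close>, which does not depend on \<open>t\<close>.\<close>
lemma parametric_du_Bois_Reymond:
  fixes f g :: "real \<times> 'b::euclidean_space \<Rightarrow> real"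
  assumes ac: "a < c" and V: "open V"
    and mf [measurable]: "f \<in> borel_measurable borel" and mg [measurable]: "g \<in> borel_measurable borel"
    and sf: "\<And>z. fst z \<notin> {a<..<c} \<Longrightarrow> f z = 0" and sg: "\<And>z. fst z \<notin> {a<..<c} \<Longrightarrow> g z = 0"
    and intf: "\<And>l u. cbox l u \<subseteq> V \<Longrightarrow> integrable lborel (\<lambda>z. f z * indicator (box l u) (snd z))"
    and intg: "\<And>l u. cbox l u \<subseteq> V \<Longrightarrow> integrable lborel (\<lambda>z. g z * indicator (box l u) (snd z))"
    and weak: "\<And>n l u \<eta>. cbox l u \<subseteq> V \<Longrightarrow> ctest a c \<eta> \<Longrightarrow>
      (LBINT z. f z * (deriv \<eta> (fst z) * bump n l u (snd z)))
        = - (LBINT z. g z * (\<eta> (fst z) * bump n l u (snd z)))"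
  shows "AE p in lborel. p \<in> V \<longrightarrow> (\<exists>k l. acI a c k l (\<lambda>t. f (t, p)) (\<lambda>t. g (t, p)))"
proof -
  \<comment> \<open>The \<open>if\<close> makes joint measurability in the upper limit and the
    parameter easy to derive; by \<open>sg\<close> this is the primitive from
    \<open>a\<close>.\<close>
  define G where "G z = (LBINT s. (if s < fst z then 1 else 0) * g (s, snd z))" for z
  have G_meas [measurable]: "G \<in> borel_measurable borel"
  proof -
    have "G \<in> borel_measurable (lborel \<Otimes>\<^sub>M lborel)"
      unfolding G_def[abs_def] by (rule lborel.borel_measurable_lebesgue_integral) measurable
    then show ?thesis by (simp add: borel_prod lborel_prod)
  qed
  have G_ind: "G (t, p) = (LBINT s. indicator {..<t} s * g (s, p))" for t p
    unfolding G_def by (simp add: indicator_def lessThan_iff of_bool_def)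
  define r0 s0 where "r0 = (2 * a + c) / 3" and "s0 = (a + 2 * c) / 3"
  have rs0: "a < r0" "r0 < s0" "s0 < c" using ac by (auto simp: r0_def s0_def)
  define k0 where "k0 = (LBINT t. bump1 1 r0 s0 t)"
  \<comment> \<open>This is \<open>bump1 1 r0 s0 / k0\<close>, in the shape that
    \<open>ctest_lincomb\<close> accepts.\<close>
  define \<beta> where "\<beta> t = (1 / k0 - 1) * bump1 1 r0 s0 t + bump1 1 r0 s0 t" for t
  have b0: "ctest a c (bump1 1 r0 s0)" using rs0 by (intro ctest_bump1) auto
  then have \<beta>: "ctest a c \<beta>" unfolding \<beta>_def[abs_def] by (intro ctest_lincomb)
  have "k0 \<noteq> 0"
  proof
    assume "k0 = 0"
    then have "AE t in lborel. bump1 1 r0 s0 t = 0"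
      unfolding k0_def
      by (subst (asm) integral_nonneg_eq_0_iff_AE[OF ctest_integrable[OF b0]]) (auto simp: bump1_bounds)
    then have "AE t in lborel. t \<notin> {r0<..<s0}"
      by eventually_elim (use bump1_pos[of 1 _ r0 s0] in fastforce)
    then have "{r0<..<s0} \<in> null_sets lborel" by (simp add: AE_iff_null_sets)
    then show False using rs0 by (auto simp: null_sets_def)
  qed
  then have \<beta>1: "(LBINT t. \<beta> t) = 1"
    using ctest_integrable[OF b0] by (simp add: \<beta>_def k0_def field_simps)
  obtain M where M: "\<And>t. \<bar>\<beta> t\<bar> \<le> M" using ctest_bounded[OF \<beta>] by blast
  have [measurable]: "\<beta> \<in> borel_measurable borel" using ctest_integrable[OF \<beta>] by auto
  \<comment> \<open>To the right of \<open>c\<close> the primitive \<open>G\<close> stays constant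
    in t, so it is cut off to keep \<open>D\<close> integrable.\<close>
  define D where "D z = f z - indicator {a<..<c} (fst z) * G z" for z
  have [measurable]: "D \<in> borel_measurable borel" unfolding D_def[abs_def] by measurable
  define C where "C p = (LBINT t. \<beta> t * D (t, p))" for p
  have C_meas [measurable]: "C \<in> borel_measurable borel"
    unfolding C_def[abs_def] by (rule lborel.borel_measurable_lebesgue_integral[where N=borel, simplified]) measurable
  define h where "h z = D z - indicator {a<..<c} (fst z) * C (snd z)" for z
  have [measurable]: "h \<in> borel_measurable borel" unfolding h_def[abs_def] by measurable
  have intG: "integrable lborel (\<lambda>z. indicator {a<..<c} (fst z) * G z * indicator (box l u) (snd z))"
    and intD: "integrable lborel (\<lambda>z. D z * indicator (box l u) (snd z))"
    and inth: "integrable lborel (\<lambda>z. h z * indicator (box l u) (snd z))"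
    and intC: "integrable lborel (\<lambda>p. C p * indicator (box l u) p)"
    if "cbox l u \<subseteq> V" for l u
  proof -
    \<comment> \<open>The L1 norm of the slice of \<open>g\<close> at \<open>p\<close>, restricted
      to the box. It dominates \<open>G\<close> along the whole slice and is integrable in
      \<open>p\<close>.\<close>
    let ?m = "\<lambda>p. \<integral>s. norm (g (s, p) * indicator (box l u) p) \<partial>lborel"
    have im: "integrable lborel ?m"
      using integrable_lborel_snd[OF integrable_norm[OF intg[OF that]]] by simp
    have aeg: "AE p in lborel. integrable lborel (\<lambda>s. g (s, p) * indicator (box l u) p)"
      using AE_integrable_lborel_snd[OF intg[OF that]] by simp
    have aeG: "AE p in lborel. \<forall>t. \<bar>G (t, p) * indicator (box l u) p\<bar> \<le> ?m p"
      using aeg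
    proof eventually_elim
      case (elim p)
      show ?case
      proof
        fix t
        have "G (t, p) * indicator (box l u) p = (LBINT s. indicator {..<t} s * (g (s, p) * indicator (box l u) p))"
          unfolding G_ind by (simp add: mult.assoc[symmetric])
        also have "\<bar>\<dots>\<bar> \<le> (LBINT s. \<bar>indicator {..<t} s * (g (s, p) * indicator (box l u) p)\<bar>)"
          by (rule integral_abs_bound)
        also have "\<dots> \<le> ?m p"
          by (rule integral_mono'[OF integrable_norm[OF elim]]) (auto simp: indicator_def)
        finally show "\<bar>G (t, p) * indicator (box l u) p\<bar> \<le> ?m p" .
      qed
    qed
    show iG: "integrable lborel (\<lambda>z. indicator {a<..<c} (fst z) * G z * indicator (box l u) (snd z))"
    proof (rule Bochner_Integration.integrable_bound[OF integrable_lborel_mult_pair[OF integrable_indicator_Ioo im]])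
      have "AE z in lborel. \<bar>G z * indicator (box l u) (snd z)\<bar> \<le> ?m (snd z)"
      proof (rule AE_lborel_pairI)
        have "(\<lambda>p. ?m p) \<in> borel_measurable borel" using im by auto
        then show "{z. \<bar>G z * indicator (box l u) (snd z)\<bar> \<le> ?m (snd z)} \<in> sets borel"
          by measurable
        show "AE x in lborel. AE y in lborel. \<bar>G (x, y) * indicator (box l u) (snd (x, y))\<bar> \<le> ?m (snd (x, y))"
        proof (rule AE_I2)
          fix x
          show "AE y in lborel. \<bar>G (x, y) * indicator (box l u) (snd (x, y))\<bar> \<le> ?m (snd (x, y))"
            using aeG by eventually_elim simp
        qed
      qed
      then show "AE z in lborel. norm (indicator {a<..<c} (fst z) * G z * indicator (box l u) (snd z))
          \<le> norm (indicator {a<..<c} (fst z) * ?m (snd z))"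
        by eventually_elim (auto simp: indicator_def)
    qed measurable
    show iD: "integrable lborel (\<lambda>z. D z * indicator (box l u) (snd z))"
      using Bochner_Integration.integrable_diff[OF intf[OF that] iG] by (simp add: D_def left_diff_distrib)
    have ibD: "integrable lborel (\<lambda>z. \<beta> (fst z) * D z * indicator (box l u) (snd z))"
    proof (rule Bochner_Integration.integrable_bound[OF integrable_mult_right[OF iD, of M]])
      show "AE z in lborel. norm (\<beta> (fst z) * D z * indicator (box l u) (snd z)) \<le> norm (M * (D z * indicator (box l u) (snd z)))"
      proof (intro AE_I2)
        fix z :: "real \<times> 'b"
        have "\<bar>\<beta> (fst z)\<bar> \<le> \<bar>M\<bar>" using M[of "fst z"] by linarith
        then show "norm (\<beta> (fst z) * D z * indicator (box l u) (snd z)) \<le> norm (M * (D z * indicator (box l u) (snd z)))"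
          by (simp add: abs_mult mult.assoc mult_right_mono)
      qed
    qed measurable
    show iC: "integrable lborel (\<lambda>p. C p * indicator (box l u) p)"
      using integrable_lborel_snd[OF ibD] by (simp add: C_def)
    show "integrable lborel (\<lambda>z. h z * indicator (box l u) (snd z))"
      using Bochner_Integration.integrable_diff[OF iD integrable_lborel_mult_pair[OF integrable_indicator_Ioo iC]]
      by (simp add: h_def left_diff_distrib mult.assoc)
  qed
  define \<Lambda> where "\<Lambda> l u n \<alpha> = (LBINT z. D z * (\<alpha> (fst z) * bump n l u (snd z)))" for l u n and \<alpha> :: "real \<Rightarrow> real"
  have bump_box: "bump n l u p = indicator (box l u) p * bump n l u p" for n and l u p :: 'b
    using bump_outside[of p l u n] by (auto simp: indicator_def)
  have int_test: "integrable lborel (\<lambda>z. k z * (\<alpha> (fst z) * bump n l u (snd z)))"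
    if k: "integrable lborel (\<lambda>z. k z * indicator (box l u) (snd z))" and \<alpha>: "ctest a c \<alpha>"
    for k :: "real \<times> 'b \<Rightarrow> real" and \<alpha> n l u
  proof -
    obtain N where N: "\<And>t. \<bar>\<alpha> t\<bar> \<le> N" using ctest_bounded[OF \<alpha>] by blast
    have [measurable]: "\<alpha> \<in> borel_measurable borel" using ctest_integrable[OF \<alpha>] by auto
    have [measurable]: "(\<lambda>z. k z * indicator (box l u) (snd z)) \<in> borel_measurable borel" using k by auto
    have eq: "(\<lambda>z. k z * (\<alpha> (fst z) * bump n l u (snd z))) = (\<lambda>z. (k z * indicator (box l u) (snd z)) * (\<alpha> (fst z) * bump n l u (snd z)))"
      by (subst bump_box) (simp add: mult_ac fun_eq_iff)
    have "integrable lborel (\<lambda>z. (k z * indicator (box l u) (snd z)) * (\<alpha> (fst z) * bump n l u (snd z)))"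
    proof (rule Bochner_Integration.integrable_bound[OF integrable_mult_left[OF k, of N]])
      show "AE z in lborel. norm ((k z * indicator (box l u) (snd z)) * (\<alpha> (fst z) * bump n l u (snd z)))
         \<le> norm ((k z * indicator (box l u) (snd z)) * N)"
      proof (intro AE_I2)
        fix z :: "real \<times> 'b"
        have "\<bar>\<alpha> (fst z)\<bar> * \<bar>bump n l u (snd z)\<bar> \<le> N * 1"
          using N[of "fst z"] bump_bounds[of n l u "snd z"] by (intro mult_mono) (auto intro: order_trans[OF abs_ge_zero])
        then have "\<bar>\<alpha> (fst z) * bump n l u (snd z)\<bar> \<le> \<bar>N\<bar>" by (simp add: abs_mult)
        then show "norm ((k z * indicator (box l u) (snd z)) * (\<alpha> (fst z) * bump n l u (snd z)))
         \<le> norm ((k z * indicator (box l u) (snd z)) * N)"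
          unfolding real_norm_def abs_mult[of "k z * indicator (box l u) (snd z)"] by (intro mult_left_mono) auto
      qed
    qed measurable
    then show ?thesis unfolding eq .
  qed
  \<comment> \<open>\<open>D\<close> has weak derivative 0: the hypothesis \<open>weak\<close> for
    \<open>f\<close> and integration by parts for \<open>G\<close> produce the same integral of g
    \<eta>. The end term of the latter drops out because \<open>deriv \<eta>\<close> has mean
    zero.\<close>
  have deriv0: "\<Lambda> l u n (deriv \<eta>) = 0" if lu: "cbox l u \<subseteq> V" and \<eta>: "ctest a c \<eta>" for l u n \<eta>
  proof -
    let ?b = "bump n l u"
    have i1: "integrable lborel (\<lambda>z. f z * (deriv \<eta> (fst z) * ?b (snd z)))"
      by (rule int_test[OF intf[OF lu] ctest_deriv[OF \<eta>]])
    have i2: "integrable lborel (\<lambda>z. indicator {a<..<c} (fst z) * G z * (deriv \<eta> (fst z) * ?b (snd z)))"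
      by (rule int_test[OF intG[OF lu] ctest_deriv[OF \<eta>]])
    have i3: "integrable lborel (\<lambda>z. g z * (\<eta> (fst z) * ?b (snd z)))"
      by (rule int_test[OF intg[OF lu] \<eta>])
    have \<eta>': "indicator {a<..<c} t * deriv \<eta> t = deriv \<eta> t" for t
      using ctest_outside[OF ctest_deriv[OF \<eta>], of t] by (auto simp: indicator_def)
    have "AE p in lborel. integrable lborel (\<lambda>s. g (s, p) * indicator (box l u) p)"
      using AE_integrable_lborel_snd[OF intg[OF lu]] by simp
    then have ae: "AE p in lborel. (LBINT t. indicator {a<..<c} t * G (t, p) * (deriv \<eta> t * ?b p))
        = - (LBINT s. g (s, p) * (\<eta> s * ?b p))"
    proof eventually_elim
      case (elim p)
      show ?case
      proof (cases "p \<in> box l u")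
        case True
        then have ig: "integrable lborel (\<lambda>s. g (s, p))" using elim by simp
        have "(LBINT x. g (x, p)) * (LBINT x. deriv \<eta> x)
           = (LBINT s. g (s, p) * \<eta> s) + (LBINT s. deriv \<eta> s * G (s, p))"
          using integral_product_split(1)[OF ig ctest_integrable[OF ctest_deriv[OF \<eta>]]]
          unfolding ctest_tail_integral(1)[OF \<eta>] G_ind .
        then have e: "(LBINT s. deriv \<eta> s * G (s, p)) = - (LBINT s. g (s, p) * \<eta> s)"
          using ctest_tail_integral(2)[OF \<eta>] by simp
        have "(\<lambda>t. indicator {a<..<c} t * G (t, p) * (deriv \<eta> t * ?b p)) = (\<lambda>t. (deriv \<eta> t * G (t, p)) * ?b p)"
        proof
          fix t
          show "indicator {a<..<c} t * G (t, p) * (deriv \<eta> t * ?b p) = (deriv \<eta> t * G (t, p)) * ?b p"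
            by (subst \<eta>'[symmetric, of t]) (auto simp: indicator_def)
        qed
        moreover have "(\<lambda>s. g (s, p) * (\<eta> s * ?b p)) = (\<lambda>s. (g (s, p) * \<eta> s) * ?b p)"
          by (simp add: mult_ac)
        ultimately show ?thesis using e by simp
      qed (simp add: bump_outside)
    qed
    have "(LBINT z. indicator {a<..<c} (fst z) * G z * (deriv \<eta> (fst z) * ?b (snd z)))
       = (LBINT p. (LBINT t. indicator {a<..<c} t * G (t, p) * (deriv \<eta> t * ?b p)))"
      using integral_lborel_snd[OF i2] by simp
    also have "\<dots> = (LBINT p. - (LBINT s. g (s, p) * (\<eta> s * ?b p)))"
      by (rule integral_cong_AE)
        (use integrable_lborel_snd[OF i2] integrable_lborel_snd[OF i3] ae in \<open>auto simp del: integral_mult_right_zero integral_mult_left_zero\<close>)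
    also have "\<dots> = - (LBINT z. g z * (\<eta> (fst z) * ?b (snd z)))"
      using integral_lborel_snd[OF i3] by simp
    also have "\<dots> = (LBINT z. f z * (deriv \<eta> (fst z) * ?b (snd z)))"
      using weak[OF lu \<eta>] by simp
    finally show ?thesis
      unfolding \<Lambda>_def D_def left_diff_distrib using i1 i2 by simp
  qed
  have \<Lambda>_eq: "\<Lambda> l u n \<alpha> = (LBINT t. \<alpha> t) * \<Lambda> l u n \<beta>"
    if lu: "cbox l u \<subseteq> V" and \<alpha>: "ctest a c \<alpha>" for l u n \<alpha>
  proof -
    let ?k = "\<integral>t. \<alpha> t \<partial>lborel"
    have t: "ctest a c (\<lambda>t. - ?k * \<beta> t + \<alpha> t)" by (rule ctest_lincomb[OF \<beta> \<alpha>])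
    have "(LBINT t. - ?k * \<beta> t + \<alpha> t) = 0"
      using ctest_integrable[OF \<alpha>] ctest_integrable[OF \<beta>] \<beta>1 by simp
    then obtain \<eta> where "ctest a c \<eta>" "deriv \<eta> = (\<lambda>t. - ?k * \<beta> t + \<alpha> t)"
      using ctest_antideriv[OF t] by blast
    then have "\<Lambda> l u n (\<lambda>t. - ?k * \<beta> t + \<alpha> t) = 0" using deriv0[OF lu] by metis
    moreover have "\<Lambda> l u n (\<lambda>t. - ?k * \<beta> t + \<alpha> t) = - ?k * \<Lambda> l u n \<beta> + \<Lambda> l u n \<alpha>"
    proof -
      have "(\<lambda>z. D z * ((- ?k * \<beta> (fst z) + \<alpha> (fst z)) * bump n l u (snd z)))
        = (\<lambda>z. - ?k * (D z * (\<beta> (fst z) * bump n l u (snd z))) + D z * (\<alpha> (fst z) * bump n l u (snd z)))"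
        by (simp add: algebra_simps fun_eq_iff)
      then show ?thesis unfolding \<Lambda>_def
        using int_test[OF intD[OF lu] \<alpha>, of n] int_test[OF intD[OF lu] \<beta>, of n] by simp
    qed
    ultimately show ?thesis by simp
  qed
  have "AE z in lborel. z \<in> {a<..<c} \<times> V \<longrightarrow> h z = 0"
  proof (rule fundamental_lemma)
    show "open ({a<..<c} \<times> V)" using V by (intro open_Times) auto
    fix lu uu :: "real \<times> 'b"
    assume "cbox lu uu \<subseteq> {a<..<c} \<times> V"
    moreover obtain t1 l t2 u where lu_eq: "lu = (t1, l)" "uu = (t2, u)" by (metis surj_pair)
    ultimately have sub: "{t1..t2} \<times> cbox l u \<subseteq> {a<..<c} \<times> V"
      by (simp add: cbox_Pair_eq)
    have boxeq: "box lu uu = {t1<..<t2} \<times> box l u"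
      unfolding lu_eq by (auto simp: mem_box Basis_prod_def)
    have *: "t \<in> {a<..<c} \<and> x \<in> V" if "t \<in> {t1..t2}" "x \<in> cbox l u" for t x
      using sub that by blast
    \<comment> \<open>Inclusion of a product box says something about one factor only when the other
      is nonempty. For an empty box both claims below are trivial.\<close>
    have subs: "cbox l u \<subseteq> V \<and> a < t1 \<and> t2 < c" if A: "t1 < t2" and B: "box l u \<noteq> {}"
    proof -
      obtain x where "x \<in> cbox l u" using B box_subset_cbox by blast
      then show ?thesis using *[of t1] *[of t2 x] A by force
    qed
    show "set_integrable lborel (box lu uu) h"
    proof (cases "t1 < t2 \<and> box l u \<noteq> {}")
      case True
      then have "cbox l u \<subseteq> V" using subs by auto
      show ?thesis unfolding set_integrable_def
      proof (rule Bochner_Integration.integrable_bound[OF inth[OF \<open>cbox l u \<subseteq> V\<close>]])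
        show "AE z in lborel. norm (indicator (box lu uu) z *\<^sub>R h z) \<le> norm (h z * indicator (box l u) (snd z))"
          by (intro AE_I2) (auto simp: indicator_def boxeq)
      qed measurable
    next
      case False
      then have "box lu uu = {}" using boxeq by auto
      then show ?thesis by (simp add: set_integrable_def)
    qed
    fix n
    show "(LBINT z. h z * bump n lu uu z) = 0"
    proof (cases "t1 < t2 \<and> box l u \<noteq> {}")
      case True
      then have lu: "cbox l u \<subseteq> V" and t12: "a < t1" "t2 < c" using subs by auto
      let ?\<alpha> = "bump1 n t1 t2" and ?b = "bump n l u"
      have \<alpha>: "ctest a c ?\<alpha>" using True t12 by (intro ctest_bump1) auto
      have \<alpha>': "indicator {a<..<c} t * ?\<alpha> t = ?\<alpha> t" for t
        using ctest_outside[OF \<alpha>, of t] by (auto simp: indicator_def)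
      have iC: "integrable lborel (\<lambda>z. (indicator {a<..<c} (fst z) * C (snd z)) * (?\<alpha> (fst z) * ?b (snd z)))"
        by (rule int_test[OF _ \<alpha>]) (use integrable_lborel_mult_pair[OF integrable_indicator_Ioo intC[OF lu]] in \<open>simp add: mult.assoc\<close>)
      \<comment> \<open>By definition of \<open>C\<close>, integrating out t against \<beta> leaves
        the pairing of \<open>C\<close> with the bump. Together with \<open>\<Lambda>_eq\<close>
        this shows that \<open>D\<close> and the cut-off \<open>C\<close> pair alike with \<alpha>
        and the bump.\<close>
      have "\<Lambda> l u n \<beta> = (LBINT p. (LBINT t. D (t, p) * (\<beta> t * ?b p)))"
        unfolding \<Lambda>_def using integral_lborel_snd[OF int_test[OF intD[OF lu] \<beta>, of n]] by simp
      also have "\<dots> = (LBINT p. C p * ?b p)"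
      proof (rule Bochner_Integration.integral_cong[OF refl])
        fix p
        have "(\<lambda>t. D (t, p) * (\<beta> t * ?b p)) = (\<lambda>t. (\<beta> t * D (t, p)) * ?b p)" by (simp add: mult_ac)
        then show "(LBINT t. D (t, p) * (\<beta> t * ?b p)) = C p * ?b p" by (simp add: C_def)
      qed
      finally have Lb: "\<Lambda> l u n \<beta> = (LBINT p. C p * ?b p)" .
      have "(LBINT z. (indicator {a<..<c} (fst z) * C (snd z)) * (?\<alpha> (fst z) * ?b (snd z)))
        = (LBINT p. (LBINT t. (indicator {a<..<c} t * C p) * (?\<alpha> t * ?b p)))"
        using integral_lborel_snd[OF iC] by simp
      also have "\<dots> = (LBINT p. (LBINT t. ?\<alpha> t) * (C p * ?b p))"
      proof (rule Bochner_Integration.integral_cong[OF refl])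
        fix p
        have "(\<lambda>t. (indicator {a<..<c} t * C p) * (?\<alpha> t * ?b p)) = (\<lambda>t. ?\<alpha> t * (C p * ?b p))"
        proof
          fix t
          show "(indicator {a<..<c} t * C p) * (?\<alpha> t * ?b p) = ?\<alpha> t * (C p * ?b p)"
            by (subst (2) \<alpha>'[symmetric, of t]) (auto simp: indicator_def)
        qed
        then show "(LBINT t. (indicator {a<..<c} t * C p) * (?\<alpha> t * ?b p)) = (LBINT t. ?\<alpha> t) * (C p * ?b p)"
          by simp
      qed
      also have "\<dots> = (LBINT t. ?\<alpha> t) * \<Lambda> l u n \<beta>" by (simp add: Lb)
      finally have "(LBINT z. (indicator {a<..<c} (fst z) * C (snd z)) * (?\<alpha> (fst z) * ?b (snd z))) = \<Lambda> l u n ?\<alpha>"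
        using \<Lambda>_eq[OF lu \<alpha>] by simp
      moreover have "bump n lu uu z = ?\<alpha> (fst z) * ?b (snd z)" for z
        unfolding lu_eq by (cases z) (simp add: bump_Pair)
      ultimately show ?thesis
        using int_test[OF intD[OF lu] \<alpha>, of n] iC by (simp add: h_def \<Lambda>_def left_diff_distrib)
    next
      case False
      then have "box lu uu = {}" using boxeq by auto
      then show ?thesis using bump_outside[of _ lu uu n] by simp
    qed
  qed
  then have ae1: "AE p in lborel. AE t in lborel. (t, p) \<in> {a<..<c} \<times> V \<longrightarrow> h (t, p) = 0"
    by (rule AE_lborel_pair)
  \<comment> \<open>Integrability of \<open>g\<close> is given over boxes with closure in
    \<open>V\<close>; a countable cover turns this into integrable slices at almost every point of
    \<open>V\<close>.\<close>
  have ae2: "AE p in lborel. p \<in> V \<longrightarrow> integrable lborel (\<lambda>s. g (s, p))"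
  proof (rule AE_open_if_AE_cbox[OF V])
    fix l u assume "cbox l u \<subseteq> V"
    then have "AE p in lborel. integrable lborel (\<lambda>s. g (s, p) * indicator (box l u) p)"
      using AE_integrable_lborel_snd[OF intg] by fastforce
    then show "AE p in lborel. p \<in> box l u \<longrightarrow> integrable lborel (\<lambda>s. g (s, p))"
      by eventually_elim auto
  qed
  show ?thesis using ae1 ae2
  proof eventually_elim
    case (elim p)
    show ?case
    proof
      assume p: "p \<in> V"
      then have ig: "integrable lborel (\<lambda>s. g (s, p))" using elim by simp
      have Gt: "G (t, p) = (LINT s:{a<..<t}|lborel. g (s, p))" if "t \<in> {a<..<c}" for t
        unfolding G_ind set_lebesgue_integral_def
        by (rule Bochner_Integration.integral_cong) (use that sg in \<open>auto simp: indicator_def\<close>)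
      have "AE t in lborel. t \<in> {a<..<c} \<longrightarrow> f (t, p) = C p + (LINT s:{a<..<t}|lborel. g (s, p))"
        using elim(1) by eventually_elim (use p Gt in \<open>force simp: h_def D_def\<close>)
      moreover have "set_integrable lborel {a<..<c} (\<lambda>s. g (s, p))"
        using integrable_mult_indicator[OF _ ig, of "{a<..<c}"] by (simp add: set_integrable_def)
      ultimately show "\<exists>k l. acI a c k l (\<lambda>t. f (t, p)) (\<lambda>t. g (t, p))"
        unfolding acI_def by blast
    qed
  qed
qed

section \<open>Energy estimate\<close>

definition sqint :: "('a::euclidean_space \<Rightarrow> real) \<Rightarrow> bool" where
  "sqint f \<longleftrightarrow> f \<in> borel_measurable borel \<and> integrable lborel (\<lambda>p. (f p)\<^sup>2)"

lemma sqint_measurable [measurable_dest]: "sqint f \<Longrightarrow> f \<in> borel_measurable borel"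
  by (simp add: sqint_def)

lemma sqint_mult_integrable:
  assumes f: "sqint f" and g: "sqint g" shows "integrable lborel (\<lambda>p. f p * g p)"
proof (rule Bochner_Integration.integrable_bound)
  show "integrable lborel (\<lambda>p. (f p)\<^sup>2 + (g p)\<^sup>2)" using f g by (simp add: sqint_def)
  show "(\<lambda>p. f p * g p) \<in> borel_measurable lborel" using f g by (auto simp: sqint_def)
  show "AE p in lborel. norm (f p * g p) \<le> norm ((f p)\<^sup>2 + (g p)\<^sup>2)"
  proof (intro AE_I2)
    fix p
    have "2 * \<bar>f p\<bar> * \<bar>g p\<bar> \<le> \<bar>f p\<bar>\<^sup>2 + \<bar>g p\<bar>\<^sup>2" by (rule sum_squares_bound)
    moreover have "0 \<le> \<bar>f p\<bar> * \<bar>g p\<bar>" by simp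
    ultimately have "\<bar>f p\<bar> * \<bar>g p\<bar> \<le> (f p)\<^sup>2 + (g p)\<^sup>2" unfolding power2_abs by linarith
    then show "norm (f p * g p) \<le> norm ((f p)\<^sup>2 + (g p)\<^sup>2)" by (simp add: abs_mult)
  qed
qed

lemma sqint_add: assumes f: "sqint f" and g: "sqint g" shows "sqint (\<lambda>p. f p + g p)"
proof -
  have "(\<lambda>p. (f p + g p)\<^sup>2) = (\<lambda>p. (f p)\<^sup>2 + (g p)\<^sup>2 + 2 * (f p * g p))"
    by (auto simp: power2_sum)
  moreover have "(\<lambda>p. f p + g p) \<in> borel_measurable borel"
    using f g by (intro borel_measurable_add) (auto simp: sqint_def)
  ultimately show ?thesis using f g sqint_mult_integrable[OF f g] unfolding sqint_def by simp
qed

lemma sqint_cmult: "sqint f \<Longrightarrow> sqint (\<lambda>p. c * f p)"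
  by (auto simp: sqint_def power_mult_distrib)

lemma sqint_diff: assumes f: "sqint f" and g: "sqint g" shows "sqint (\<lambda>p. f p - g p)"
  using sqint_add[OF f sqint_cmult[OF g, of "-1"]] by simp

text \<open>Bounded intervals are used because a square integrable derivative may fail to be
  integrable over a whole line. The end values may depend on the line and on \<open>n\<close>;
  \<open>acI_line\<close> glues the intervals once function and derivative are integrable.\<close>

definition acx :: "(real \<times> real \<Rightarrow> real) \<Rightarrow> (real \<times> real \<Rightarrow> real) \<Rightarrow> bool" where
  "acx f g \<longleftrightarrow> f \<in> borel_measurable borel \<and> g \<in> borel_measurable borel \<and>
     (AE y in lborel. \<forall>n::nat. \<exists>k l. acI (- real n) (real n) k l (\<lambda>x. f (x, y)) (\<lambda>x. g (x, y)))"

lemma acx_mult: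
  assumes 1: "acx f1 g1" and 2: "acx f2 g2"
  shows "acx (\<lambda>p. f1 p * f2 p) (\<lambda>p. g1 p * f2 p + f1 p * g2 p)"
proof -
  have [measurable]: "f1 \<in> borel_measurable borel" "g1 \<in> borel_measurable borel"
    "f2 \<in> borel_measurable borel" "g2 \<in> borel_measurable borel" using 1 2 by (auto simp: acx_def)
  have "AE y in lborel. \<forall>n::nat. \<exists>k l. acI (- real n) (real n) k l (\<lambda>x. f1 (x, y)) (\<lambda>x. g1 (x, y))"
    "AE y in lborel. \<forall>n::nat. \<exists>k l. acI (- real n) (real n) k l (\<lambda>x. f2 (x, y)) (\<lambda>x. g2 (x, y))"
    using 1 2 by (auto simp: acx_def)
  then have "AE y in lborel. \<forall>n::nat. \<exists>k l. acI (- real n) (real n) k l (\<lambda>x. f1 (x, y) * f2 (x, y))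
      (\<lambda>x. g1 (x, y) * f2 (x, y) + f1 (x, y) * g2 (x, y))"
  proof eventually_elim
    case (elim y)
    show ?case
    proof
      fix n
      obtain k1 l1 k2 l2 where "acI (- real n) (real n) k1 l1 (\<lambda>x. f1 (x, y)) (\<lambda>x. g1 (x, y))"
        "acI (- real n) (real n) k2 l2 (\<lambda>x. f2 (x, y)) (\<lambda>x. g2 (x, y))" using elim by meson
      from acI_product[OF this] show "\<exists>k l. acI (- real n) (real n) k l (\<lambda>x. f1 (x, y) * f2 (x, y))
        (\<lambda>x. g1 (x, y) * f2 (x, y) + f1 (x, y) * g2 (x, y))" by auto
    qed
  qed
  then show ?thesis by (auto simp: acx_def)
qed

text \<open>\<open>acI_line\<close> on almost every line, followed by Fubini. The bound by the L1
  norm of the derivative along the line is one of the two ingredients of Ladyzhenskaya's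
  inequality.\<close>

lemma
  assumes fg: "acx f g" and f: "integrable lborel f" and g: "integrable lborel g"
  shows acx_integral_zero: "integral\<^sup>L lborel g = 0"
    and acx_bound: "AE p in lborel. \<bar>f p\<bar> \<le> (LBINT x. \<bar>g (x, snd p)\<bar>)"
proof -
  have [measurable]: "f \<in> borel_measurable borel" "g \<in> borel_measurable borel" using fg by (auto simp: acx_def)
  have "AE y in lborel. \<forall>n::nat. \<exists>k l. acI (- real n) (real n) k l (\<lambda>x. f (x, y)) (\<lambda>x. g (x, y))"
    using fg by (simp add: acx_def)
  then have *: "AE y in lborel. (LBINT x. g (x, y)) = 0 \<and>
      (AE x in lborel. \<bar>f (x, y)\<bar> \<le> (LBINT x. \<bar>g (x, y)\<bar>))"
    using AE_integrable_lborel_snd[OF f] AE_integrable_lborel_snd[OF g]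
  proof eventually_elim
    case (elim y)
    then have ac: "\<And>n::nat. \<exists>k l. acI (- real n) (real n) k l (\<lambda>x. f (x, y)) (\<lambda>x. g (x, y))" by blast
    have "AE t in lborel. f (t, y) = (LBINT s. indicator {..<t} s * g (s, y))"
      by (rule acI_line(1)[OF ac elim(2,3)])
    then have "AE x in lborel. \<bar>f (x, y)\<bar> \<le> (LBINT x. \<bar>g (x, y)\<bar>)"
    proof eventually_elim
      case (elim t)
      have "\<bar>\<integral>s. indicator {..<t} s * g (s, y) \<partial>lborel\<bar> \<le> (LBINT s. \<bar>indicator {..<t} s * g (s, y)\<bar>)"
        by (rule integral_abs_bound)
      also have "\<dots> \<le> (LBINT x. \<bar>g (x, y)\<bar>)"
        by (rule integral_mono'[OF integrable_abs]) (use \<open>integrable lborel (\<lambda>x. g (x, y))\<close> in \<open>auto simp: indicator_def\<close>)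
      finally show ?case unfolding elim .
    qed
    then show ?case using acI_line(2)[OF ac elim(2,3)] by simp
  qed
  have "integral\<^sup>L lborel g = (LBINT y. (LBINT x. g (x, y)))"
    using integral_lborel_snd[OF g] by simp
  also have "\<dots> = (\<integral>y. 0 \<partial>(lborel :: real measure))"
    by (rule integral_cong_AE) (use * integrable_lborel_snd[OF g] in auto)
  finally show "integral\<^sup>L lborel g = 0" by simp
  have m: "(\<lambda>y. \<integral>x. \<bar>g (x, y)\<bar> \<partial>lborel) \<in> borel_measurable borel"
    using integrable_lborel_snd[OF integrable_abs[OF g]] by auto
  have s: "{p. \<bar>f p\<bar> \<le> (LBINT x. \<bar>g (x, snd p)\<bar>)} \<in> sets borel"
    using m by measurable
  have "AE y in lborel. AE x in lborel. \<bar>f (x, y)\<bar> \<le> (LBINT x. \<bar>g (x, y)\<bar>)"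
    using * by eventually_elim simp
  then show "AE p in lborel. \<bar>f p\<bar> \<le> (LBINT x. \<bar>g (x, snd p)\<bar>)"
    by (intro AE_lborel_pairI_snd[OF s]) simp
qed

text \<open>The end values 0 at y = 0 and y = B carry the Dirichlet condition; \<open>acy\<close>
  leaves both values free.\<close>

definition acy0 :: "real \<Rightarrow> (real \<times> real \<Rightarrow> real) \<Rightarrow> (real \<times> real \<Rightarrow> real) \<Rightarrow> bool" where
  "acy0 B f g \<longleftrightarrow> f \<in> borel_measurable borel \<and> g \<in> borel_measurable borel \<and>
     (AE x in lborel. acI 0 B 0 0 (\<lambda>y. f (x, y)) (\<lambda>y. g (x, y)))"

definition acy :: "real \<Rightarrow> (real \<times> real \<Rightarrow> real) \<Rightarrow> (real \<times> real \<Rightarrow> real) \<Rightarrow> bool" where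
  "acy B f g \<longleftrightarrow> f \<in> borel_measurable borel \<and> g \<in> borel_measurable borel \<and>
     (AE x in lborel. \<exists>k l. acI 0 B k l (\<lambda>y. f (x, y)) (\<lambda>y. g (x, y)))"

text \<open>End values multiply, so one factor vanishing on the boundary makes the product vanish
  there. This serves the product of \<open>v\<close> and \<open>qy\<close>, where the boundary
  values of \<open>qy\<close> are unknown.\<close>

lemma acy0_mult:
  assumes 1: "acy0 B f1 g1" and 2: "acy B f2 g2"
  shows "acy0 B (\<lambda>p. f1 p * f2 p) (\<lambda>p. g1 p * f2 p + f1 p * g2 p)"
proof -
  have [measurable]: "f1 \<in> borel_measurable borel" "g1 \<in> borel_measurable borel"
    "f2 \<in> borel_measurable borel" "g2 \<in> borel_measurable borel" using 1 2 by (auto simp: acy0_def acy_def)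
  have "AE x in lborel. acI 0 B 0 0 (\<lambda>y. f1 (x, y)) (\<lambda>y. g1 (x, y))"
    "AE x in lborel. \<exists>k l. acI 0 B k l (\<lambda>y. f2 (x, y)) (\<lambda>y. g2 (x, y))"
    using 1 2 by (auto simp: acy0_def acy_def)
  then have "AE x in lborel. acI 0 B 0 0 (\<lambda>y. f1 (x, y) * f2 (x, y))
      (\<lambda>y. g1 (x, y) * f2 (x, y) + f1 (x, y) * g2 (x, y))"
  proof eventually_elim
    case (elim x)
    then obtain k l where "acI 0 B k l (\<lambda>y. f2 (x, y)) (\<lambda>y. g2 (x, y))" by blast
    from acI_product[OF elim(1) this] show ?case by auto
  qed
  then show ?thesis by (auto simp: acy0_def)
qed

lemma
  assumes fg: "acy0 B f g" and g: "integrable lborel g" and gs: "\<And>p. p \<notin> strip B \<Longrightarrow> g p = 0"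
    and fs: "\<And>p. p \<notin> strip B \<Longrightarrow> f p = 0"
  shows acy0_integral_zero: "integral\<^sup>L lborel g = 0"
    and acy0_bound: "AE p in lborel. \<bar>f p\<bar> \<le> (LBINT y. \<bar>g (fst p, y)\<bar>)"
proof -
  have [measurable]: "f \<in> borel_measurable borel" "g \<in> borel_measurable borel" using fg by (auto simp: acy0_def)
  have "AE x in lborel. acI 0 B 0 0 (\<lambda>y. f (x, y)) (\<lambda>y. g (x, y))"
    using fg by (simp add: acy0_def)
  then have *: "AE x in lborel. (LBINT y. g (x, y)) = 0 \<and>
      (AE y in lborel. \<bar>f (x, y)\<bar> \<le> (LBINT y. \<bar>g (x, y)\<bar>))"
    using AE_integrable_lborel_fst[OF g]
  proof eventually_elim
    case (elim x)
    have "(LBINT y. g (x, y)) = (LINT s:{0<..<B}|lborel. g (x, s))"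
      unfolding set_lebesgue_integral_def
      by (rule Bochner_Integration.integral_cong) (use gs[of "(x, _)"] in \<open>force simp: indicator_def strip_def\<close>)+
    moreover have "\<dots> = 0" using elim(1) by (simp add: acI_def)
    moreover have "AE t in lborel. t \<in> {0<..<B} \<longrightarrow> f (x, t) = (LINT s:{0<..<t}|lborel. g (x, s))"
      using elim(1) by (simp add: acI_def)
    then have "AE t in lborel. \<bar>f (x, t)\<bar> \<le> (LBINT y. \<bar>g (x, y)\<bar>)"
    proof eventually_elim
      case (elim t)
      show ?case
      proof (cases "t \<in> {0<..<B}")
        case True
        have "\<bar>LINT s:{0<..<t}|lborel. g (x, s)\<bar> \<le> (LBINT s. \<bar>indicator {0<..<t} s * g (x, s)\<bar>)"
          unfolding set_lebesgue_integral_def real_scaleR_def by (rule integral_abs_bound)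
        also have "\<dots> \<le> (LBINT y. \<bar>g (x, y)\<bar>)"
          by (rule integral_mono'[OF integrable_abs]) (use \<open>integrable lborel (\<lambda>y. g (x, y))\<close> in \<open>auto simp: indicator_def\<close>)
        finally show ?thesis using True elim by simp
      next
        case False
        then show ?thesis using fs[of "(x, t)"] by (simp add: strip_def)
      qed
    qed
    ultimately show ?case by simp
  qed
  have "integral\<^sup>L lborel g = (LBINT x. (LBINT y. g (x, y)))"
    using integral_lborel_fst[OF g] by simp
  also have "\<dots> = (\<integral>y. 0 \<partial>(lborel :: real measure))"
    by (rule integral_cong_AE) (use * integrable_lborel_fst[OF g] in auto)
  finally show "integral\<^sup>L lborel g = 0" by simp
  have m: "(\<lambda>x. \<integral>y. \<bar>g (x, y)\<bar> \<partial>lborel) \<in> borel_measurable borel"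
    using integrable_lborel_fst[OF integrable_abs[OF g]] by auto
  have s: "{p. \<bar>f p\<bar> \<le> (LBINT y. \<bar>g (fst p, y)\<bar>)} \<in> sets borel"
    using m by measurable
  show "AE p in lborel. \<bar>f p\<bar> \<le> (LBINT y. \<bar>g (fst p, y)\<bar>)"
    by (rule AE_lborel_pairI[OF s]) (use * in \<open>auto elim: eventually_mono\<close>)
qed

section \<open>Ladyzhenskaya's inequality and integration by parts on the strip\<close>

lemma AM_GM_scaled: "m > 0 \<Longrightarrow> 2 * \<bar>x * y\<bar> \<le> m * x\<^sup>2 + y\<^sup>2 / m" for x y m :: real
proof -
  assume m: "m > 0"
  have "0 \<le> (m * \<bar>x\<bar> - \<bar>y\<bar>)\<^sup>2 / m" using m by simp
  also have "\<dots> = m * x\<^sup>2 + y\<^sup>2 / m - 2 * \<bar>x * y\<bar>"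
    using m by (simp add: power2_diff power_mult_distrib abs_mult field_simps) (simp add: power2_eq_square algebra_simps)
  finally show ?thesis by simp
qed

text \<open>Along x, v^2 is bounded by \<open>F\<close>, which depends on y alone; along y it is
  bounded by \<open>G\<close>, which depends on x alone. So v^4 <= G F, and the integral of the
  right-hand side factorises into those of |(v^2)_x| and |(v^2)_y|. Each of these is estimated by
  the scaled AM-GM inequality.\<close>

lemma ladyzhenskaya:
  assumes x: "acx v vx" and y: "acy0 B v vy"
    and L2: "sqint v" "sqint vx" "sqint vy" and S: "\<And>p. p \<notin> strip B \<Longrightarrow> v p = 0" "\<And>p. p \<notin> strip B \<Longrightarrow> vy p = 0"
    and N: "N = (LBINT p. (v p)\<^sup>2)" "N > 0"
  shows "integrable lborel (\<lambda>p. ((v p)\<^sup>2)\<^sup>2)"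
    and "(LBINT p. ((v p)\<^sup>2)\<^sup>2) \<le> 4 * N * ((LBINT p. (vx p)\<^sup>2) + (LBINT p. (vy p)\<^sup>2) + N)"
proof -
  have [measurable]: "v \<in> borel_measurable borel" "vx \<in> borel_measurable borel" "vy \<in> borel_measurable borel"
    using L2 by (auto simp: sqint_def)
  have vv: "integrable lborel (\<lambda>p. v p * v p)" by (rule sqint_mult_integrable[OF L2(1) L2(1)])
  define gx gy where "gx p = vx p * v p + v p * vx p" and "gy p = vy p * v p + v p * vy p" for p
  have igx: "integrable lborel gx" and igy: "integrable lborel gy"
    unfolding gx_def[abs_def] gy_def[abs_def]
    by (intro Bochner_Integration.integrable_add sqint_mult_integrable L2)+
  define F where "F y = (LBINT x. \<bar>gx (x, y)\<bar>)" for y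
  define G where "G x = (LBINT y. \<bar>gy (x, y)\<bar>)" for x
  have iF: "integrable lborel F" and sF: "integral\<^sup>L lborel F = (LBINT p. \<bar>gx p\<bar>)"
    unfolding F_def[abs_def]
    using integrable_lborel_snd[OF integrable_abs[OF igx]] integral_lborel_snd[OF integrable_abs[OF igx]] by simp_all
  have iG: "integrable lborel G" and sG: "integral\<^sup>L lborel G = (LBINT p. \<bar>gy p\<bar>)"
    unfolding G_def[abs_def]
    using integrable_lborel_fst[OF integrable_abs[OF igy]] integral_lborel_fst[OF integrable_abs[OF igy]] by simp_all
  have "acx (\<lambda>p. v p * v p) gx" unfolding gx_def[abs_def] by (rule acx_mult[OF x x])
  from acx_bound[OF this vv igx] have bx: "AE p in lborel. (v p)\<^sup>2 \<le> F (snd p)"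
    by eventually_elim (simp add: F_def power2_eq_square)
  have yy: "acy B v vy" using y by (auto simp: acy_def acy0_def elim!: eventually_mono)
  have "acy0 B (\<lambda>p. v p * v p) gy" unfolding gy_def[abs_def] by (rule acy0_mult[OF y yy])
  from acy0_bound[OF this igy] have by': "AE p in lborel. (v p)\<^sup>2 \<le> G (fst p)"
    using S by (auto simp: gy_def G_def power2_eq_square elim!: eventually_mono)
  have b: "AE p in lborel. ((v p)\<^sup>2)\<^sup>2 \<le> G (fst p) * F (snd p)"
    using bx by'
  proof eventually_elim
    case (elim p)
    have "(v p)\<^sup>2 * (v p)\<^sup>2 \<le> G (fst p) * F (snd p)"
      using elim order_trans[OF zero_le_power2 elim(2)] by (intro mult_mono) auto
    then show ?case by (simp only: power2_eq_square[of "(v p)\<^sup>2"])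
  qed
  have iGF: "integrable lborel (\<lambda>p. G (fst p) * F (snd p))"
    by (rule integrable_lborel_mult_pair[OF iG iF])
  show i4: "integrable lborel (\<lambda>p. ((v p)\<^sup>2)\<^sup>2)"
  proof (rule Bochner_Integration.integrable_bound[OF iGF])
    show "AE p in lborel. norm (((v p)\<^sup>2)\<^sup>2) \<le> norm (G (fst p) * F (snd p))"
      using b by eventually_elim auto
  qed measurable
  define X Y where "X = (LBINT p. (vx p)\<^sup>2)" and "Y = (LBINT p. (vy p)\<^sup>2)"
  \<comment> \<open>Including \<open>N\<close> makes \<open>W\<close> positive even when both
    derivatives vanish, so that \<open>m\<close> is an admissible weight.\<close>
  define W where "W = X + Y + N"
  have XY: "X \<ge> 0" "Y \<ge> 0" by (simp_all add: X_def Y_def)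
  then have W: "W > 0" "X \<le> W" "Y \<le> W" using N by (simp_all add: W_def)
  \<comment> \<open>This choice balances \<open>m * N = W / m\<close>. Each of the two factors is
    then at most \<open>2 * W / m\<close>, and their product is at most 4 N W.\<close>
  define m where "m = sqrt (W / N)"
  have m: "m > 0" and m2: "m * m = W / N" using W N by (simp_all add: m_def)
  have mN: "m * N = W / m"
  proof -
    have "m * m * N = W" using m2 N by simp
    then show ?thesis using m by (simp add: field_simps)
  qed
  have est: "(LBINT p. \<bar>h p * v p + v p * h p\<bar>) \<le> 2 * W / m"
    if h: "sqint h" and hW: "(LBINT p. (h p)\<^sup>2) \<le> W" for h :: "real \<times> real \<Rightarrow> real"
  proof -
    have "(LBINT p. \<bar>h p * v p + v p * h p\<bar>) \<le> (LBINT p. m * (v p)\<^sup>2 + (h p)\<^sup>2 / m)"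
    proof (rule integral_mono)
      show "integrable lborel (\<lambda>p. \<bar>h p * v p + v p * h p\<bar>)"
        by (intro integrable_abs Bochner_Integration.integrable_add sqint_mult_integrable L2 h)
      show "integrable lborel (\<lambda>p. m * (v p)\<^sup>2 + (h p)\<^sup>2 / m)"
        using L2(1) h by (simp add: sqint_def)
      show "\<bar>h p * v p + v p * h p\<bar> \<le> m * (v p)\<^sup>2 + (h p)\<^sup>2 / m" for p
        using AM_GM_scaled[OF m, of "v p" "h p"] by (simp add: mult.commute)
    qed
    also have "\<dots> = m * N + (LBINT p. (h p)\<^sup>2) / m"
      using L2(1) h N by (simp add: sqint_def)
    also have "\<dots> \<le> 2 * W / m"
      using hW m unfolding mN by (simp add: field_simps)
    finally show ?thesis .
  qed
  have "(LBINT p. ((v p)\<^sup>2)\<^sup>2) \<le> (LBINT p. G (fst p) * F (snd p))"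
    by (rule integral_mono_AE[OF i4 iGF b])
  also have "\<dots> = integral\<^sup>L lborel G * integral\<^sup>L lborel F"
    using integral_lborel_fst[OF iGF] by simp
  also have "\<dots> \<le> (2 * W / m) * (2 * W / m)"
  proof (rule mult_mono)
    show "integral\<^sup>L lborel G \<le> 2 * W / m"
      unfolding sG gy_def by (rule est[OF L2(3)]) (use W in \<open>simp add: Y_def\<close>)
    show "integral\<^sup>L lborel F \<le> 2 * W / m"
      unfolding sF gx_def by (rule est[OF L2(2)]) (use W in \<open>simp add: X_def\<close>)
    show "0 \<le> integral\<^sup>L lborel F" unfolding sF by simp
  qed (use W m in simp)
  also have "\<dots> = 4 * W * W / (m * m)" by simp
  also have "\<dots> = 4 * N * W" unfolding m2 using W N by simp
  finally show "(LBINT p. ((v p)\<^sup>2)\<^sup>2) \<le> 4 * N * ((LBINT p. (vx p)\<^sup>2) + (LBINT p. (vy p)\<^sup>2) + N)"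
    by (simp add: W_def X_def Y_def)
qed


text \<open>Square integrability of both functions and both derivatives makes the product and its
  derivative integrable, which excludes contributions from infinity.\<close>

lemma acx_ibp:
  assumes "acx f f'" "acx g g'" "sqint f" "sqint f'" "sqint g" "sqint g'"
  shows "(LBINT p. f p * g' p) = - (LBINT p. f' p * g p)"
proof -
  have "(LBINT p. f' p * g p + f p * g' p) = 0"
    by (rule acx_integral_zero[OF acx_mult[OF assms(1,2)]])
      (intro Bochner_Integration.integrable_add sqint_mult_integrable assms)+
  then show ?thesis using assms by (simp add: sqint_mult_integrable)
qed

lemma acy_ibp:
  assumes "acy0 B f f'" "acy B g g'" "sqint f" "sqint f'" "sqint g" "sqint g'"
    and S: "\<And>p. p \<notin> strip B \<Longrightarrow> f p = 0" "\<And>p. p \<notin> strip B \<Longrightarrow> f' p = 0"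
  shows "(LBINT p. f p * g' p) = - (LBINT p. f' p * g p)"
proof -
  have "(LBINT p. f' p * g p + f p * g' p) = 0"
    by (rule acy0_integral_zero[OF acy0_mult[OF assms(1,2)]])
      (use S in \<open>auto intro!: Bochner_Integration.integrable_add sqint_mult_integrable assms\<close>)
  then show ?thesis using assms by (simp add: sqint_mult_integrable)
qed

text \<open>\<open>v = exp (b x) z\<close> and \<open>q = exp (b x) z\<^sub>x\<close> for the difference \<open>z\<close> of two solutions,
  so that \<open>v\<^sub>x = q + b v\<close>, and \<open>\<nu> = exp (b x) z\<^sub>t\<close>.\<close>
lemma energy_estimate:
  assumes b: "b > 0"
    and ax: "acx v (\<lambda>p. q p + b * v p)" "acx q qx" "acx qx qxx" "acx vy (\<lambda>p. qy p + b * vy p)" "acx u a2"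
    and ay: "acy0 B v vy" "acy B qy qyy"
    and L2: "sqint v" "sqint q" "sqint qx" "sqint qxx" "sqint qy" "sqint qyy" "sqint vy" "sqint \<nu>"
      "sqint u" "sqint a1" "sqint a2"
    and S: "\<And>p. p \<notin> strip B \<Longrightarrow> v p = 0" "\<And>p. p \<notin> strip B \<Longrightarrow> vy p = 0"
    and eq: "AE p in lborel. \<nu> p = qx p - b * q p - (qxx p - 2 * b * qx p + b\<^sup>2 * q p) - qyy p
        - (v p * a1 p + u p * q p)"
  shows "(LBINT p. v p * \<nu> p) \<le> (2 * b\<^sup>2 + 4 * b^3 + b + (1 + b) * (2 + b) / b) *
     (1 + (LBINT p. (a1 p)\<^sup>2) + (LBINT p. (a2 p)\<^sup>2) + (LBINT p. (u p)\<^sup>2)) * (LBINT p. (v p)\<^sup>2)"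
proof -
  note [measurable] = L2[THEN sqint_measurable]
  define N where "N = (LBINT p. (v p)\<^sup>2)"
  have N0: "N \<ge> 0" by (simp add: N_def)
  show ?thesis
  \<comment> \<open>If v = 0 almost everywhere, both sides vanish; otherwise \<open>N\<close> can
    enter the AM-GM weights.\<close>
  proof (cases "N = 0")
    case True
    then have "AE p in lborel. (v p)\<^sup>2 = 0"
      unfolding N_def using L2(1) by (subst (asm) integral_nonneg_eq_0_iff_AE) (auto simp: sqint_def)
    then have "(LBINT p. v p * \<nu> p) = (\<integral>p. 0 \<partial>(lborel :: (real \<times> real) measure))"
      by (intro integral_cong_AE) (auto elim: eventually_mono)
    then show ?thesis using True by (simp add: N_def)
  next
    case False
    then have N: "N > 0" using N0 by simp
    define Q Y where "Q = (LBINT p. (q p)\<^sup>2)" and "Y = (LBINT p. (vy p)\<^sup>2)"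
    have Q0: "Q \<ge> 0" and Y0: "Y \<ge> 0" by (simp_all add: Q_def Y_def)
    have vx: "sqint (\<lambda>p. q p + b * v p)" and vyx: "sqint (\<lambda>p. qy p + b * vy p)"
      by (intro sqint_add sqint_cmult L2)+
    note I = sqint_mult_integrable
    have NN: "(LBINT p. v p * v p) = N" and QQ: "(LBINT p. q p * q p) = Q" and YY: "(LBINT p. vy p * vy p) = Y"
      by (simp_all add: N_def Q_def Y_def power2_eq_square)
    have comm: "(LBINT p. f p * g p) = (LBINT p. g p * f p)" for f g :: "real \<times> real \<Rightarrow> real"
      by (simp add: mult.commute)
    have lin: "(LBINT p. (f p + b * g p) * h p) = (LBINT p. f p * h p) + b * (LBINT p. g p * h p)"
      if "sqint f" "sqint g" "sqint h" for f g h :: "real \<times> real \<Rightarrow> real"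
    proof -
      have "integrable lborel (\<lambda>p. f p * h p)" "integrable lborel (\<lambda>p. b * (g p * h p))"
        using that I by auto
      then show ?thesis by (simp add: distrib_right mult.assoc)
    qed
    \<comment> \<open>From (v, v_x) = 0 and v_x = q + b v. The next identities arise alike: moving
      one x-derivative from \<open>qx\<close> or \<open>qxx\<close> onto \<open>v\<close> brings in
      -(q + b v) and lowers the order.\<close>
    have vq: "(LBINT p. v p * q p) = - b * N"
      using acx_ibp[OF ax(1,1) L2(1) vx L2(1) vx] comm[of v "\<lambda>p. q p + b * v p"] comm[of v q]
      unfolding lin[OF L2(2,1,1)] NN by (simp add: algebra_simps)
    have vqx: "(LBINT p. v p * qx p) = - Q + b\<^sup>2 * N"
      using acx_ibp[OF ax(1,2) L2(1) vx L2(2,3)] unfolding lin[OF L2(2,1,2)] QQ vq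
      by (simp add: power2_eq_square)
    have qqx: "(LBINT p. q p * qx p) = 0"
      using acx_ibp[OF ax(2,2) L2(2,3,2,3)] comm[of q qx] by simp
    have vqxx: "(LBINT p. v p * qxx p) = b * Q - b^3 * N"
      using acx_ibp[OF ax(1,3) L2(1) vx L2(3,4)] unfolding lin[OF L2(2,1,3)] qqx vqx
      by (simp add: power2_eq_square power3_eq_cube algebra_simps)
    \<comment> \<open>From (v_y, v_yx) = 0 and v_yx = q_y + b v_y. Integration by parts in y, where
      \<open>v\<close> removes the boundary terms, turns this into the dissipation of v_y.\<close>
    have vyqy: "(LBINT p. vy p * qy p) = - b * Y"
      using acx_ibp[OF ax(4,4) L2(7) vyx L2(7) vyx] comm[of vy "\<lambda>p. qy p + b * vy p"] comm[of vy qy]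
      unfolding lin[OF L2(5,7,7)] YY by (simp add: algebra_simps)
    have vqyy: "(LBINT p. v p * qyy p) = b * Y"
      using acy_ibp[OF ay L2(1,7,5,6) S] vyqy by simp
    \<comment> \<open>From v_x = q + b v and (v, q) = -b N. It expresses the gradient in
      Ladyzhenskaya's inequality through \<open>Q\<close>, which the dissipation controls.\<close>
    have X: "(LBINT p. (q p + b * v p)\<^sup>2) = Q - b\<^sup>2 * N"
    proof -
      have "(LBINT p. (q p + b * v p)\<^sup>2) = (LBINT p. (q p + b * v p) * (q p + b * v p))"
        by (simp add: power2_eq_square)
      also have "\<dots> = (LBINT p. q p * (q p + b * v p)) + b * (LBINT p. v p * (q p + b * v p))"
        by (rule lin[OF L2(2,1) vx])
      also have "\<dots> = Q - b\<^sup>2 * N"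
        unfolding comm[of q "\<lambda>p. q p + b * v p"] comm[of v "\<lambda>p. q p + b * v p"]
          lin[OF L2(2,1,2)] lin[OF L2(2,1,1)] QQ vq NN comm[of q v]
        by (simp add: power2_eq_square algebra_simps)
      finally show ?thesis .
    qed
    note lad = ladyzhenskaya[OF ax(1) ay(1) L2(1) vx L2(7) S N_def N]
    have v2: "sqint (\<lambda>p. (v p)\<^sup>2)" using lad(1) by (simp add: sqint_def)
    define W where "W = Q + Y + N"
    have W: "W > 0" using Q0 Y0 N by (simp add: W_def)
    have v4: "(LBINT p. ((v p)\<^sup>2)\<^sup>2) \<le> 4 * N * W"
    proof -
      have "4 * N * ((Q - b\<^sup>2 * N) + Y + N) \<le> 4 * N * W" using N by (intro mult_left_mono) (auto simp: W_def)
      then show ?thesis using lad(2) unfolding X Y_def[symmetric] by linarith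
    qed
    \<comment> \<open>Chosen such that (2 + b) 2 \<delta> = b. The trilinear terms enter with
      weights at most 1, 1 and b, so their errors add up to b W, whose parts b Q and b Y the
      dissipation absorbs.\<close>
    define \<delta> where "\<delta> = b / (2 * (2 + b))"
    have \<delta>: "\<delta> > 0" using b by (simp add: \<delta>_def)
    have tri: "(LBINT p. \<bar>a p\<bar> * (v p)\<^sup>2) \<le> N / (2 * \<delta>) * (LBINT p. (a p)\<^sup>2) + 2 * \<delta> * W"
      if a: "sqint a" for a :: "real \<times> real \<Rightarrow> real"
    proof -
      \<comment> \<open>With this weight the factor \<open>N\<close> in the bound for v^4 cancels,
        leaving 2 \<delta> W.\<close>
      define m where "m = N / \<delta>"
      have m: "m > 0" using N \<delta> by (simp add: m_def)
      have "(LBINT p. \<bar>a p\<bar> * (v p)\<^sup>2) \<le> (LBINT p. m / 2 * (a p)\<^sup>2 + ((v p)\<^sup>2)\<^sup>2 / (2 * m))"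
      proof (rule integral_mono)
        show "integrable lborel (\<lambda>p. \<bar>a p\<bar> * (v p)\<^sup>2)"
          using integrable_abs[OF I[OF a v2]] by (simp add: abs_mult)
        show "integrable lborel (\<lambda>p. m / 2 * (a p)\<^sup>2 + ((v p)\<^sup>2)\<^sup>2 / (2 * m))"
          using a v2 by (simp add: sqint_def)
        show "\<bar>a p\<bar> * (v p)\<^sup>2 \<le> m / 2 * (a p)\<^sup>2 + ((v p)\<^sup>2)\<^sup>2 / (2 * m)" for p
          using AM_GM_scaled[OF m, of "a p" "(v p)\<^sup>2"] m by (simp add: abs_mult field_simps)
      qed
      also have "\<dots> = m / 2 * (LBINT p. (a p)\<^sup>2) + (LBINT p. ((v p)\<^sup>2)\<^sup>2) / (2 * m)"
        using a v2 by (simp add: sqint_def)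
      also have "\<dots> \<le> m / 2 * (LBINT p. (a p)\<^sup>2) + 4 * N * W / (2 * m)"
        by (intro add_left_mono divide_right_mono v4) (use m in simp)
      also have "\<dots> = N / (2 * \<delta>) * (LBINT p. (a p)\<^sup>2) + 2 * \<delta> * W"
        using N \<delta> by (simp add: m_def field_simps)
      finally show ?thesis .
    qed
    have iva: "integrable lborel (\<lambda>p. v p * (v p * a p))" if "sqint a" for a :: "real \<times> real \<Rightarrow> real"
      using I[OF v2 that] by (simp add: power2_eq_square mult.assoc)
    let ?lin = "\<lambda>p. v p * qx p - b * (v p * q p) - (v p * qxx p - 2 * b * (v p * qx p) + b\<^sup>2 * (v p * q p)) - v p * qyy p"
    have i1: "integrable lborel (\<lambda>p. v p * qx p)" and i2: "integrable lborel (\<lambda>p. v p * q p)"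
      and i3: "integrable lborel (\<lambda>p. v p * qxx p)" and i4: "integrable lborel (\<lambda>p. v p * qyy p)"
      by (intro I L2)+
    have ilin: "integrable lborel ?lin" using i1 i2 i3 i4 by simp
    \<comment> \<open>In the coefficient of \<open>Q\<close> the 1 stems from -u_xx and the 3 b from
      u_xxx; the term -b Y stems from u_xyy.\<close>
    have slin: "integral\<^sup>L lborel ?lin = - (1 + 3 * b) * Q + (2 * b\<^sup>2 + 4 * b^3) * N - b * Y"
    proof -
      have "integral\<^sup>L lborel ?lin = (- Q + b\<^sup>2 * N) - b * (- b * N) - ((b * Q - b^3 * N) - 2 * b * (- Q + b\<^sup>2 * N) + b\<^sup>2 * (- b * N)) - b * Y"
        using i1 i2 i3 i4 by (simp add: vq vqx vqxx vqyy)
      then show ?thesis by (simp add: power2_eq_square power3_eq_cube algebra_simps)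
    qed
    have v\<nu>: "AE p in lborel. v p * \<nu> p = ?lin p - v p * (v p * a1 p) - u p * (v p * q p)"
      using eq
    proof eventually_elim
      case (elim p)
      show ?case unfolding elim by (simp add: algebra_simps)
    qed
    \<comment> \<open>No bound on \<open>u v\<close> is needed here: multiply the equation by \<open>v\<close>; all other terms are integrable.\<close>
    have iuvq: "integrable lborel (\<lambda>p. u p * (v p * q p))"
    proof (rule integrable_cong_AE_imp)
      show "integrable lborel (\<lambda>p. ?lin p - v p * \<nu> p - v p * (v p * a1 p))"
        using ilin I[OF L2(1,8)] iva[OF L2(10)] by simp
      show "AE p in lborel. ?lin p - v p * \<nu> p - v p * (v p * a1 p) = u p * (v p * q p)"
        using v\<nu> by eventually_elim simp
    qed measurable
    have sv\<nu>: "(LBINT p. v p * \<nu> p) = integral\<^sup>L lborel ?lin - (LBINT p. v p * (v p * a1 p)) - (LBINT p. u p * (v p * q p))"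
    proof -
      have "(LBINT p. v p * \<nu> p) = (LBINT p. ?lin p - v p * (v p * a1 p) - u p * (v p * q p))"
      proof (rule integral_cong_AE)
        show "AE p in lborel. v p * \<nu> p = ?lin p - v p * (v p * a1 p) - u p * (v p * q p)" by (rule v\<nu>)
      qed measurable
      also have "\<dots> = integral\<^sup>L lborel ?lin - (LBINT p. v p * (v p * a1 p)) - (LBINT p. u p * (v p * q p))"
        using ilin iva[OF L2(10)] iuvq
        by (subst Bochner_Integration.integral_diff, simp, simp, subst Bochner_Integration.integral_diff) simp_all
      finally show ?thesis .
    qed
    \<comment> \<open>The integral of (u v^2)_x vanishes, and the identity is solved for the term
      with \<open>q\<close>. The integrability of this derivative rests on
      \<open>iuvq\<close>.\<close>
    have uvq: "2 * (LBINT p. u p * (v p * q p)) = - (LBINT p. v p * (v p * a2 p)) - 2 * b * (LBINT p. v p * (v p * u p))"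
    proof -
      let ?g = "\<lambda>p. a2 p * (v p * v p) + u p * ((q p + b * v p) * v p + v p * (q p + b * v p))"
      have g: "?g = (\<lambda>p. v p * (v p * a2 p) + 2 * (u p * (v p * q p)) + 2 * b * (v p * (v p * u p)))"
        by (simp add: algebra_simps fun_eq_iff)
      have ig: "integrable lborel ?g" unfolding g using iva[OF L2(11)] iva[OF L2(9)] iuvq by simp
      have iu: "integrable lborel (\<lambda>p. u p * (v p * v p))"
        using iva[OF L2(9)] by (simp add: mult_ac)
      have "integral\<^sup>L lborel ?g = 0"
        by (rule acx_integral_zero[OF acx_mult[OF ax(5) acx_mult[OF ax(1,1)]] iu ig])
      then show ?thesis unfolding g using iva[OF L2(11)] iva[OF L2(9)] iuvq by simp
    qed
    have abs_bd: "\<bar>\<integral>p. v p * (v p * a p) \<partial>lborel\<bar> \<le> N / (2 * \<delta>) * (LBINT p. (a p)\<^sup>2) + 2 * \<delta> * W"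
      if a: "sqint a" for a :: "real \<times> real \<Rightarrow> real"
    proof -
      have "\<bar>\<integral>p. v p * (v p * a p) \<partial>lborel\<bar> \<le> (LBINT p. \<bar>v p * (v p * a p)\<bar>)" by (rule integral_abs_bound)
      also have "\<dots> = (LBINT p. \<bar>a p\<bar> * (v p)\<^sup>2)"
        by (rule Bochner_Integration.integral_cong) (auto simp: abs_mult power2_eq_square mult_ac)
      finally show ?thesis using tri[OF a] by linarith
    qed
    define A1 A2 A3 where "A1 = (LBINT p. (a1 p)\<^sup>2)" and "A2 = (LBINT p. (a2 p)\<^sup>2)" and "A3 = (LBINT p. (u p)\<^sup>2)"
    have A: "A1 \<ge> 0" "A2 \<ge> 0" "A3 \<ge> 0" by (simp_all add: A1_def A2_def A3_def)
    define R where "R = N / (2 * \<delta>)"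
    have R: "R \<ge> 0" using N \<delta> by (simp add: R_def)
    define P where "P = 2 * \<delta> * W"
    have P: "P \<ge> 0" using W \<delta> by (simp add: P_def)
    have b1: "\<bar>\<integral>p. v p * (v p * a1 p) \<partial>lborel\<bar> \<le> R * A1 + P"
      and b2: "\<bar>\<integral>p. v p * (v p * a2 p) \<partial>lborel\<bar> \<le> R * A2 + P"
      and b3: "\<bar>\<integral>p. v p * (v p * u p) \<partial>lborel\<bar> \<le> R * A3 + P"
      using abs_bd L2 by (simp_all add: R_def P_def A1_def A2_def A3_def)
    have b3': "b * (LBINT p. v p * (v p * u p)) \<le> b * (R * A3 + P)"
      using b3 b by (intro mult_left_mono) auto
    have "(LBINT p. v p * \<nu> p) \<le> - (1 + 3 * b) * Q + (2 * b\<^sup>2 + 4 * b^3) * N - b * Y + (R * A1 + P) + (R * A2 + P) + b * (R * A3 + P)"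
    proof -
      have "- (LBINT p. u p * (v p * q p)) \<le> (R * A2 + P) + b * (R * A3 + P)"
      proof -
        have "- (LBINT p. u p * (v p * q p)) = (LBINT p. v p * (v p * a2 p)) / 2 + b * (LBINT p. v p * (v p * u p))"
          using uvq by simp
        also have "\<dots> \<le> (R * A2 + P) + b * (R * A3 + P)"
        proof (rule add_mono[OF _ b3'])
          have "R * A2 + P \<ge> 0" using R A P by simp
          then show "(LBINT p. v p * (v p * a2 p)) / 2 \<le> R * A2 + P" using b2 by linarith
        qed
        finally show ?thesis .
      qed
      then show ?thesis unfolding sv\<nu> slin using b1 by linarith
    qed
    also have "\<dots> = - (1 + 3 * b) * Q + (2 * b\<^sup>2 + 4 * b^3) * N - b * Y + R * (A1 + A2 + b * A3) + (2 + b) * P"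
      by (simp add: algebra_simps)
    also have "(2 + b) * P = b * W" using b by (simp add: P_def \<delta>_def field_simps)
    also have "- (1 + 3 * b) * Q + (2 * b\<^sup>2 + 4 * b^3) * N - b * Y + R * (A1 + A2 + b * A3) + b * W
       \<le> (2 * b\<^sup>2 + 4 * b^3 + b) * N + R * (A1 + A2 + b * A3)"
      using b Q0 mult_nonneg_nonneg[of b Q] by (simp add: W_def algebra_simps)
    also have "\<dots> \<le> (2 * b\<^sup>2 + 4 * b^3 + b) * N * (1 + A1 + A2 + A3) + (1 + b) * R * (1 + A1 + A2 + A3)"
    proof (rule add_mono)
      have "(2 * b\<^sup>2 + 4 * b^3 + b) * N * 1 \<le> (2 * b\<^sup>2 + 4 * b^3 + b) * N * (1 + A1 + A2 + A3)"
        using b N A by (intro mult_left_mono) auto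
      then show "(2 * b\<^sup>2 + 4 * b^3 + b) * N \<le> (2 * b\<^sup>2 + 4 * b^3 + b) * N * (1 + A1 + A2 + A3)" by simp
      have "A1 + A2 + b * A3 \<le> (1 + b) * (1 + A1 + A2 + A3)"
        using b A by (simp add: algebra_simps)
      then have "R * (A1 + A2 + b * A3) \<le> R * ((1 + b) * (1 + A1 + A2 + A3))" using R by (rule mult_left_mono)
      then show "R * (A1 + A2 + b * A3) \<le> (1 + b) * R * (1 + A1 + A2 + A3)" by (simp add: mult_ac)
    qed
    also have "R = N * ((2 + b) / b)" using b by (simp add: R_def \<delta>_def field_simps)
    finally show ?thesis
      unfolding N_def[symmetric] A1_def[symmetric] A2_def[symmetric] A3_def[symmetric] by (simp add: algebra_simps)
  qed
qed

section \<open>From weak derivatives to absolutely continuous slices\<close>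

lemma
  fixes f :: "'a::euclidean_space \<times> 'b::euclidean_space \<Rightarrow> real"
  shows integrable_lborel_swap: "integrable lborel f \<Longrightarrow> integrable lborel (\<lambda>z. f (snd z, fst z))"
    and integral_lborel_swap: "f \<in> borel_measurable borel \<Longrightarrow> (LBINT z. f (snd z, fst z)) = integral\<^sup>L lborel f"
proof -
  show "integrable lborel (\<lambda>z. f (snd z, fst z))" if "integrable lborel f"
    using lborel_pair.integrable_product_swap[of f] that by (simp add: lborel_prod case_prod_unfold)
  show "(LBINT z. f (snd z, fst z)) = integral\<^sup>L lborel f" if "f \<in> borel_measurable borel"
    using lborel_pair.integral_product_swap[of f] that by (simp add: lborel_prod case_prod_unfold borel_prod)
qed

lemma bump1_measurable [measurable]: "bump1 n a b \<in> borel_measurable borel"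
  by (rule smooth1_measurable[OF smooth1_bump1])

lemma acI_cong:
  assumes "acI a c k l f g" "\<And>t. t \<in> {a<..<c} \<Longrightarrow> f t = f' t" "\<And>t. t \<in> {a<..<c} \<Longrightarrow> g t = g' t"
  shows "acI a c k l f' g'"
proof -
  have ind: "(\<lambda>s. indicator {a<..<t} s *\<^sub>R g s) = (\<lambda>s. indicator {a<..<t} s *\<^sub>R g' s)" if "t \<le> c" for t
    using assms(3) that by (auto simp: indicator_def fun_eq_iff)
  then have "(LINT s:{a<..<t}|lborel. g s) = (LINT s:{a<..<t}|lborel. g' s)" if "t \<le> c" for t
    using that by (simp add: set_lebesgue_integral_def)
  then show ?thesis
    using assms(1,2) ind[of c] unfolding acI_def set_integrable_def by (auto elim!: eventually_mono)
qed

lemma acI_zero: "acI a c 0 0 (\<lambda>t. 0) (\<lambda>t. 0)"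
  by (simp add: acI_def set_integrable_def set_lebesgue_integral_def)

text \<open>Tensor products as test functions match the form of
  \<open>parametric_du_Bois_Reymond\<close>. The support of \<beta> lies in (0, B), so nothing is
  said about the boundary.\<close>

definition weakx :: "real \<Rightarrow> (real \<times> real \<Rightarrow> real) \<Rightarrow> (real \<times> real \<Rightarrow> real) \<Rightarrow> bool" where
  "weakx B f g \<longleftrightarrow> (\<forall>a c \<alpha> \<beta>. ctest a c \<alpha> \<longrightarrow> ctest 0 B \<beta> \<longrightarrow>
     (LBINT p. f p * (deriv \<alpha> (fst p) * \<beta> (snd p))) = - (LBINT p. g p * (\<alpha> (fst p) * \<beta> (snd p))))"

text \<open>The interval in y is a parameter: (0, B) gives the interior weak derivative, while an
  interval reaching beyond the strip, for functions extended by 0, also encodes vanishing boundary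
  values.\<close>

definition weaky :: "real \<Rightarrow> real \<Rightarrow> (real \<times> real \<Rightarrow> real) \<Rightarrow> (real \<times> real \<Rightarrow> real) \<Rightarrow> bool" where
  "weaky a c f g \<longleftrightarrow> (\<forall>a' c' \<alpha> \<beta>. ctest a' c' \<alpha> \<longrightarrow> ctest a c \<beta> \<longrightarrow>
     (LBINT p. f p * (\<alpha> (fst p) * deriv \<beta> (snd p))) = - (LBINT p. g p * (\<alpha> (fst p) * \<beta> (snd p))))"

lemma sqint_mult_fst_snd:
  fixes \<alpha> :: "'a::euclidean_space \<Rightarrow> real" and \<beta> :: "'b::euclidean_space \<Rightarrow> real"
  assumes [measurable]: "\<alpha> \<in> borel_measurable borel" "\<beta> \<in> borel_measurable borel"
    and "integrable lborel (\<lambda>x. (\<alpha> x)\<^sup>2)" "integrable lborel (\<lambda>y. (\<beta> y)\<^sup>2)"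
  shows "sqint (\<lambda>p. \<alpha> (fst p) * \<beta> (snd p))"
  using integrable_lborel_mult_pair[OF assms(3,4)] by (simp add: sqint_def power_mult_distrib)

lemma ctest_square_integrable: "ctest a c \<alpha> \<Longrightarrow> integrable lborel (\<lambda>x. (\<alpha> x)\<^sup>2)"
proof -
  assume \<alpha>: "ctest a c \<alpha>"
  obtain M where M: "\<And>t. \<bar>\<alpha> t\<bar> \<le> M" using ctest_bounded[OF \<alpha>] by blast
  have [measurable]: "\<alpha> \<in> borel_measurable borel" using ctest_integrable[OF \<alpha>] by auto
  show ?thesis
  proof (rule Bochner_Integration.integrable_bound[OF integrable_mult_right[OF ctest_integrable[OF \<alpha>], of M]])
    show "AE x in lborel. norm ((\<alpha> x)\<^sup>2) \<le> norm (M * \<alpha> x)"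
    proof (intro AE_I2)
      fix x
      have "\<bar>\<alpha> x\<bar> * \<bar>\<alpha> x\<bar> \<le> \<bar>M\<bar> * \<bar>\<alpha> x\<bar>"
        using M[of x] by (intro mult_right_mono) auto
      then show "norm ((\<alpha> x)\<^sup>2) \<le> norm (M * \<alpha> x)" by (simp add: power2_eq_square abs_mult)
    qed
  qed measurable
qed

lemma sqint_ctest: "ctest a c \<alpha> \<Longrightarrow> ctest a' c' \<beta> \<Longrightarrow> sqint (\<lambda>p. \<alpha> (fst p) * \<beta> (snd p))"
  using ctest_integrable ctest_square_integrable by (intro sqint_mult_fst_snd) auto

lemma box_ctest: "cbox l u \<subseteq> {a<..<c} \<Longrightarrow> l \<le> u \<Longrightarrow> ctest a c (bump n l u)" for l u :: real
  by (subst bump_real[abs_def]) (auto intro!: ctest_bump1)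

lemma integrable_indicator_Ioo_square: "integrable lborel (\<lambda>x::real. (indicator {a<..<c} x :: real)\<^sup>2)"
proof -
  have "(indicator {a<..<c} x :: real)\<^sup>2 = indicator {a<..<c} x" for x :: real by (simp add: indicator_def)
  then show ?thesis using integrable_indicator_Ioo[of a c] by simp
qed

lemma integrable_cut:
  fixes f :: "real \<times> real \<Rightarrow> real"
  assumes f: "sqint f"
  shows "integrable lborel (\<lambda>p. f p * (indicator {a<..<c} (fst p) * indicator {a'<..<c'} (snd p)))"
  by (rule sqint_mult_integrable[OF f sqint_mult_fst_snd]) (auto intro: integrable_indicator_Ioo_square)

text \<open>The distinguished variable is x and the parameter y ranges over (0, B). The functions
  are cut to (-n, n) to have support in a bounded interval; test functions supported there do not
  see the cut.\<close>

lemma weakx_acx: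
  assumes w: "weakx B f g" and L2: "sqint f" "sqint g"
    and S: "\<And>p. p \<notin> strip B \<Longrightarrow> f p = 0" "\<And>p. p \<notin> strip B \<Longrightarrow> g p = 0"
  shows "acx f g"
proof -
  note [measurable] = L2[THEN sqint_measurable]
  have "AE y in lborel. \<exists>k l. acI (- real n) (real n) k l (\<lambda>x. f (x, y)) (\<lambda>x. g (x, y))" for n :: nat
  proof (cases "n = 0")
    case True
    then show ?thesis by (simp add: acI_def set_integrable_def)
  next
    case False
    let ?I = "{- real n<..<real n}"
    let ?f = "\<lambda>z. indicator ?I (fst z) * f z" and ?g = "\<lambda>z. indicator ?I (fst z) * g z"
    have "AE y in lborel. y \<in> {0<..<B} \<longrightarrow> (\<exists>k l. acI (- real n) (real n) k l (\<lambda>x. ?f (x, y)) (\<lambda>x. ?g (x, y)))"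
    proof (rule parametric_du_Bois_Reymond)
      show "integrable lborel (\<lambda>z. ?f z * indicator (box l u) (snd z))" for l u :: real
        using integrable_cut[OF L2(1), of "- real n" "real n" l u] by (simp add: mult_ac)
      show "integrable lborel (\<lambda>z. ?g z * indicator (box l u) (snd z))" for l u :: real
        using integrable_cut[OF L2(2), of "- real n" "real n" l u] by (simp add: mult_ac)
      fix m l u \<eta> assume lu: "cbox l u \<subseteq> {0<..<B}" and \<eta>: "ctest (- real n) (real n) \<eta>"
      have e: "(\<lambda>z. h' z * (\<gamma> (fst z) * bump m l u (snd z))) = (\<lambda>z. h z * (\<gamma> (fst z) * bump m l u (snd z)))"
        if "ctest (- real n) (real n) \<gamma>" "h' = (\<lambda>z. indicator ?I (fst z) * h z)" for \<gamma> h h'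
        using ctest_outside[OF that(1)] that(2) by (auto simp: fun_eq_iff indicator_def)
      show "(LBINT z. ?f z * (deriv \<eta> (fst z) * bump m l u (snd z)))
          = - (LBINT z. ?g z * (\<eta> (fst z) * bump m l u (snd z)))"
      proof (cases "l \<le> u")
        case True
        then show ?thesis
          using w lu \<eta> box_ctest[OF lu True] unfolding e[OF ctest_deriv[OF \<eta>] refl] e[OF \<eta> refl] weakx_def by blast
      next
        case False
        then show ?thesis using bump_outside[of _ l u m] by simp
      qed
    qed (use False in auto)
    then show ?thesis
    proof eventually_elim
      case (elim y)
      show ?case
      proof (cases "y \<in> {0<..<B}")
        case True
        then obtain k l where "acI (- real n) (real n) k l (\<lambda>x. ?f (x, y)) (\<lambda>x. ?g (x, y))" using elim by blast
        then have "acI (- real n) (real n) k l (\<lambda>x. f (x, y)) (\<lambda>x. g (x, y))" by (rule acI_cong) auto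
        then show ?thesis by blast
      next
        case False
        then have "(\<lambda>x. f (x, y)) = (\<lambda>x. 0)" "(\<lambda>x. g (x, y)) = (\<lambda>x. 0)"
          using S by (auto simp: strip_def fun_eq_iff)
        then show ?thesis using acI_zero by metis
      qed
    qed
  qed
  then show ?thesis unfolding acx_def by (simp add: AE_all_countable)
qed

text \<open>Exchanging the coordinates makes y the distinguished variable. The support condition
  holds because the functions vanish outside the strip and (0, B) lies in (a, c).\<close>

lemma weak_slices_y:
  assumes ac: "a \<le> 0" "0 < B" "B \<le> c"
    and w: "weaky a c f g"
    and L2: "sqint f" "sqint g"
    and S: "\<And>p. p \<notin> strip B \<Longrightarrow> f p = 0" "\<And>p. p \<notin> strip B \<Longrightarrow> g p = 0"
  shows "AE x in lborel. \<exists>k l. acI a c k l (\<lambda>y. f (x, y)) (\<lambda>y. g (x, y))"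
proof -
  note [measurable] = L2[THEN sqint_measurable]
  have "AE x in lborel. x \<in> UNIV \<longrightarrow> (\<exists>k l. acI a c k l (\<lambda>y. f (snd (y, x), fst (y, x))) (\<lambda>y. g (snd (y, x), fst (y, x))))"
  proof (rule parametric_du_Bois_Reymond[OF _ open_UNIV])
    have i: "integrable lborel (\<lambda>z. h (snd z, fst z) * indicator (box l u) (snd z))"
      if "sqint h" "\<And>p. p \<notin> strip B \<Longrightarrow> h p = 0" for h and l u :: real
    proof -
      have "(\<lambda>p. h p * (indicator {l<..<u} (fst p) * indicator {0<..<B} (snd p))) = (\<lambda>p. h p * indicator {l<..<u} (fst p))"
        using that(2) by (force simp: fun_eq_iff strip_def indicator_def)
      then have "integrable lborel (\<lambda>p. h p * indicator {l<..<u} (fst p))"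
        using integrable_cut[OF that(1), of l u 0 B] by simp
      from integrable_lborel_swap[OF this] show ?thesis by simp
    qed
    show "integrable lborel (\<lambda>z. f (snd z, fst z) * indicator (box l u) (snd z))"
      "integrable lborel (\<lambda>z. g (snd z, fst z) * indicator (box l u) (snd z))" for l u :: real
      using i[OF L2(1) S(1)] i[OF L2(2) S(2)] by auto
    fix m l u \<eta> assume \<eta>: "ctest a c \<eta>"
    show "(LBINT z. f (snd z, fst z) * (deriv \<eta> (fst z) * bump m l u (snd z)))
          = - (LBINT z. g (snd z, fst z) * (\<eta> (fst z) * bump m l u (snd z)))"
    proof (cases "l \<le> u")
      case True
      have t: "ctest (l - 1) (u + 1) (bump m l u)" by (rule box_ctest) (use True in auto)
      have [measurable]: "\<eta> \<in> borel_measurable borel" "deriv \<eta> \<in> borel_measurable borel"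
        using ctest_integrable \<eta> ctest_deriv[OF \<eta>] by auto
      have "(LBINT z. f (snd z, fst z) * (deriv \<eta> (fst z) * bump m l u (snd z)))
        = (LBINT p. f p * (bump m l u (fst p) * deriv \<eta> (snd p)))"
        by (subst integral_lborel_swap[symmetric]) (simp_all add: mult_ac)
      also have "\<dots> = - (LBINT p. g p * (bump m l u (fst p) * \<eta> (snd p)))"
        using w t \<eta> unfolding weaky_def by blast
      also have "(LBINT p. g p * (bump m l u (fst p) * \<eta> (snd p)))
        = (LBINT z. g (snd z, fst z) * (\<eta> (fst z) * bump m l u (snd z)))"
        by (subst integral_lborel_swap[symmetric]) (simp_all add: mult_ac)
      finally show ?thesis .
    next
      case False
      then show ?thesis using bump_outside[of _ l u m] by simp
    qed
  qed (use S ac in \<open>auto simp: strip_def\<close>)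
  then show ?thesis by simp
qed

lemma weaky_acy:
  assumes B: "B > 0" and w: "weaky 0 B f g" and L2: "sqint f" "sqint g"
    and S: "\<And>p. p \<notin> strip B \<Longrightarrow> f p = 0" "\<And>p. p \<notin> strip B \<Longrightarrow> g p = 0"
  shows "acy B f g"
proof -
  have "AE x in lborel. \<exists>k l. acI 0 B k l (\<lambda>y. f (x, y)) (\<lambda>y. g (x, y))"
    using B by (intro weak_slices_y[where B=B] w L2 S) auto
  then show ?thesis using L2 by (simp add: acy_def sqint_def)
qed

text \<open>The extension by 0 is absolutely continuous on (-1, B + 1). It vanishes on (-1, 0),
  which forces the initial constant to be 0, and on (B, B + 1), which forces the derivative to have
  integral 0 over (0, B). Any margins of positive length would serve.\<close>

lemma weaky_acy0:
  assumes B: "B > 0" and w: "weaky (-1) (B + 1) f g" and L2: "sqint f" "sqint g"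
    and S: "\<And>p. p \<notin> strip B \<Longrightarrow> f p = 0" "\<And>p. p \<notin> strip B \<Longrightarrow> g p = 0"
  shows "acy0 B f g"
proof -
  have "AE x in lborel. \<exists>k l. acI (-1) (B + 1) k l (\<lambda>y. f (x, y)) (\<lambda>y. g (x, y))"
    using B by (intro weak_slices_y[where B=B] w L2 S) auto
  then have "AE x in lborel. acI 0 B 0 0 (\<lambda>y. f (x, y)) (\<lambda>y. g (x, y))"
  proof eventually_elim
    case (elim x)
    then obtain k l where ac: "acI (-1) (B + 1) k l (\<lambda>y. f (x, y)) (\<lambda>y. g (x, y))" by auto
    have fz: "f (x, t) = 0" and gz: "g (x, t) = 0" if "t \<notin> {0<..<B}" for t
      using S[of "(x, t)"] that by (auto simp: strip_def)
    have ae: "AE t in lborel. t \<in> {-1<..<B + 1} \<longrightarrow> f (x, t) = k + (LINT s:{-1<..<t}|lborel. g (x, s))"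
      using ac by (simp add: acI_def)
    \<comment> \<open>A representation valid almost everywhere holds at some point of every
      nondegenerate subinterval; one such point on either side of the strip is enough.\<close>
    have ex: "\<exists>t\<in>{r<..<s}. f (x, t) = k + (LINT s:{-1<..<t}|lborel. g (x, s))" if "r < s" "-1 \<le> r" "s \<le> B + 1" for r s
    proof (rule ccontr)
      assume n: "\<not> ?thesis"
      have "AE t in lborel. t \<notin> {r<..<s}" using ae by eventually_elim (use n that in auto)
      then have "{r<..<s} \<in> null_sets lborel" by (simp add: AE_iff_null_sets)
      then show False using that by (auto simp: null_sets_def)
    qed
    have G: "(LINT s:{-1<..<t}|lborel. g (x, s)) = (LINT s:{0<..<t}|lborel. g (x, s))" if "t \<ge> 0" for t
      unfolding set_lebesgue_integral_def
      by (rule Bochner_Integration.integral_cong) (use gz that in \<open>force simp: indicator_def\<close>)+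
    have G0: "(LINT s:{-1<..<t}|lborel. g (x, s)) = 0" if "t \<le> 0" for t
    proof -
      have "(\<lambda>s. indicator {-1<..<t} s *\<^sub>R g (x, s)) = (\<lambda>s. 0)"
        using gz that by (force simp: indicator_def fun_eq_iff)
      then show ?thesis unfolding set_lebesgue_integral_def by simp
    qed
    have GB: "(LINT s:{0<..<t}|lborel. g (x, s)) = (LINT s:{0<..<B}|lborel. g (x, s))" if "t \<ge> B" for t
      unfolding set_lebesgue_integral_def
      by (rule Bochner_Integration.integral_cong) (use gz that in \<open>force simp: indicator_def\<close>)+
    obtain t where "t \<in> {-1<..<0}" "f (x, t) = k + (LINT s:{-1<..<t}|lborel. g (x, s))"
      using ex[of "-1" 0] B by auto
    then have k: "k = 0" using fz[of t] G0[of t] by auto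
    obtain t where "t \<in> {B<..<B + 1}" "f (x, t) = k + (LINT s:{-1<..<t}|lborel. g (x, s))"
      using ex[of B "B + 1"] B by auto
    then have l: "(LINT s:{0<..<B}|lborel. g (x, s)) = 0" using fz[of t] G[of t] GB[of t] k B by auto
    have "set_integrable lborel {0<..<B} (\<lambda>y. g (x, y))"
      by (rule set_integrable_subset[where A="{-1<..<B + 1}"]) (use ac in \<open>auto simp: acI_def\<close>)
    moreover have "AE t in lborel. t \<in> {0<..<B} \<longrightarrow> f (x, t) = 0 + (LINT s:{0<..<t}|lborel. g (x, s))"
      using ae by eventually_elim (use G k in auto)
    ultimately show ?case using l by (simp add: acI_def)
  qed
  then show ?thesis using L2 by (simp add: acy0_def sqint_def)
qed

section \<open>Test functions and weak derivatives\<close>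

lemma smooth2_coinduct:
  assumes "f \<in> C"
    and step: "\<And>g. g \<in> C \<Longrightarrow> continuous_on UNIV g \<and> pdir True g \<in> C \<and> pdir False g \<in> C \<and>
      (\<forall>p. (\<lambda>s. g (s, snd p)) differentiable (at (fst p)) \<and> (\<lambda>s. g (fst p, s)) differentiable (at (snd p)))"
  shows "smooth2 f"
proof -
  have "pdw ds f \<in> C" for ds
  proof (induction ds)
    case (Cons d ds)
    then show ?case using step by (cases d) auto
  qed (use assms in auto)
  then show ?thesis unfolding smooth2_def using step by blast
qed

lemma pdw_append: "pdw (ds @ es) f = pdw ds (pdw es f)"
  by (induction ds) auto

lemma smooth2_pdir: assumes "smooth2 f" shows "smooth2 (pdir d f)"
proof -
  have "pdw ds (pdir d f) = pdw (ds @ [d]) f" for ds by (simp add: pdw_append)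
  then show ?thesis using assms unfolding smooth2_def by metis
qed

lemma smooth2_continuous: "smooth2 f \<Longrightarrow> continuous_on UNIV f"
  unfolding smooth2_def by (metis pdw.simps(1))

lemma smooth2_measurable: "smooth2 f \<Longrightarrow> f \<in> borel_measurable borel"
  using smooth2_continuous borel_measurable_continuous_onI by blast

lemma smooth2_differentiable:
  assumes "smooth2 f"
  shows "(\<lambda>s. f (s, y)) differentiable (at x)" "(\<lambda>s. f (x, s)) differentiable (at y)"
proof -
  have "(\<lambda>s. pdw [] f (s, snd (x, y))) differentiable (at (fst (x, y)))"
    "(\<lambda>s. pdw [] f (fst (x, y), s)) differentiable (at (snd (x, y)))"
    using assms unfolding smooth2_def by blast+
  then show "(\<lambda>s. f (s, y)) differentiable (at x)" "(\<lambda>s. f (x, s)) differentiable (at y)" by simp_all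
qed

lemma smooth2_has_deriv:
  assumes "smooth2 f"
  shows "((\<lambda>s. f (s, y)) has_real_derivative pdir True f (x, y)) (at x)"
    "((\<lambda>s. f (x, s)) has_real_derivative pdir False f (x, y)) (at y)"
  using smooth2_differentiable[OF assms] by (simp_all add: pdir_def DERIV_deriv_iff_real_differentiable)

text \<open>The partial derivatives are exhibited as members of \<open>C\<close>, so that closure
  under \<open>pdir\<close> becomes a computation with \<open>has_real_derivative\<close>.\<close>

lemma smooth2_coinductI:
  assumes "f \<in> C"
    and step: "\<And>g. g \<in> C \<Longrightarrow> continuous_on UNIV g \<and>
      (\<exists>g1\<in>C. \<forall>x y. ((\<lambda>s. g (s, y)) has_real_derivative g1 (x, y)) (at x)) \<and>
      (\<exists>g2\<in>C. \<forall>x y. ((\<lambda>s. g (x, s)) has_real_derivative g2 (x, y)) (at y))"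
  shows "smooth2 f"
proof (rule smooth2_coinduct[OF assms(1)])
  fix g assume "g \<in> C"
  then obtain g1 g2 where g: "continuous_on UNIV g" "g1 \<in> C" "g2 \<in> C"
    "\<And>x y. ((\<lambda>s. g (s, y)) has_real_derivative g1 (x, y)) (at x)" "\<And>x y. ((\<lambda>s. g (x, s)) has_real_derivative g2 (x, y)) (at y)"
    using step by blast
  have "pdir True g = g1" "pdir False g = g2"
    using DERIV_imp_deriv[OF g(4)] DERIV_imp_deriv[OF g(5)] by (auto simp: pdir_def fun_eq_iff)
  then show "continuous_on UNIV g \<and> pdir True g \<in> C \<and> pdir False g \<in> C \<and>
      (\<forall>p. (\<lambda>s. g (s, snd p)) differentiable (at (fst p)) \<and> (\<lambda>s. g (fst p, s)) differentiable (at (snd p)))"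
    using g real_differentiable_def by blast
qed

lemma smooth2_lincomb:
  assumes "smooth2 f" "smooth2 g" shows "smooth2 (\<lambda>p. a * f p + g p)"
proof (rule smooth2_coinductI)
  let ?C = "{(\<lambda>p. a * f p + g p) |f g. smooth2 f \<and> smooth2 g}"
  show "(\<lambda>p. a * f p + g p) \<in> ?C" using assms by blast
  fix h assume "h \<in> ?C"
  then obtain f g where h: "h = (\<lambda>p. a * f p + g p)" and fg: "smooth2 f" "smooth2 g" by auto
  show "continuous_on UNIV h \<and>
      (\<exists>g1\<in>?C. \<forall>x y. ((\<lambda>s. h (s, y)) has_real_derivative g1 (x, y)) (at x)) \<and>
      (\<exists>g2\<in>?C. \<forall>x y. ((\<lambda>s. h (x, s)) has_real_derivative g2 (x, y)) (at y))"
  proof (intro conjI)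
    show "continuous_on UNIV h" unfolding h
      using fg smooth2_continuous by (intro continuous_intros) auto
    show "\<exists>g1\<in>?C. \<forall>x y. ((\<lambda>s. h (s, y)) has_real_derivative g1 (x, y)) (at x)"
    proof (intro bexI[of _ "\<lambda>p. a * pdir True f p + pdir True g p"] allI)
      show "((\<lambda>s. h (s, y)) has_real_derivative a * pdir True f (x, y) + pdir True g (x, y)) (at x)" for x y
        unfolding h using fg by (intro DERIV_add DERIV_cmult smooth2_has_deriv)
    qed (use fg smooth2_pdir in blast)
    show "\<exists>g2\<in>?C. \<forall>x y. ((\<lambda>s. h (x, s)) has_real_derivative g2 (x, y)) (at y)"
    proof (intro bexI[of _ "\<lambda>p. a * pdir False f p + pdir False g p"] allI)
      show "((\<lambda>s. h (x, s)) has_real_derivative a * pdir False f (x, y) + pdir False g (x, y)) (at y)" for x y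
        unfolding h using fg by (intro DERIV_add DERIV_cmult smooth2_has_deriv)
    qed (use fg smooth2_pdir in blast)
  qed
qed

text \<open>Since the weight is smooth, multiplication by it maps test functions to test functions.
  Weak derivatives of u and of exp(b x) u are converted into one another by putting the weight on
  the test function.\<close>

lemma smooth2_exp_mult:
  assumes "smooth2 f" shows "smooth2 (\<lambda>p. exp (c * fst p) * f p)"
    and "pdir True (\<lambda>p. exp (c * fst p) * f p) = (\<lambda>p. exp (c * fst p) * (c * f p + pdir True f p))"
    and "pdir False (\<lambda>p. exp (c * fst p) * f p) = (\<lambda>p. exp (c * fst p) * pdir False f p)"
proof -
  have D1: "((\<lambda>s. exp (c * fst (s, y)) * g (s, y)) has_real_derivative exp (c * x) * (c * g (x, y) + pdir True g (x, y))) (at x)"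
    and D2: "((\<lambda>s. exp (c * fst (x, s)) * g (x, s)) has_real_derivative exp (c * x) * pdir False g (x, y)) (at y)"
    if "smooth2 g" for g x y
  proof -
    have "((\<lambda>s. exp (c * s) * g (s, y)) has_real_derivative (exp (c * x) * c) * g (x, y) + pdir True g (x, y) * exp (c * x)) (at x)"
      by (rule DERIV_mult[OF _ smooth2_has_deriv(1)[OF that]]) (auto intro!: derivative_eq_intros)
    then show "((\<lambda>s. exp (c * fst (s, y)) * g (s, y)) has_real_derivative exp (c * x) * (c * g (x, y) + pdir True g (x, y))) (at x)"
      by (simp add: algebra_simps)
    show "((\<lambda>s. exp (c * fst (x, s)) * g (x, s)) has_real_derivative exp (c * x) * pdir False g (x, y)) (at y)"
      using DERIV_cmult[OF smooth2_has_deriv(2)[OF that]] by simp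
  qed
  let ?C = "{(\<lambda>p. exp (c * fst p) * g p) |g. smooth2 g}"
  show "smooth2 (\<lambda>p. exp (c * fst p) * f p)"
  proof (rule smooth2_coinductI[where C="?C"])
    fix h assume "h \<in> ?C"
    then obtain g where h: "h = (\<lambda>p. exp (c * fst p) * g p)" and g: "smooth2 g" by auto
    show "continuous_on UNIV h \<and>
      (\<exists>g1\<in>?C. \<forall>x y. ((\<lambda>s. h (s, y)) has_real_derivative g1 (x, y)) (at x)) \<and>
      (\<exists>g2\<in>?C. \<forall>x y. ((\<lambda>s. h (x, s)) has_real_derivative g2 (x, y)) (at y))"
    proof (intro conjI)
      show "continuous_on UNIV h" unfolding h
        using g smooth2_continuous by (intro continuous_intros) auto
      show "\<exists>g1\<in>?C. \<forall>x y. ((\<lambda>s. h (s, y)) has_real_derivative g1 (x, y)) (at x)"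
      proof (intro bexI[of _ "\<lambda>p. exp (c * fst p) * (c * g p + pdir True g p)"] allI)
        show "(\<lambda>p. exp (c * fst p) * (c * g p + pdir True g p)) \<in> ?C"
          using smooth2_lincomb[OF g smooth2_pdir[OF g, of True], of c]
          by (intro CollectI exI[of _ "\<lambda>p. c * g p + pdir True g p"]) simp
        show "((\<lambda>s. h (s, y)) has_real_derivative exp (c * fst (x, y)) * (c * g (x, y) + pdir True g (x, y))) (at x)" for x y
          unfolding h using D1[OF g] by simp
      qed
      show "\<exists>g2\<in>?C. \<forall>x y. ((\<lambda>s. h (x, s)) has_real_derivative g2 (x, y)) (at y)"
      proof (intro bexI[of _ "\<lambda>p. exp (c * fst p) * pdir False g p"] allI)
        show "(\<lambda>p. exp (c * fst p) * pdir False g p) \<in> ?C" using smooth2_pdir[OF g] by blast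
        show "((\<lambda>s. h (x, s)) has_real_derivative exp (c * fst (x, y)) * pdir False g (x, y)) (at y)" for x y
          unfolding h using D2[OF g] by simp
      qed
    qed
  qed (use assms in blast)
  show "pdir True (\<lambda>p. exp (c * fst p) * f p) = (\<lambda>p. exp (c * fst p) * (c * f p + pdir True f p))"
    "pdir False (\<lambda>p. exp (c * fst p) * f p) = (\<lambda>p. exp (c * fst p) * pdir False f p)"
    using DERIV_imp_deriv[OF D1[OF assms]] DERIV_imp_deriv[OF D2[OF assms]] by (auto simp: pdir_def fun_eq_iff)
qed

lemma smooth2_tensor:
  assumes "smooth1 \<alpha>" "smooth1 \<beta>" shows "smooth2 (\<lambda>p. \<alpha> (fst p) * \<beta> (snd p))"
    and "pdir True (\<lambda>p. \<alpha> (fst p) * \<beta> (snd p)) = (\<lambda>p. deriv \<alpha> (fst p) * \<beta> (snd p))"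
    and "pdir False (\<lambda>p. \<alpha> (fst p) * \<beta> (snd p)) = (\<lambda>p. \<alpha> (fst p) * deriv \<beta> (snd p))"
proof -
  have D1: "((\<lambda>s. \<alpha> (fst (s, y)) * \<beta> (snd (s, y))) has_real_derivative deriv \<alpha> x * \<beta> y) (at x)"
    and D2: "((\<lambda>s. \<alpha> (fst (x, s)) * \<beta> (snd (x, s))) has_real_derivative \<alpha> x * deriv \<beta> y) (at y)"
    if "smooth1 \<alpha>" "smooth1 \<beta>" for \<alpha> \<beta> and x y :: real
    using DERIV_cmult_right[OF smooth1_has_deriv[OF that(1)]] DERIV_cmult[OF smooth1_has_deriv[OF that(2)]] by simp_all
  let ?C = "{(\<lambda>p. \<alpha> (fst p) * \<beta> (snd p)) |\<alpha> \<beta>. smooth1 \<alpha> \<and> smooth1 \<beta>}"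
  show "smooth2 (\<lambda>p. \<alpha> (fst p) * \<beta> (snd p))"
  proof (rule smooth2_coinductI[where C="?C"])
    fix h assume "h \<in> ?C"
    then obtain \<alpha> \<beta> where h: "h = (\<lambda>p. \<alpha> (fst p) * \<beta> (snd p))" and g: "smooth1 \<alpha>" "smooth1 \<beta>" by auto
    show "continuous_on UNIV h \<and>
      (\<exists>g1\<in>?C. \<forall>x y. ((\<lambda>s. h (s, y)) has_real_derivative g1 (x, y)) (at x)) \<and>
      (\<exists>g2\<in>?C. \<forall>x y. ((\<lambda>s. h (x, s)) has_real_derivative g2 (x, y)) (at y))"
    proof (intro conjI)
      show "continuous_on UNIV h" unfolding h
        by (intro continuous_on_mult continuous_on_compose2[OF smooth1_continuous[OF g(1), of UNIV]]
            continuous_on_compose2[OF smooth1_continuous[OF g(2), of UNIV]] continuous_intros) auto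
      show "\<exists>g1\<in>?C. \<forall>x y. ((\<lambda>s. h (s, y)) has_real_derivative g1 (x, y)) (at x)"
      proof (intro bexI[of _ "\<lambda>p. deriv \<alpha> (fst p) * \<beta> (snd p)"] allI)
        show "((\<lambda>s. h (s, y)) has_real_derivative deriv \<alpha> (fst (x, y)) * \<beta> (snd (x, y))) (at x)" for x y
          unfolding h using D1[OF g] by simp
      qed (use smooth1_deriv g in blast)
      show "\<exists>g2\<in>?C. \<forall>x y. ((\<lambda>s. h (x, s)) has_real_derivative g2 (x, y)) (at y)"
      proof (intro bexI[of _ "\<lambda>p. \<alpha> (fst p) * deriv \<beta> (snd p)"] allI)
        show "((\<lambda>s. h (x, s)) has_real_derivative \<alpha> (fst (x, y)) * deriv \<beta> (snd (x, y))) (at y)" for x y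
          unfolding h using D2[OF g] by simp
      qed (use smooth1_deriv g in blast)
    qed
  qed (use assms in blast)
  show "pdir True (\<lambda>p. \<alpha> (fst p) * \<beta> (snd p)) = (\<lambda>p. deriv \<alpha> (fst p) * \<beta> (snd p))"
    "pdir False (\<lambda>p. \<alpha> (fst p) * \<beta> (snd p)) = (\<lambda>p. \<alpha> (fst p) * deriv \<beta> (snd p))"
    using DERIV_imp_deriv[OF D1[OF assms]] DERIV_imp_deriv[OF D2[OF assms]] by (auto simp: pdir_def fun_eq_iff)
qed

section \<open>Test functions on the plane\<close>

lemma test2_smooth2: "test2 U \<phi> \<Longrightarrow> smooth2 \<phi>"
  by (simp add: test2_def)

lemma test2_pdir: assumes "test2 U f" shows "test2 U (pdir d f)"
proof -
  obtain K where K: "compact K" "K \<subseteq> U" "\<And>p. p \<notin> K \<Longrightarrow> f p = 0" using assms unfolding test2_def by blast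
  have "pdir d f p = 0" if "p \<notin> K" for p
  proof -
    have o: "open (- K)" using K(1) by (simp add: compact_imp_closed open_Compl)
    have "deriv (\<lambda>s. f (s, snd p)) (fst p) = deriv (\<lambda>s. 0) (fst p)"
    proof (rule deriv_cong_ev)
      have "open ((\<lambda>s. (s, snd p)) -` (- K))"
        by (rule open_vimage[OF o]) (intro continuous_intros)
      then show "\<forall>\<^sub>F s in nhds (fst p). f (s, snd p) = 0"
        unfolding eventually_nhds using that K(3) by (intro exI[of _ "(\<lambda>s. (s, snd p)) -` (- K)"]) auto
    qed simp
    moreover have "deriv (\<lambda>s. f (fst p, s)) (snd p) = deriv (\<lambda>s. 0) (snd p)"
    proof (rule deriv_cong_ev)
      have "open ((\<lambda>s. (fst p, s)) -` (- K))"
        by (rule open_vimage[OF o]) (intro continuous_intros)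
      then show "\<forall>\<^sub>F s in nhds (snd p). f (fst p, s) = 0"
        unfolding eventually_nhds using that K(3) by (intro exI[of _ "(\<lambda>s. (fst p, s)) -` (- K)"]) auto
    qed simp
    ultimately show ?thesis by (simp add: pdir_def)
  qed
  then show ?thesis using K assms smooth2_pdir unfolding test2_def by blast
qed

lemma test2_pd: assumes "test2 U f" shows "test2 U (pd i j f)"
proof -
  have "test2 U ((pdir d ^^ n) g)" if "test2 U g" for d n g
    by (induction n) (use that test2_pdir in auto)
  then show ?thesis unfolding pd_def using assms by blast
qed

lemma test2_exp_mult: "test2 U f \<Longrightarrow> test2 U (\<lambda>p. exp (c * fst p) * f p)"
  unfolding test2_def using smooth2_exp_mult(1) by (metis mult_zero_right)

lemma pd_simps:
  "pd 0 0 f = f" "pd 1 0 f = pdir True f" "pd 2 0 f = pdir True (pdir True f)"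
  "pd 0 1 f = pdir False f" "pd 0 2 f = pdir False (pdir False f)"
  "pd 3 0 f = pdir True (pdir True (pdir True f))" "pd 1 1 f = pdir True (pdir False f)"
  "pd 1 2 f = pdir True (pdir False (pdir False f))"
  by (simp_all add: pd_def numeral_2_eq_2 numeral_3_eq_3)

lemma test2_tensor:
  assumes "ctest a c \<alpha>" "ctest a' c' \<beta>" and sub: "\<And>x y. y \<in> {a'<..<c'} \<Longrightarrow> (x, y) \<in> U"
  shows "test2 U (\<lambda>p. \<alpha> (fst p) * \<beta> (snd p))"
proof -
  obtain r s where rs: "\<And>t. t < r \<or> s < t \<Longrightarrow> \<alpha> t = 0" "smooth1 \<alpha>" using assms(1) unfolding ctest_def by metis
  obtain r' s' where rs': "a' < r'" "s' < c'" "\<And>t. t < r' \<or> s' < t \<Longrightarrow> \<beta> t = 0" "smooth1 \<beta>" using assms(2) unfolding ctest_def by metis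
  have "compact ({r..s} \<times> {r'..s'})" by (intro compact_Times) auto
  moreover have "{r..s} \<times> {r'..s'} \<subseteq> U" using sub rs' by auto
  moreover have "\<alpha> (fst p) * \<beta> (snd p) = 0" if "p \<notin> {r..s} \<times> {r'..s'}" for p
    using that rs(1)[of "fst p"] rs'(3)[of "snd p"] by (cases p) (auto simp: not_le)
  ultimately show ?thesis unfolding test2_def using smooth2_tensor(1)[OF rs(2) rs'(4)] by blast
qed

lemma open_strip: "open (strip B)"
proof -
  have "strip B = UNIV \<times> {0<..<B}" by (auto simp: strip_def)
  then show ?thesis by (simp add: open_Times)
qed

lemma sqint_test2: assumes "test2 U \<phi>" shows "sqint \<phi>"
proof -
  obtain K where K: "compact K" "\<And>p. p \<notin> K \<Longrightarrow> \<phi> p = 0" using assms unfolding test2_def by blast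
  have "continuous_on K (\<lambda>p. (\<phi> p)\<^sup>2)"
    using smooth2_continuous[OF test2_smooth2[OF assms]] by (intro continuous_intros) (auto intro: continuous_on_subset)
  then have "integrable lborel (\<lambda>p. indicator K p *\<^sub>R (\<phi> p)\<^sup>2)" by (rule borel_integrable_compact[OF K(1)])
  moreover have "(\<lambda>p. indicator K p *\<^sub>R (\<phi> p)\<^sup>2) = (\<lambda>p. (\<phi> p)\<^sup>2)" using K(2) by (auto simp: indicator_def fun_eq_iff)
  ultimately show ?thesis using smooth2_measurable[OF test2_smooth2[OF assms]] by (simp add: sqint_def)
qed

section \<open>Borel versions of Lebesgue measurable functions\<close>

lemma
  fixes h H :: "'a::euclidean_space \<Rightarrow> real"
  assumes H[measurable]: "H \<in> borel_measurable borel" and ae: "AE x in lborel. h x = H x"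
  shows lebesgue_measurable_rep: "h \<in> borel_measurable lebesgue"
    and lebesgue_integrable_rep: "integrable lebesgue h \<longleftrightarrow> integrable lborel H"
    and lebesgue_integral_rep: "integral\<^sup>L lebesgue h = integral\<^sup>L lborel H"
proof -
  have Hl: "H \<in> borel_measurable lebesgue" using H by (simp add: measurable_completion)
  have ae': "AE x in lebesgue. h x = H x" using ae by (simp add: AE_completion)
  then have ae'': "AE x in lebesgue. H x = h x" by eventually_elim simp
  show hm: "h \<in> borel_measurable lebesgue" by (rule borel_measurable_AE[OF Hl ae''])
  show "integrable lebesgue h \<longleftrightarrow> integrable lborel H"
    using integrable_cong_AE[OF hm Hl ae'] integrable_completion[of H lborel] by simp
  show "integral\<^sup>L lebesgue h = integral\<^sup>L lborel H"
    using integral_cong_AE[OF hm Hl ae'] integral_completion[of H lborel] by simp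
qed

text \<open>The problem is stated with the completed Lebesgue measure, while Fubini and the slicing
  lemmas live on \<open>lborel\<close>. A Borel version that is 0 off \<open>S\<close> turns
  integrals over \<open>S\<close> into integrals over the whole space, and it is the zero extension
  through which the boundary condition is expressed.\<close>

definition rep :: "'a::euclidean_space set \<Rightarrow> ('a \<Rightarrow> real) \<Rightarrow> ('a \<Rightarrow> real) \<Rightarrow> bool" where
  "rep S f F \<longleftrightarrow> F \<in> borel_measurable borel \<and> (\<forall>p. p \<notin> S \<longrightarrow> F p = 0) \<and> (AE p in lborel. p \<in> S \<longrightarrow> f p = F p)"

lemma rep_exists:
  assumes S: "S \<in> sets borel" and f: "set_borel_measurable lebesgue S f"
  obtains F where "rep S f F"
proof -
  obtain g where g: "g \<in> borel_measurable lborel" "AE p in lborel. indicator S p *\<^sub>R f p = g p"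
    using completion_ex_borel_measurable_real f unfolding set_borel_measurable_def by blast
  have "rep S f (\<lambda>p. indicator S p * g p)"
    unfolding rep_def
  proof (intro conjI)
    show "(\<lambda>p. indicator S p * g p) \<in> borel_measurable borel" using g(1) S by simp
    show "AE p in lborel. p \<in> S \<longrightarrow> f p = indicator S p * g p"
      using g(2) by eventually_elim auto
  qed auto
  then show ?thesis using that by blast
qed

lemma rep_measurable: "rep S f F \<Longrightarrow> F \<in> borel_measurable borel"
  by (simp add: rep_def)

lemma
  assumes r: "rep S f F"
  shows rep_integral: "\<psi> \<in> borel_measurable borel \<Longrightarrow> (LINT p:S|lebesgue. f p * \<psi> p) = (LBINT p. F p * \<psi> p)"
    and rep_L2: "L2 S f \<longleftrightarrow> sqint F"
    and rep_L2norm2: "L2norm2 S f = (LBINT p. (F p)\<^sup>2)"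
proof -
  have F [measurable]: "F \<in> borel_measurable borel" using r by (rule rep_measurable)
  have F0: "p \<notin> S \<Longrightarrow> F p = 0" for p using r unfolding rep_def by blast
  have *: "AE p in lborel. indicator S p *\<^sub>R (k p) = K p"
    if "AE p in lborel. p \<in> S \<longrightarrow> f p = F p \<longrightarrow> k p = K p" "\<And>p. F p = 0 \<Longrightarrow> K p = 0" for k K :: "_ \<Rightarrow> real"
  proof -
    have "AE p in lborel. p \<in> S \<longrightarrow> f p = F p" using r by (simp add: rep_def)
    with that(1) show ?thesis
    proof eventually_elim
      case (elim p)
      then show ?case using that(2)[of p] F0[of p] by (cases "p \<in> S") simp_all
    qed
  qed
  have m: "set_borel_measurable lebesgue S f"
    unfolding set_borel_measurable_def by (rule lebesgue_measurable_rep[OF F]) (rule *, auto)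
  show "(LINT p:S|lebesgue. f p * \<psi> p) = (LBINT p. F p * \<psi> p)" if [measurable]: "\<psi> \<in> borel_measurable borel"
    unfolding set_lebesgue_integral_def by (rule lebesgue_integral_rep) (measurable, rule *, auto)
  show "L2norm2 S f = (LBINT p. (F p)\<^sup>2)"
    unfolding L2norm2_def set_lebesgue_integral_def by (rule lebesgue_integral_rep) (measurable, rule *, auto)
  have "set_integrable lebesgue S (\<lambda>p. (f p)\<^sup>2) \<longleftrightarrow> integrable lborel (\<lambda>p. (F p)\<^sup>2)"
    unfolding set_integrable_def by (rule lebesgue_integrable_rep) (measurable, rule *, auto)
  then show "L2 S f \<longleftrightarrow> sqint F" using m F by (simp add: L2_def sqint_def)
qed

lemma rep_cong_mult:
  assumes "rep S f F" "m \<in> borel_measurable borel" shows "rep S (\<lambda>p. m p * f p) (\<lambda>p. m p * F p)"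
  using assms by (auto simp: rep_def elim!: eventually_mono)

section \<open>Weak derivatives of Borel versions\<close>

lemma weak_op_single:
  "weak_pd U f i j g \<longleftrightarrow> loc_int U f \<and> loc_int U g \<and> (\<forall>\<phi>. test2 U \<phi> \<longrightarrow>
     (LINT p:U|lebesgue. f p * ((-1)^(i+j) * pd i j \<phi> p)) = (LINT p:U|lebesgue. g p * \<phi> p))"
  by (simp add: weak_pd_def weak_op_def)

text \<open>The integral identity of \<open>weak_pd\<close> for Borel versions. Local integrability
  is kept apart; for the unweighted derivatives \<open>loc_int_exp_sqint\<close> supplies
  it.\<close>

definition wpd :: "(real \<times> real) set \<Rightarrow> (real \<times> real \<Rightarrow> real) \<Rightarrow> nat \<Rightarrow> nat \<Rightarrow> (real \<times> real \<Rightarrow> real) \<Rightarrow> bool" where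
  "wpd U F i j G \<longleftrightarrow> (\<forall>\<phi>. test2 U \<phi> \<longrightarrow> (LBINT p. F p * pd i j \<phi> p) = (-1)^(i+j) * (LBINT p. G p * \<phi> p))"

lemma weak_pd_rep:
  assumes "rep U f F" "rep U g G"
  shows "weak_pd U f i j g \<longleftrightarrow> loc_int U f \<and> loc_int U g \<and> wpd U F i j G"
proof -
  have "(LINT p:U|lebesgue. f p * ((-1)^(i+j) * pd i j \<phi> p)) = (LINT p:U|lebesgue. g p * \<phi> p)
    \<longleftrightarrow> (LBINT p. F p * pd i j \<phi> p) = (-1)^(i+j) * (LBINT p. G p * \<phi> p)" if \<phi>: "test2 U \<phi>" for \<phi>
  proof -
    have m [measurable]: "\<phi> \<in> borel_measurable borel" "pd i j \<phi> \<in> borel_measurable borel"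
      using smooth2_measurable test2_smooth2 \<phi> test2_pd by blast+
    have "(LINT p:U|lebesgue. f p * ((-1)^(i+j) * pd i j \<phi> p)) = (LBINT p. F p * ((-1)^(i+j) * pd i j \<phi> p))"
      by (rule rep_integral[OF assms(1)]) measurable
    also have "\<dots> = (-1)^(i+j) * (LBINT p. F p * pd i j \<phi> p)"
      by (subst integral_mult_right_zero[symmetric]) (simp add: mult_ac)
    finally have 1: "(LINT p:U|lebesgue. f p * ((-1)^(i+j) * pd i j \<phi> p)) = (-1)^(i+j) * (LBINT p. F p * pd i j \<phi> p)" .
    have 2: "(LINT p:U|lebesgue. g p * \<phi> p) = (LBINT p. G p * \<phi> p)" by (rule rep_integral[OF assms(2) m(1)])
    have "(-1 :: real)^(i+j) * (-1)^(i+j) = 1" by (simp add: power_mult_distrib[symmetric])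
    then have "s * a = c \<longleftrightarrow> a = s * c" if "s = (-1 :: real)^(i+j)" for a c s using that by (metis mult.assoc mult_1)
    then show ?thesis unfolding 1 2 by blast
  qed
  then show ?thesis unfolding weak_op_single wpd_def by blast
qed

lemma test2_bump:
  assumes "cbox c e \<subseteq> U" shows "test2 U (bump n c e)"
proof -
  obtain c1 c2 e1 e2 where eq: "c = (c1, c2)" "e = (e1, e2)" by (metis surj_pair)
  have bump: "bump n c e p = bump1 n c1 e1 (fst p) * bump1 n c2 e2 (snd p)" for p
    unfolding eq by (cases p) (simp add: bump_Pair)
  show ?thesis unfolding test2_def bump[abs_def]
  proof (intro conjI exI[of _ "cbox c e"])
    show "smooth2 (\<lambda>p. bump1 n c1 e1 (fst p) * bump1 n c2 e2 (snd p))"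
      by (intro smooth2_tensor smooth1_bump1)
    show "\<forall>p. p \<notin> cbox c e \<longrightarrow> bump1 n c1 e1 (fst p) * bump1 n c2 e2 (snd p) = 0"
      unfolding bump[symmetric] using bump_outside box_subset_cbox by blast
  qed (use assms in auto)
qed

text \<open>On each box with closure in \<open>U\<close> the function has an integrable Borel
  version, to which \<open>fundamental_lemma\<close> applies; the boxes are then glued.\<close>

lemma loc_int_AE_zero:
  assumes U: "open U" and d: "loc_int U d" and z: "\<And>\<phi>. test2 U \<phi> \<Longrightarrow> (LINT p:U|lebesgue. d p * \<phi> p) = 0"
  shows "AE p in lborel. p \<in> U \<longrightarrow> d p = 0"
proof (rule AE_open_if_AE_cbox[OF U])
  fix a b assume ab: "cbox a b \<subseteq> U"
  let ?X = "box a b"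
  have i: "set_integrable lebesgue ?X d"
  proof (rule set_integrable_subset[OF _ _ box_subset_cbox])
    show "set_integrable lebesgue (cbox a b) d" using d ab compact_cbox unfolding loc_int_def by blast
  qed simp
  then have "set_borel_measurable lebesgue ?X d" by (auto simp: set_integrable_def set_borel_measurable_def)
  then obtain F where F: "rep ?X d F" using rep_exists[of ?X d] by auto
  note [measurable] = rep_measurable[OF F]
  have iF: "integrable lborel F"
    using lebesgue_integrable_rep[of F "\<lambda>p. indicator ?X p *\<^sub>R d p"] i F unfolding set_integrable_def rep_def
    by (auto elim!: eventually_mono simp: indicator_def)
  have "AE p in lborel. p \<in> ?X \<longrightarrow> F p = 0"
  proof (rule fundamental_lemma)
    show "set_integrable lborel (box c e) F" for c e
      using integrable_mult_indicator[OF _ iF, of "box c e"] by (simp add: set_integrable_def)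
    fix n and c e :: "real \<times> real" assume ce: "cbox c e \<subseteq> ?X"
    show "(LBINT p. F p * bump n c e p) = 0"
    proof -
      have t: "test2 U (bump n c e)" using ce ab box_subset_cbox by (intro test2_bump) blast
      have "(LINT p:U|lebesgue. d p * bump n c e p) = (LINT p:?X|lebesgue. d p * bump n c e p)"
        unfolding set_lebesgue_integral_def
      proof (rule Bochner_Integration.integral_cong[OF refl])
        fix p
        have "p \<notin> ?X \<Longrightarrow> bump n c e p = 0" using ce bump_outside[of p c e n] box_subset_cbox[of c e] by blast
        moreover have "p \<in> ?X \<Longrightarrow> p \<in> U" using ab box_subset_cbox by blast
        ultimately show "indicator U p *\<^sub>R (d p * bump n c e p) = indicator ?X p *\<^sub>R (d p * bump n c e p)"
          by (cases "p \<in> ?X") auto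
      qed
      also have "\<dots> = (LBINT p. F p * bump n c e p)" by (rule rep_integral[OF F]) measurable
      finally show ?thesis using z[OF t] by simp
    qed
  qed auto
  moreover have "AE p in lborel. p \<in> ?X \<longrightarrow> d p = F p" using F by (simp add: rep_def)
  ultimately show "AE p in lborel. p \<in> ?X \<longrightarrow> d p = 0" by eventually_elim simp
qed

lemma loc_int_test_integrable:
  assumes "loc_int U g" "test2 U \<phi>" shows "set_integrable lebesgue U (\<lambda>p. g p * \<phi> p)"
proof -
  obtain K where K: "compact K" "K \<subseteq> U" "\<And>p. p \<notin> K \<Longrightarrow> \<phi> p = 0" using assms(2) unfolding test2_def by blast
  have c: "continuous_on K \<phi>"
    using smooth2_continuous[OF test2_smooth2[OF assms(2)]] by (rule continuous_on_subset) simp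
  then obtain M where M: "\<forall>x\<in>\<phi> ` K. norm x \<le> M"
    using compact_imp_bounded[OF compact_continuous_image[OF c K(1)]] bounded_iff by metis
  have g: "set_integrable lebesgue K g" using assms(1) K by (simp add: loc_int_def)
  have [measurable]: "\<phi> \<in> borel_measurable lebesgue"
    using smooth2_measurable[OF test2_smooth2[OF assms(2)]] by (simp add: measurable_completion)
  have gm: "(\<lambda>p. indicator K p *\<^sub>R g p) \<in> borel_measurable lebesgue" using g by (auto simp: set_integrable_def)
  have eq: "(\<lambda>p. indicator U p *\<^sub>R (g p * \<phi> p)) = (\<lambda>p. (indicator K p *\<^sub>R g p) * \<phi> p)"
    using K by (auto simp: fun_eq_iff indicator_def)
  show ?thesis unfolding set_integrable_def eq
  proof (rule Bochner_Integration.integrable_bound[OF integrable_mult_right[OF g[unfolded set_integrable_def], of M]])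
    show "(\<lambda>p. (indicator K p *\<^sub>R g p) * \<phi> p) \<in> borel_measurable lebesgue" using gm by measurable
    show "AE p in lebesgue. norm ((indicator K p *\<^sub>R g p) * \<phi> p) \<le> norm (M * (indicator K p *\<^sub>R g p))"
    proof (intro AE_I2)
      fix p
      show "norm ((indicator K p *\<^sub>R g p) * \<phi> p) \<le> norm (M * (indicator K p *\<^sub>R g p))"
      proof (cases "p \<in> K")
        case True
        then have "\<bar>\<phi> p\<bar> \<le> \<bar>M\<bar>" using M by force
        then show ?thesis using True by (simp add: abs_mult mult.commute mult_right_mono)
      qed simp
    qed
  qed
qed

text \<open>The difference annihilates every test function. Consequently the choice made in
  \<open>wd\<close> is immaterial up to null sets.\<close>

lemma weak_pd_unique:
  assumes U: "open U" and 1: "weak_pd U f i j g1" and 2: "weak_pd U f i j g2"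
  shows "AE p in lborel. p \<in> U \<longrightarrow> g1 p = g2 p"
proof -
  have l: "loc_int U g1" "loc_int U g2" using 1 2 by (auto simp: weak_op_single)
  have "AE p in lborel. p \<in> U \<longrightarrow> g1 p - g2 p = 0"
  proof (rule loc_int_AE_zero[OF U])
    show "loc_int U (\<lambda>p. g1 p - g2 p)" using l by (auto simp: loc_int_def intro: set_integral_diff)
    fix \<phi> assume \<phi>: "test2 U \<phi>"
    have "(LINT p:U|lebesgue. g1 p * \<phi> p) = (LINT p:U|lebesgue. g2 p * \<phi> p)"
      using 1 2 \<phi> unfolding weak_op_single by metis
    then show "(LINT p:U|lebesgue. (g1 p - g2 p) * \<phi> p) = 0"
      using set_integral_diff(2)[OF loc_int_test_integrable[OF l(1) \<phi>] loc_int_test_integrable[OF l(2) \<phi>]]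
      by (simp add: left_diff_distrib)
  qed
  then show ?thesis by simp
qed

lemma wd_weak_pd: "weak_pd U f i j g \<Longrightarrow> weak_pd U f i j (wd U f i j)"
  unfolding wd_def by (rule someI[of "weak_pd U f i j"])

lemma wd_eq: "open U \<Longrightarrow> weak_pd U f i j g \<Longrightarrow> AE p in lborel. p \<in> U \<longrightarrow> wd U f i j p = g p"
  using weak_pd_unique wd_weak_pd by blast

section \<open>Regularity at a fixed time\<close>

lemma test2_measurable:
  assumes "test2 U \<phi>" shows "\<phi> \<in> borel_measurable borel"
  using smooth2_measurable test2_smooth2 assms by blast

lemma wpdD: "wpd U F i j G \<Longrightarrow> test2 U \<phi> \<Longrightarrow> (LBINT p. F p * pd i j \<phi> p) = (-1)^(i+j) * (LBINT p. G p * \<phi> p)"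
  by (simp add: wpd_def)

lemma tensor_strip: "ctest a c \<alpha> \<Longrightarrow> ctest 0 B \<beta> \<Longrightarrow> test2 (strip B) (\<lambda>p. \<alpha> (fst p) * \<beta> (snd p))"
  by (erule test2_tensor) (auto simp: strip_def)

lemma ctest_smooth1: "ctest a c \<alpha> \<Longrightarrow> smooth1 \<alpha>"
  by (simp add: ctest_def)

lemma wpd_weakx: assumes "wpd (strip B) F 1 0 G" shows "weakx B F G"
  unfolding weakx_def
proof (intro allI impI)
  fix a c \<alpha> \<beta> assume t: "ctest a c \<alpha>" "ctest 0 B \<beta>"
  show "(LBINT p. F p * (deriv \<alpha> (fst p) * \<beta> (snd p))) = - (LBINT p. G p * (\<alpha> (fst p) * \<beta> (snd p)))"
    using wpdD[OF assms tensor_strip[OF t]]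
    by (simp add: pd_simps[unfolded One_nat_def] smooth2_tensor(2,3)[OF ctest_smooth1[OF t(1)] ctest_smooth1[OF t(2)]])
qed

lemma wpd_weaky: assumes "wpd (strip B) F 0 1 G" shows "weaky 0 B F G"
  unfolding weaky_def
proof (intro allI impI)
  fix a c \<alpha> \<beta> assume t: "ctest a c \<alpha>" "ctest 0 B \<beta>"
  show "(LBINT p. F p * (\<alpha> (fst p) * deriv \<beta> (snd p))) = - (LBINT p. G p * (\<alpha> (fst p) * \<beta> (snd p)))"
    using wpdD[OF assms tensor_strip[OF t]]
    by (simp add: pd_simps[unfolded One_nat_def] smooth2_tensor(2,3)[OF ctest_smooth1[OF t(1)] ctest_smooth1[OF t(2)]])
qed

text \<open>Tested against the x-derivative of a test function. \<open>Hk\<close> supplies q_xx as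
  second derivative of q, whereas integration by parts on lines wants it as first derivative of
  q_x.\<close>

lemma wpd_step_x:
  assumes "wpd U F 1 0 G" "wpd U F 2 0 H" shows "wpd U G 1 0 H"
  unfolding wpd_def
proof (intro allI impI)
  fix \<phi> assume t: "test2 U \<phi>"
  have "(LBINT p. F p * pdir True (pdir True \<phi>) p) = - (LBINT p. G p * pdir True \<phi> p)"
    using wpdD[OF assms(1) test2_pdir[OF t, of True]] by (simp add: pd_simps[unfolded One_nat_def])
  moreover have "(LBINT p. F p * pdir True (pdir True \<phi>) p) = (LBINT p. H p * \<phi> p)"
    using wpdD[OF assms(2) t] by (simp add: pd_simps)
  ultimately show "(LBINT p. G p * pd 1 0 \<phi> p) = (-1)^(1 + 0) * (LBINT p. H p * \<phi> p)"
    by (simp add: pd_simps[unfolded One_nat_def])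
qed

lemma wpd_step_y:
  assumes "wpd U F 0 1 G" "wpd U F 0 2 H" shows "wpd U G 0 1 H"
  unfolding wpd_def
proof (intro allI impI)
  fix \<phi> assume t: "test2 U \<phi>"
  have "(LBINT p. F p * pdir False (pdir False \<phi>) p) = - (LBINT p. G p * pdir False \<phi> p)"
    using wpdD[OF assms(1) test2_pdir[OF t, of False]] by (simp add: pd_simps[unfolded One_nat_def])
  moreover have "(LBINT p. F p * pdir False (pdir False \<phi>) p) = (LBINT p. H p * \<phi> p)"
    using wpdD[OF assms(2) t] by (simp add: pd_simps)
  ultimately show "(LBINT p. G p * pd 0 1 \<phi> p) = (-1)^(0 + 1) * (LBINT p. H p * \<phi> p)"
    by (simp add: pd_simps[unfolded One_nat_def])
qed

lemma sqint_test_integrable: "sqint F \<Longrightarrow> test2 U \<phi> \<Longrightarrow> integrable lborel (\<lambda>p. F p * \<phi> p)"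
  by (rule sqint_mult_integrable[OF _ sqint_test2])

lemma rep_outside: "rep S f F \<Longrightarrow> p \<notin> S \<Longrightarrow> F p = 0"
  unfolding rep_def by blast

text \<open>The Leibniz rule for the weight, obtained by testing with exp(c x) \<phi>. Applied to u
  it yields v_x = q + b v.\<close>

lemma wpd_exp_x:
  assumes w: "wpd U F 1 0 G" and L2: "sqint (\<lambda>p. exp (c * fst p) * F p)" "sqint (\<lambda>p. exp (c * fst p) * G p)"
  shows "wpd U (\<lambda>p. exp (c * fst p) * F p) 1 0 (\<lambda>p. exp (c * fst p) * G p + c * (exp (c * fst p) * F p))"
  unfolding wpd_def
proof (intro allI impI)
  fix \<phi> assume t: "test2 U \<phi>"
  let ?F = "\<lambda>p. exp (c * fst p) * F p" and ?G = "\<lambda>p. exp (c * fst p) * G p"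
  note i = sqint_test_integrable[OF L2(1) t] sqint_test_integrable[OF L2(2) t]
    sqint_test_integrable[OF L2(1) test2_pdir[OF t, of True]]
  have "(LBINT p. F p * (exp (c * fst p) * (c * \<phi> p + pdir True \<phi> p))) = - (LBINT p. G p * (exp (c * fst p) * \<phi> p))"
    using wpdD[OF w test2_exp_mult[OF t]] by (simp add: pd_simps[unfolded One_nat_def] smooth2_exp_mult(2)[OF test2_smooth2[OF t]])
  moreover have "(LBINT p. F p * (exp (c * fst p) * (c * \<phi> p + pdir True \<phi> p)))
    = (LBINT p. c * (?F p * \<phi> p) + ?F p * pdir True \<phi> p)"
    by (simp add: algebra_simps)
  moreover have "\<dots> = c * (LBINT p. ?F p * \<phi> p) + (LBINT p. ?F p * pdir True \<phi> p)"
    using i by (subst Bochner_Integration.integral_add) simp_all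
  moreover have "(LBINT p. G p * (exp (c * fst p) * \<phi> p)) = (LBINT p. ?G p * \<phi> p)"
    by (simp add: mult_ac)
  moreover have "(LBINT p. (?G p + c * ?F p) * \<phi> p) = (LBINT p. ?G p * \<phi> p + c * (?F p * \<phi> p))"
    by (simp add: algebra_simps)
  moreover have "\<dots> = (LBINT p. ?G p * \<phi> p) + c * (LBINT p. ?F p * \<phi> p)"
    using i by (subst Bochner_Integration.integral_add) simp_all
  ultimately show "(LBINT p. ?F p * pd 1 0 \<phi> p) = (-1)^(1 + 0) * (LBINT p. (?G p + c * ?F p) * \<phi> p)"
    by (simp add: pd_simps[unfolded One_nat_def])
qed

lemma sqint_indicator_exp:
  assumes K: "compact K" shows "sqint (\<lambda>p::real\<times>real. indicator K p * exp (c * fst p))"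
proof -
  have [measurable]: "K \<in> sets borel" using K by (simp add: borel_compact)
  have "continuous_on K (\<lambda>p. (exp (c * fst p))\<^sup>2)" by (intro continuous_intros)
  then have "integrable lborel (\<lambda>p. indicator K p *\<^sub>R (exp (c * fst p))\<^sup>2)"
    using K by (intro borel_integrable_compact)
  moreover have "(\<lambda>p. indicator K p *\<^sub>R (exp (c * fst p))\<^sup>2) = (\<lambda>p. (indicator K p * exp (c * fst p))\<^sup>2)"
    by (auto simp: indicator_def fun_eq_iff)
  ultimately show ?thesis by (simp add: sqint_def)
qed

text \<open>Removing the weight may cost square integrability, as exp(-b x) is unbounded on the
  strip. It is bounded on compact sets, and local integrability is what \<open>weak_pd\<close> asks
  for.\<close>

lemma loc_int_exp_sqint:
  assumes F: "sqint F" shows "loc_int U (\<lambda>p. exp (c * fst p) * F p)"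
  unfolding loc_int_def
proof (intro allI impI)
  fix K :: "(real \<times> real) set" assume K: "compact K \<and> K \<subseteq> U"
  then have [measurable]: "K \<in> sets borel" by (simp add: borel_compact)
  note [measurable] = sqint_measurable[OF F]
  have "sqint (\<lambda>p. indicator K p * exp (c * fst p))" using K by (intro sqint_indicator_exp) simp
  from sqint_mult_integrable[OF this F] have "integrable lborel (\<lambda>p. indicator K p *\<^sub>R (exp (c * fst p) * F p))"
    by (simp add: mult.assoc)
  then show "set_integrable lebesgue K (\<lambda>p. exp (c * fst p) * F p)"
    unfolding set_integrable_def by (subst integrable_completion) simp_all
qed

lemma rep_refl: "F \<in> borel_measurable borel \<Longrightarrow> (\<And>p. p \<notin> S \<Longrightarrow> F p = 0) \<Longrightarrow> rep S F F"
  by (simp add: rep_def)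

lemma rep_AE_eq: "rep S f F \<Longrightarrow> AE p in lborel. p \<in> S \<longrightarrow> g p = f p \<Longrightarrow> rep S g F"
  by (auto simp: rep_def elim: eventually_elim2)

text \<open>\<open>F\<close> is not assumed square integrable; in the application it contains a
  product u u_x. It is therefore tested with its truncation to the set where |F| <= n inside the
  ball of radius n, and the resulting integral is that of the squared truncation.\<close>

lemma AE_zero_if_orthogonal:
  assumes r: "rep S f F" and S: "S \<in> sets borel"
    and z: "\<And>\<phi>. L2 S \<phi> \<Longrightarrow> (LINT p:S|lebesgue. f p * \<phi> p) = 0"
  shows "AE p in lborel. F p = 0"
proof -
  have [measurable]: "F \<in> borel_measurable borel" "cball 0 e \<in> sets borel" for e
    using rep_measurable[OF r] by auto
  have "AE p in lborel. \<bar>F p\<bar> \<le> real n \<longrightarrow> p \<in> cball 0 (real n) \<longrightarrow> F p = 0" for n :: nat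
  proof -
    define \<phi> where "\<phi> p = (if \<bar>F p\<bar> \<le> real n then 1 else 0) * indicator (cball 0 (real n)) p * F p" for p
    have [measurable]: "\<phi> \<in> borel_measurable borel" unfolding \<phi>_def[abs_def] by measurable
    have "integrable lborel (\<lambda>p. indicator (cball 0 (real n)) p *\<^sub>R (real n)\<^sup>2)"
      by (rule borel_integrable_compact) auto
    then have i: "integrable lborel (\<lambda>p. (\<phi> p)\<^sup>2)"
    proof (rule Bochner_Integration.integrable_bound)
      show "AE p in lborel. norm ((\<phi> p)\<^sup>2) \<le> norm (indicator (cball 0 (real n)) p *\<^sub>R (real n)\<^sup>2)"
      proof (intro AE_I2)
        fix p
        show "norm ((\<phi> p)\<^sup>2) \<le> norm (indicator (cball 0 (real n)) p *\<^sub>R (real n)\<^sup>2)"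
          by (auto simp: \<phi>_def indicator_def abs_le_square_iff[symmetric])
      qed
    qed measurable
    have \<phi>0: "\<phi> p = 0" if "p \<notin> S" for p using rep_outside[OF r that] by (simp add: \<phi>_def)
    have "L2 S \<phi>" using rep_L2[OF rep_refl[of \<phi> S]] \<phi>0 i by (simp add: sqint_def)
    then have "(LBINT p. F p * \<phi> p) = 0" using z rep_integral[OF r, of \<phi>] by simp
    moreover have "(\<lambda>p. F p * \<phi> p) = (\<lambda>p. (\<phi> p)\<^sup>2)"
      by (auto simp: \<phi>_def fun_eq_iff indicator_def power2_eq_square)
    ultimately have "AE p in lborel. (\<phi> p)\<^sup>2 = 0"
      using integral_nonneg_eq_0_iff_AE[OF i] by simp
    then show ?thesis by eventually_elim (auto simp: \<phi>_def indicator_def)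
  qed
  then have "AE p in lborel. \<forall>n::nat. \<bar>F p\<bar> \<le> real n \<longrightarrow> p \<in> cball 0 (real n) \<longrightarrow> F p = 0"
    by (simp add: AE_all_countable)
  then show ?thesis
  proof eventually_elim
    case (elim p)
    obtain n where "max \<bar>F p\<bar> (norm p) < real n" using reals_Archimedean2 by blast
    then show ?case using elim[rule_format, of n] by simp
  qed
qed

text \<open>At a fixed time, \<open>U\<close>, \<open>P\<close>, \<open>W\<close> represent \<open>u\<close>, \<open>u\<^sub>x\<close>, \<open>u\<^sub>t\<close>, while \<open>vy\<close> and \<open>qx\<close>, \<open>qxx\<close>, \<open>qy\<close>, \<open>qyy\<close> are
  derivatives of \<open>V\<close> and \<open>Q\<close>. The test functions for \<open>vy\<close> need not vanish at \<open>y = 0\<close> and \<open>y = B\<close>: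
  this is the boundary condition.\<close>
definition regular_slice ::
  "real \<Rightarrow> real \<Rightarrow> (real \<times> real \<Rightarrow> real) \<Rightarrow> (real \<times> real \<Rightarrow> real) \<Rightarrow> (real \<times> real \<Rightarrow> real) \<Rightarrow> (real \<times> real \<Rightarrow> real) \<Rightarrow>
   (real \<times> real \<Rightarrow> real) \<Rightarrow> (real \<times> real \<Rightarrow> real) \<Rightarrow> (real \<times> real \<Rightarrow> real) \<Rightarrow> (real \<times> real \<Rightarrow> real) \<Rightarrow>
   (real \<times> real \<Rightarrow> real) \<Rightarrow> (real \<times> real \<Rightarrow> real) \<Rightarrow> bool" where
  "regular_slice B b U W P V Q vy qx qxx qy qyy \<longleftrightarrow>
     V = (\<lambda>p. exp (b * fst p) * U p) \<and> Q = (\<lambda>p. exp (b * fst p) * P p) \<and>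
     (\<forall>F \<in> {U, P, V, Q, vy, qx, qxx, qy, qyy, \<lambda>p. exp (b * fst p) * W p}. sqint F \<and> (\<forall>p. p \<notin> strip B \<longrightarrow> F p = 0)) \<and>
     weakx B U P \<and> weakx B V (\<lambda>p. Q p + b * V p) \<and> weakx B Q qx \<and> weakx B qx qxx \<and>
     weakx B vy (\<lambda>p. qy p + b * vy p) \<and> weaky (-1) (B + 1) V vy \<and> weaky 0 B qy qyy \<and>
     (AE p in lborel. exp (b * fst p) * W p = qx p - b * Q p - (qxx p - 2 * b * qx p + b\<^sup>2 * Q p) - qyy p - V p * P p)"

lemma weak_pd_L2_rep:
  assumes "\<exists>g. weak_pd (strip B) f i j g \<and> L2 (strip B) g" "rep (strip B) f F"
  obtains G where "wpd (strip B) F i j G" "sqint G" "\<And>p. p \<notin> strip B \<Longrightarrow> G p = 0"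
proof -
  obtain g where g: "weak_pd (strip B) f i j g" "L2 (strip B) g" using assms(1) by blast
  obtain G where G: "rep (strip B) g G"
    using rep_exists[of "strip B" g] g(2) open_strip[of B] by (auto simp: L2_def)
  have "wpd (strip B) F i j G" using weak_pd_rep[OF assms(2) G] g(1) by blast
  moreover have "sqint G" using rep_L2[OF G] g(2) by blast
  moreover have "\<And>p. p \<notin> strip B \<Longrightarrow> G p = 0" using rep_outside[OF G] .
  ultimately show ?thesis using that by blast
qed

text \<open>Higher derivatives of u are recovered from those of q = exp(b x) u_x, through exp(b x)
  u_xx = q_x - b q, exp(b x) u_xxx = q_xx - 2 b q_x + b^2 q and exp(b x) u_xyy = q_yy. The weighted
  equation then consists of square integrable terms and the product \<open>V P\<close>.\<close>

lemma regular_slice_exists: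
  assumes rU: "rep (strip B) u U" and rW: "rep (strip B) w W"
    and Lu: "L2 (strip B) u" and ux: "\<exists>g. weak_pd (strip B) u 1 0 g \<and> L2 (strip B) g"
    and Hv: "Hk 3 (strip B) (\<lambda>p. exp (b * fst p) * u p)"
    and Hq: "Hk 3 (strip B) (\<lambda>p. exp (b * fst p) * wd (strip B) u 1 0 p)"
    and Lw: "L2 (strip B) (\<lambda>p. exp (b * fst p) * w p)"
    and van: "vanish_y B u"
    and eq: "\<And>\<phi>. L2 (strip B) \<phi> \<Longrightarrow> (LINT p:strip B|lebesgue. exp (b * fst p) *
             (w p - wd (strip B) u 2 0 p + wd (strip B) u 3 0 p
              + u p * wd (strip B) u 1 0 p + wd (strip B) u 1 2 p) * \<phi> p) = 0"
  shows "\<exists>P V Q vy qx qxx qy qyy. regular_slice B b U W P V Q vy qx qxx qy qyy \<and>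
    (LBINT p. (P p)\<^sup>2) = L2norm2 (strip B) (wd (strip B) u 1 0)"
proof -
  let ?S = "strip B"
  have oS: "open ?S" by (rule open_strip)
  have bS: "?S \<in> sets borel" using oS by simp
  have me: "(\<lambda>p. exp (c * fst p)) \<in> borel_measurable (borel :: (real \<times> real) measure)" for c :: real by measurable
  obtain g where g: "weak_pd ?S u 1 0 g" "L2 ?S g" using ux by blast
  have lu: "loc_int ?S u" using g by (simp add: weak_op_single)
  define wx where "wx = wd ?S u 1 0"
  have wx: "weak_pd ?S u 1 0 wx" unfolding wx_def by (rule wd_weak_pd[OF g(1)])
  \<comment> \<open>\<open>g\<close> is known to be square integrable and \<open>wx\<close> is the
    version chosen by \<open>wd\<close>; they agree almost everywhere and share the Borel version
    \<open>P\<close>.\<close>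
  obtain P where rP: "rep ?S wx P" and P: "wpd ?S U 1 0 P" "sqint P" "\<And>p. p \<notin> ?S \<Longrightarrow> P p = 0"
  proof -
    obtain P where P: "rep ?S g P" using rep_exists[of ?S g] g(2) bS by (auto simp: L2_def)
    have r: "rep ?S wx P" by (rule rep_AE_eq[OF P weak_pd_unique[OF oS wx g(1)]])
    show ?thesis
      using that[OF r] weak_pd_rep[OF rU r] wx rep_L2[OF P] g(2) rep_outside[OF P] by blast
  qed
  define V Q where "V p = exp (b * fst p) * U p" and "Q p = exp (b * fst p) * P p" for p
  have rV: "rep ?S (\<lambda>p. exp (b * fst p) * u p) V" unfolding V_def[abs_def] by (rule rep_cong_mult[OF rU me])
  have rQ: "rep ?S (\<lambda>p. exp (b * fst p) * wx p) Q" unfolding Q_def[abs_def] by (rule rep_cong_mult[OF rP me])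
  have rEW: "rep ?S (\<lambda>p. exp (b * fst p) * w p) (\<lambda>p. exp (b * fst p) * W p)" by (rule rep_cong_mult[OF rW me])
  have U: "sqint U" "\<And>p. p \<notin> ?S \<Longrightarrow> U p = 0" using rep_L2[OF rU] Lu rep_outside[OF rU] by blast+
  have V: "sqint V" "\<And>p. p \<notin> ?S \<Longrightarrow> V p = 0" using rep_L2[OF rV] Hv rep_outside[OF rV] unfolding Hk_def by blast+
  have Q: "sqint Q" "\<And>p. p \<notin> ?S \<Longrightarrow> Q p = 0" using rep_L2[OF rQ] Hq rep_outside[OF rQ] unfolding Hk_def wx_def by blast+
  have EW: "sqint (\<lambda>p. exp (b * fst p) * W p)" "\<And>p. p \<notin> ?S \<Longrightarrow> W p = 0" using rep_L2[OF rEW] Lw rep_outside[OF rW] by blast+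
  have hv: "\<exists>g. weak_pd ?S (\<lambda>p. exp (b * fst p) * u p) i j g \<and> L2 ?S g" if "i + j \<le> 3" for i j
    using Hv that by (simp add: Hk_def)
  have hq: "\<exists>g. weak_pd ?S (\<lambda>p. exp (b * fst p) * wx p) i j g \<and> L2 ?S g" if "i + j \<le> 3" for i j
    using Hq that by (simp add: Hk_def wx_def)
  obtain vy where vy: "wpd ?S V 0 1 vy" "sqint vy" "\<And>p. p \<notin> ?S \<Longrightarrow> vy p = 0"
    by (rule weak_pd_L2_rep[OF hv rV]) auto
  obtain qx where qx: "wpd ?S Q 1 0 qx" "sqint qx" "\<And>p. p \<notin> ?S \<Longrightarrow> qx p = 0"
    by (rule weak_pd_L2_rep[OF hq rQ]) auto
  obtain qxx where qxx: "wpd ?S Q 2 0 qxx" "sqint qxx" "\<And>p. p \<notin> ?S \<Longrightarrow> qxx p = 0"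
    by (rule weak_pd_L2_rep[OF hq rQ]) auto
  obtain qy where qy: "wpd ?S Q 0 1 qy" "sqint qy" "\<And>p. p \<notin> ?S \<Longrightarrow> qy p = 0"
    by (rule weak_pd_L2_rep[OF hq rQ]) auto
  obtain qyy where qyy: "wpd ?S Q 0 2 qyy" "sqint qyy" "\<And>p. p \<notin> ?S \<Longrightarrow> qyy p = 0"
    by (rule weak_pd_L2_rep[OF hq rQ]) auto
  note [measurable] = U(1)[THEN sqint_measurable] P(2)[THEN sqint_measurable] V(1)[THEN sqint_measurable]
    Q(1)[THEN sqint_measurable] vy(2)[THEN sqint_measurable] qx(2)[THEN sqint_measurable]
    qxx(2)[THEN sqint_measurable] qy(2)[THEN sqint_measurable] qyy(2)[THEN sqint_measurable] rep_measurable[OF rW]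
  have VQ: "wpd ?S V 1 0 (\<lambda>p. Q p + b * V p)"
    using wpd_exp_x[OF P(1), of b] V(1) Q(1) unfolding V_def[abs_def] Q_def[abs_def] by simp
  have UV: "U p = exp (- b * fst p) * V p" and PQ: "P p = exp (- b * fst p) * Q p" for p
    by (simp_all add: V_def Q_def mult.assoc[symmetric] mult_exp_exp)
  let ?e = "\<lambda>p::real\<times>real. exp (- b * fst p)"
  \<comment> \<open>Mixed derivatives commute: testing \<open>V\<close> with \<alpha>' \<beta>' and
    moving one derivative or the other back gives (v_y)_x = (v_x)_y = q_y + b v_y.\<close>
  have x_vy: "weakx B vy (\<lambda>p. qy p + b * vy p)"
    unfolding weakx_def
  proof (intro allI impI)
    fix a c \<alpha> \<beta> assume t: "ctest a c \<alpha>" "ctest 0 B \<beta>"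
    note t' = ctest_deriv[OF t(1)] ctest_deriv[OF t(2)]
    have "(LBINT p. V p * (deriv \<alpha> (fst p) * deriv \<beta> (snd p))) = - (LBINT p. vy p * (deriv \<alpha> (fst p) * \<beta> (snd p)))"
      using wpd_weaky[OF vy(1)] t'(1) t(2) unfolding weaky_def by blast
    moreover have "(LBINT p. V p * (deriv \<alpha> (fst p) * deriv \<beta> (snd p))) = - (LBINT p. (Q p + b * V p) * (\<alpha> (fst p) * deriv \<beta> (snd p)))"
      using wpd_weakx[OF VQ] t(1) t'(2) unfolding weakx_def by blast
    moreover have "(LBINT p. (Q p + b * V p) * (\<alpha> (fst p) * deriv \<beta> (snd p)))
      = (LBINT p. Q p * (\<alpha> (fst p) * deriv \<beta> (snd p)) + b * (V p * (\<alpha> (fst p) * deriv \<beta> (snd p))))"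
      by (simp add: algebra_simps)
    moreover have "\<dots> = (LBINT p. Q p * (\<alpha> (fst p) * deriv \<beta> (snd p))) + b * (LBINT p. V p * (\<alpha> (fst p) * deriv \<beta> (snd p)))"
      using sqint_mult_integrable[OF Q(1) sqint_ctest[OF t(1) t'(2)]] sqint_mult_integrable[OF V(1) sqint_ctest[OF t(1) t'(2)]]
      by (subst Bochner_Integration.integral_add) simp_all
    moreover have "(LBINT p. Q p * (\<alpha> (fst p) * deriv \<beta> (snd p))) = - (LBINT p. qy p * (\<alpha> (fst p) * \<beta> (snd p)))"
      using wpd_weaky[OF qy(1)] t unfolding weaky_def by blast
    moreover have "(LBINT p. V p * (\<alpha> (fst p) * deriv \<beta> (snd p))) = - (LBINT p. vy p * (\<alpha> (fst p) * \<beta> (snd p)))"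
      using wpd_weaky[OF vy(1)] t unfolding weaky_def by blast
    moreover have "(LBINT p. (qy p + b * vy p) * (\<alpha> (fst p) * \<beta> (snd p)))
      = (LBINT p. qy p * (\<alpha> (fst p) * \<beta> (snd p)) + b * (vy p * (\<alpha> (fst p) * \<beta> (snd p))))"
      by (simp add: algebra_simps)
    moreover have "\<dots> = (LBINT p. qy p * (\<alpha> (fst p) * \<beta> (snd p))) + b * (LBINT p. vy p * (\<alpha> (fst p) * \<beta> (snd p)))"
      using sqint_mult_integrable[OF qy(2) sqint_ctest[OF t]] sqint_mult_integrable[OF vy(2) sqint_ctest[OF t]]
      by (subst Bochner_Integration.integral_add) simp_all
    ultimately show "(LBINT p. vy p * (deriv \<alpha> (fst p) * \<beta> (snd p))) = - (LBINT p. (qy p + b * vy p) * (\<alpha> (fst p) * \<beta> (snd p)))"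
      by simp
  qed
  \<comment> \<open>\<open>vanish_y\<close> speaks of u and some weak derivative \<open>h\<close>.
    By uniqueness \<open>h\<close> is exp(-b x) v_y, and test functions carrying the factor exp(b x)
    transfer Green's formula to \<open>V\<close>.\<close>
  have y0: "weaky (-1) (B + 1) V vy"
  proof -
    obtain h where h: "weak_pd ?S u 0 1 h" and hb: "\<And>\<phi>. test2 UNIV \<phi> \<Longrightarrow>
        (LINT p:?S|lebesgue. u p * pd 0 1 \<phi> p) = - (LINT p:?S|lebesgue. h p * \<phi> p)"
      using van unfolding vanish_y_def by blast
    let ?h = "\<lambda>p. ?e p * vy p"
    have rh': "rep ?S ?h ?h" by (rule rep_refl) (measurable, simp add: vy(3))
    have "wpd ?S U 0 1 ?h"
      unfolding wpd_def
    proof (intro allI impI)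
      fix \<phi> assume t: "test2 ?S \<phi>"
      have "(LBINT p. V p * (?e p * pdir False \<phi> p)) = - (LBINT p. vy p * (?e p * \<phi> p))"
        using wpdD[OF vy(1) test2_exp_mult[OF t, of "- b"]]
        by (simp add: pd_simps[unfolded One_nat_def] smooth2_exp_mult(3)[OF test2_smooth2[OF t], of "- b", simplified])
      then show "(LBINT p. U p * pd 0 1 \<phi> p) = (-1)^(0 + 1) * (LBINT p. ?h p * \<phi> p)"
        unfolding UV by (simp add: pd_simps[unfolded One_nat_def] mult_ac)
    qed
    then have "weak_pd ?S u 0 1 ?h"
      using weak_pd_rep[OF rU rh'] lu loc_int_exp_sqint[OF vy(2)] by blast
    then have rh: "rep ?S h ?h" using rep_AE_eq[OF rh' weak_pd_unique[OF oS h]] by blast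
    show ?thesis unfolding weaky_def
    proof (intro allI impI)
      fix a c \<alpha> \<beta> assume t: "ctest a c \<alpha>" "ctest (-1) (B + 1) \<beta>"
      let ?\<alpha> = "\<lambda>t. exp (b * t) * \<alpha> t"
      have ta: "ctest a c ?\<alpha>"
      proof -
        obtain r s where "a < r" "r \<le> s" "s < c" "\<forall>t. t < r \<or> s < t \<longrightarrow> \<alpha> t = 0" using t(1) unfolding ctest_def by blast
        moreover have "smooth1 ?\<alpha>" by (intro smooth1_mult smooth1_exp ctest_smooth1[OF t(1)])
        ultimately show ?thesis unfolding ctest_def by (metis mult_zero_right)
      qed
      let ?\<phi> = "\<lambda>p. ?\<alpha> (fst p) * \<beta> (snd p)"
      have t2: "test2 UNIV ?\<phi>" by (rule test2_tensor[OF ta t(2)]) simp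
      have pd: "pd 0 1 ?\<phi> = (\<lambda>p. ?\<alpha> (fst p) * deriv \<beta> (snd p))"
        using smooth2_tensor(3)[OF ctest_smooth1[OF ta] ctest_smooth1[OF t(2)]] by (simp add: pd_simps[unfolded One_nat_def])
      have [measurable]: "\<alpha> \<in> borel_measurable borel" "\<beta> \<in> borel_measurable borel" "deriv \<beta> \<in> borel_measurable borel"
        using ctest_integrable[OF t(1)] ctest_integrable[OF t(2)] ctest_integrable[OF ctest_deriv[OF t(2)]] by auto
      have "(LBINT p. U p * (?\<alpha> (fst p) * deriv \<beta> (snd p))) = - (LBINT p. ?h p * (?\<alpha> (fst p) * \<beta> (snd p)))"
        using hb[OF t2] unfolding pd by (subst (asm) rep_integral[OF rU], measurable, subst (asm) rep_integral[OF rh], measurable)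
      moreover have "(\<lambda>p. U p * (?\<alpha> (fst p) * deriv \<beta> (snd p))) = (\<lambda>p. V p * (\<alpha> (fst p) * deriv \<beta> (snd p)))"
        by (simp add: V_def mult_ac)
      moreover have "(\<lambda>p. ?h p * (?\<alpha> (fst p) * \<beta> (snd p))) = (\<lambda>p. vy p * (\<alpha> (fst p) * \<beta> (snd p)))"
      proof
        fix p :: "real \<times> real"
        have "exp (- b * fst p) * exp (b * fst p) = 1" by (simp add: mult_exp_exp)
        then show "?h p * (?\<alpha> (fst p) * \<beta> (snd p)) = vy p * (\<alpha> (fst p) * \<beta> (snd p))"
          by (metis (no_types, lifting) mult.commute mult.left_commute mult_1)
      qed
      ultimately show "(LBINT p. V p * (\<alpha> (fst p) * deriv \<beta> (snd p))) = - (LBINT p. vy p * (\<alpha> (fst p) * \<beta> (snd p)))"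
        by simp
    qed
  qed
  have P_test: "(LBINT p. U p * pdir True \<phi> p) = - (LBINT p. Q p * (?e p * \<phi> p))" if "test2 ?S \<phi>" for \<phi>
    using wpdD[OF P(1) that] unfolding PQ by (simp add: pd_simps[unfolded One_nat_def] mult_ac)
  \<comment> \<open>These are exp(b x) u_xx and exp(b x) u_xxx, found by differentiating u_x =
    exp(-b x) q.\<close>
  let ?R2 = "\<lambda>p. qx p - b * Q p" and ?R3 = "\<lambda>p. qxx p - 2 * b * qx p + b\<^sup>2 * Q p"
  have sR2: "sqint ?R2" and sR3: "sqint ?R3"
    by (intro sqint_add sqint_diff sqint_cmult qx qxx Q)+
  have w2: "wpd ?S U 2 0 (\<lambda>p. ?e p * ?R2 p)"
    unfolding wpd_def
  proof (intro allI impI)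
    fix \<phi> assume t: "test2 ?S \<phi>"
    define \<psi> where "\<psi> p = ?e p * \<phi> p" for p
    have \<psi>: "test2 ?S \<psi>" unfolding \<psi>_def[abs_def] by (rule test2_exp_mult[OF t])
    have \<psi>x: "pdir True \<psi> p = ?e p * (- b * \<phi> p + pdir True \<phi> p)" for p
      unfolding \<psi>_def[abs_def] smooth2_exp_mult(2)[OF test2_smooth2[OF t]] by simp
    \<comment> \<open>With \<psi> = exp(-b x) \<phi> one has exp(-b x) \<phi>_x = \<psi>_x + b
      \<psi>, which moves the weight into the test function for \<open>Q\<close>.\<close>
    have e: "(\<lambda>p. Q p * (?e p * pdir True \<phi> p)) = (\<lambda>p. Q p * pdir True \<psi> p + b * (Q p * \<psi> p))"
      unfolding \<psi>x by (simp add: \<psi>_def algebra_simps fun_eq_iff)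
    have "(LBINT p. U p * pdir True (pdir True \<phi>) p) = - (LBINT p. Q p * (?e p * pdir True \<phi> p))"
      by (rule P_test[OF test2_pdir[OF t]])
    also have "\<dots> = - ((LBINT p. Q p * pdir True \<psi> p) + b * (LBINT p. Q p * \<psi> p))"
      unfolding e using sqint_test_integrable[OF Q(1) \<psi>] sqint_test_integrable[OF Q(1) test2_pdir[OF \<psi>, of True]]
      by (subst Bochner_Integration.integral_add) simp_all
    also have "(LBINT p. Q p * pdir True \<psi> p) = - (LBINT p. qx p * \<psi> p)"
      using wpdD[OF qx(1) \<psi>] by (simp add: pd_simps[unfolded One_nat_def])
    also have "- (- (LBINT p. qx p * \<psi> p) + b * (LBINT p. Q p * \<psi> p)) = (LBINT p. qx p * \<psi> p - b * (Q p * \<psi> p))"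
      using sqint_test_integrable[OF Q(1) \<psi>] sqint_test_integrable[OF qx(2) \<psi>]
      by (subst Bochner_Integration.integral_diff) simp_all
    also have "\<dots> = (LBINT p. (?e p * ?R2 p) * \<phi> p)"
      by (simp add: \<psi>_def algebra_simps)
    finally show "(LBINT p. U p * pd 2 0 \<phi> p) = (-1)^(2 + 0) * (LBINT p. (?e p * ?R2 p) * \<phi> p)"
      by (simp add: pd_simps)
  qed
  have w3: "wpd ?S U 3 0 (\<lambda>p. ?e p * ?R3 p)"
    unfolding wpd_def
  proof (intro allI impI)
    fix \<phi> assume t: "test2 ?S \<phi>"
    define \<psi> where "\<psi> p = ?e p * \<phi> p" for p
    have \<psi>: "test2 ?S \<psi>" unfolding \<psi>_def[abs_def] by (rule test2_exp_mult[OF t])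
    have \<psi>x: "pdir True \<psi> = (\<lambda>p. ?e p * (- b * \<phi> p + pdir True \<phi> p))"
      unfolding \<psi>_def[abs_def] smooth2_exp_mult(2)[OF test2_smooth2[OF t]] by simp
    have sm: "smooth2 (\<lambda>p. - b * \<phi> p + pdir True \<phi> p)"
      by (intro smooth2_lincomb smooth2_pdir test2_smooth2[OF t])
    have "pdir True (\<lambda>p. - b * \<phi> p + pdir True \<phi> p) (x, y) = - b * pdir True \<phi> (x, y) + pdir True (pdir True \<phi>) (x, y)" for x y
    proof -
      have "((\<lambda>s. - b * \<phi> (s, y) + pdir True \<phi> (s, y)) has_real_derivative - b * pdir True \<phi> (x, y) + pdir True (pdir True \<phi>) (x, y)) (at x)"
        by (intro DERIV_add DERIV_cmult smooth2_has_deriv smooth2_pdir test2_smooth2[OF t])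
      from DERIV_imp_deriv[OF this] show ?thesis by (simp add: pdir_def)
    qed
    then have lin: "pdir True (\<lambda>p. - b * \<phi> p + pdir True \<phi> p) = (\<lambda>p. - b * pdir True \<phi> p + pdir True (pdir True \<phi>) p)"
      by (auto simp: fun_eq_iff)
    have \<psi>xx: "pdir True (pdir True \<psi>) p = ?e p * (b\<^sup>2 * \<phi> p - 2 * b * pdir True \<phi> p + pdir True (pdir True \<phi>) p)" for p
      unfolding \<psi>x smooth2_exp_mult(2)[OF sm] lin by (simp add: algebra_simps power2_eq_square)
    \<comment> \<open>The same substitution to second order: exp(-b x) \<phi>_xx = \<psi>_xx + 2 b
      \<psi>_x + b^2 \<psi>.\<close>
    have e: "(\<lambda>p. Q p * (?e p * pdir True (pdir True \<phi>) p)) = (\<lambda>p. Q p * pdir True (pdir True \<psi>) p + 2 * b * (Q p * pdir True \<psi> p) + b\<^sup>2 * (Q p * \<psi> p))"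
      unfolding \<psi>xx unfolding \<psi>x by (simp add: \<psi>_def algebra_simps power2_eq_square fun_eq_iff)
    note i = sqint_test_integrable[OF Q(1) \<psi>] sqint_test_integrable[OF Q(1) test2_pdir[OF \<psi>, of True]]
      sqint_test_integrable[OF Q(1) test2_pdir[OF test2_pdir[OF \<psi>, of True], of True]]
      sqint_test_integrable[OF qx(2) \<psi>] sqint_test_integrable[OF qxx(2) \<psi>]
    have "(LBINT p. U p * pdir True (pdir True (pdir True \<phi>)) p) = - (LBINT p. Q p * (?e p * pdir True (pdir True \<phi>) p))"
      by (rule P_test[OF test2_pdir[OF test2_pdir[OF t]]])
    also have "\<dots> = - ((LBINT p. Q p * pdir True (pdir True \<psi>) p) + 2 * b * (LBINT p. Q p * pdir True \<psi> p) + b\<^sup>2 * (LBINT p. Q p * \<psi> p))"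
      unfolding e using i by (subst Bochner_Integration.integral_add, simp, simp, subst Bochner_Integration.integral_add) simp_all
    also have "(LBINT p. Q p * pdir True \<psi> p) = - (LBINT p. qx p * \<psi> p)"
      using wpdD[OF qx(1) \<psi>] by (simp add: pd_simps[unfolded One_nat_def])
    also have "(LBINT p. Q p * pdir True (pdir True \<psi>) p) = (LBINT p. qxx p * \<psi> p)"
      using wpdD[OF qxx(1) \<psi>] by (simp add: pd_simps)
    also have "- ((LBINT p. qxx p * \<psi> p) + 2 * b * - (LBINT p. qx p * \<psi> p) + b\<^sup>2 * (LBINT p. Q p * \<psi> p))
      = - (LBINT p. qxx p * \<psi> p - 2 * b * (qx p * \<psi> p) + b\<^sup>2 * (Q p * \<psi> p))"
      using i by (subst Bochner_Integration.integral_add, simp, simp, subst Bochner_Integration.integral_diff) simp_all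
    also have "(LBINT p. qxx p * \<psi> p - 2 * b * (qx p * \<psi> p) + b\<^sup>2 * (Q p * \<psi> p)) = (LBINT p. (?e p * ?R3 p) * \<phi> p)"
      by (simp add: \<psi>_def algebra_simps)
    finally show "(LBINT p. U p * pd 3 0 \<phi> p) = (-1)^(3 + 0) * (LBINT p. (?e p * ?R3 p) * \<phi> p)"
      by (simp add: pd_simps)
  qed
  have w12: "wpd ?S U 1 2 (\<lambda>p. ?e p * qyy p)"
    unfolding wpd_def
  proof (intro allI impI)
    fix \<phi> assume t: "test2 ?S \<phi>"
    have e: "pdir False (pdir False (\<lambda>p. ?e p * \<phi> p)) = (\<lambda>p. ?e p * pdir False (pdir False \<phi>) p)"
      unfolding smooth2_exp_mult(3)[OF test2_smooth2[OF t]] smooth2_exp_mult(3)[OF test2_smooth2[OF test2_pdir[OF t]]] ..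
    have "(LBINT p. U p * pdir True (pdir False (pdir False \<phi>)) p) = - (LBINT p. Q p * (?e p * pdir False (pdir False \<phi>) p))"
      by (rule P_test[OF test2_pdir[OF test2_pdir[OF t]]])
    also have "(LBINT p. Q p * (?e p * pdir False (pdir False \<phi>) p)) = (LBINT p. qyy p * (?e p * \<phi> p))"
      using wpdD[OF qyy(1) test2_exp_mult[OF t, of "- b"]] unfolding pd_simps e by simp
    finally show "(LBINT p. U p * pd 1 2 \<phi> p) = (-1)^(1 + 2) * (LBINT p. (?e p * qyy p) * \<phi> p)"
      by (simp add: pd_simps[unfolded One_nat_def] mult_ac)
  qed
  \<comment> \<open>Uniqueness of weak derivatives identifies \<open>wd\<close> with the explicit
    candidate exp(-b x) R.\<close>
  have wdr: "rep ?S (wd ?S u i j) (\<lambda>p. ?e p * R p)"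
    if "wpd ?S U i j (\<lambda>p. ?e p * R p)" "sqint R" "\<And>p. p \<notin> ?S \<Longrightarrow> R p = 0" for i j R
  proof -
    have [measurable]: "R \<in> borel_measurable borel" using that(2) by (rule sqint_measurable)
    have r: "rep ?S (\<lambda>p. ?e p * R p) (\<lambda>p. ?e p * R p)" by (rule rep_refl) (measurable, simp add: that(3))
    have "weak_pd ?S u i j (\<lambda>p. ?e p * R p)"
      using weak_pd_rep[OF rU r] lu loc_int_exp_sqint[OF that(2)] that(1) by blast
    from rep_AE_eq[OF r wd_eq[OF oS this]] show ?thesis .
  qed
  have r2: "rep ?S (wd ?S u 2 0) (\<lambda>p. ?e p * ?R2 p)" by (rule wdr[OF w2 sR2]) (simp add: qx(3) Q(2))
  have r3: "rep ?S (wd ?S u 3 0) (\<lambda>p. ?e p * ?R3 p)" by (rule wdr[OF w3 sR3]) (simp add: qx(3) qxx(3) Q(2))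
  have r12: "rep ?S (wd ?S u 1 2) (\<lambda>p. ?e p * qyy p)" by (rule wdr[OF w12 qyy(2,3)])
  let ?E = "\<lambda>p. exp (b * fst p) * (W p - ?e p * ?R2 p + ?e p * ?R3 p + U p * P p + ?e p * qyy p)"
  have "rep ?S (\<lambda>p. exp (b * fst p) * (w p - wd ?S u 2 0 p + wd ?S u 3 0 p + u p * wd ?S u 1 0 p + wd ?S u 1 2 p)) ?E"
    unfolding rep_def
  proof (intro conjI)
    show "?E \<in> borel_measurable borel" by measurable
    show "\<forall>p. p \<notin> ?S \<longrightarrow> ?E p = 0" by (simp add: EW(2) U(2) qx(3) qxx(3) Q(2) qyy(3))
    have "AE p in lborel. p \<in> ?S \<longrightarrow> w p = W p" "AE p in lborel. p \<in> ?S \<longrightarrow> wd ?S u 2 0 p = ?e p * ?R2 p"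
      "AE p in lborel. p \<in> ?S \<longrightarrow> wd ?S u 3 0 p = ?e p * ?R3 p" "AE p in lborel. p \<in> ?S \<longrightarrow> u p = U p"
      "AE p in lborel. p \<in> ?S \<longrightarrow> wd ?S u 1 0 p = P p" "AE p in lborel. p \<in> ?S \<longrightarrow> wd ?S u 1 2 p = ?e p * qyy p"
      using rW r2 r3 rU rP r12 unfolding rep_def wx_def by blast+
    then show "AE p in lborel. p \<in> ?S \<longrightarrow> exp (b * fst p) * (w p - wd ?S u 2 0 p + wd ?S u 3 0 p + u p * wd ?S u 1 0 p + wd ?S u 1 2 p) = ?E p"
      by eventually_elim simp
  qed
  \<comment> \<open>The equation tested with all of L2 becomes an identity almost
    everywhere.\<close>
  then have "AE p in lborel. ?E p = 0" by (rule AE_zero_if_orthogonal[OF _ bS eq])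
  then have eqn: "AE p in lborel. exp (b * fst p) * W p = qx p - b * Q p - (qxx p - 2 * b * qx p + b\<^sup>2 * Q p) - qyy p - V p * P p"
  proof eventually_elim
    case (elim p)
    have ee: "exp (b * fst p) * (?e p * r) = r" for r by (simp add: mult.assoc[symmetric] mult_exp_exp)
    have "exp (b * fst p) * W p - exp (b * fst p) * (?e p * ?R2 p) + exp (b * fst p) * (?e p * ?R3 p)
        + (exp (b * fst p) * U p) * P p + exp (b * fst p) * (?e p * qyy p) = 0"
      using elim by (simp only: distrib_left right_diff_distrib mult.assoc)
    then show ?case unfolding ee V_def by simp
  qed
  have "regular_slice B b U W P V Q vy qx qxx qy qyy"
    unfolding regular_slice_def
  proof (intro conjI)
    show "\<forall>F\<in>{U, P, V, Q, vy, qx, qxx, qy, qyy, \<lambda>p. exp (b * fst p) * W p}. sqint F \<and> (\<forall>p. p \<notin> ?S \<longrightarrow> F p = 0)"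
      using U P V Q vy qx qxx qy qyy EW by simp
  qed (use eqn y0 x_vy wpd_weakx[OF P(1)] wpd_weakx[OF VQ] wpd_weakx[OF qx(1)] wpd_weakx[OF wpd_step_x[OF qx(1) qxx(1)]]
      wpd_weaky[OF wpd_step_y[OF qy(1) qyy(1)]] in \<open>simp_all add: V_def[abs_def] Q_def[abs_def]\<close>)
  moreover have "(LBINT p. (P p)\<^sup>2) = L2norm2 ?S (wd ?S u 1 0)"
    using rep_L2norm2[OF rP] by (simp add: wx_def)
  ultimately show ?thesis by blast
qed

section \<open>Difference of two solutions and Gronwall's inequality\<close>

lemma weakx_diff:
  assumes "weakx B f1 g1" "weakx B f2 g2" "sqint f1" "sqint g1" "sqint f2" "sqint g2"
  shows "weakx B (\<lambda>p. f1 p - f2 p) (\<lambda>p. g1 p - g2 p)"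
  unfolding weakx_def
proof (intro allI impI)
  fix a c \<alpha> \<beta> assume t: "ctest a c \<alpha>" "ctest 0 B \<beta>"
  have i: "integrable lborel (\<lambda>p. f p * (\<alpha> (fst p) * \<beta> (snd p)))"
    "integrable lborel (\<lambda>p. f p * (deriv \<alpha> (fst p) * \<beta> (snd p)))" if "sqint f" for f
    by (intro sqint_mult_integrable[OF that] sqint_ctest[OF t] sqint_ctest[OF ctest_deriv[OF t(1)] t(2)])+
  have "(LBINT p. f1 p * (deriv \<alpha> (fst p) * \<beta> (snd p))) = - (LBINT p. g1 p * (\<alpha> (fst p) * \<beta> (snd p)))"
    "(LBINT p. f2 p * (deriv \<alpha> (fst p) * \<beta> (snd p))) = - (LBINT p. g2 p * (\<alpha> (fst p) * \<beta> (snd p)))"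
    using assms(1,2) t unfolding weakx_def by blast+
  then show "(LBINT p. (f1 p - f2 p) * (deriv \<alpha> (fst p) * \<beta> (snd p))) = - (LBINT p. (g1 p - g2 p) * (\<alpha> (fst p) * \<beta> (snd p)))"
    using i assms(3-6) by (simp add: left_diff_distrib)
qed

lemma weaky_diff:
  assumes "weaky a' c' f1 g1" "weaky a' c' f2 g2" "sqint f1" "sqint g1" "sqint f2" "sqint g2"
  shows "weaky a' c' (\<lambda>p. f1 p - f2 p) (\<lambda>p. g1 p - g2 p)"
  unfolding weaky_def
proof (intro allI impI)
  fix a c \<alpha> \<beta> assume t: "ctest a c \<alpha>" "ctest a' c' \<beta>"
  have i: "integrable lborel (\<lambda>p. f p * (\<alpha> (fst p) * \<beta> (snd p)))"
    "integrable lborel (\<lambda>p. f p * (\<alpha> (fst p) * deriv \<beta> (snd p)))" if "sqint f" for f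
    by (intro sqint_mult_integrable[OF that] sqint_ctest[OF t] sqint_ctest[OF t(1) ctest_deriv[OF t(2)]])+
  have "(LBINT p. f1 p * (\<alpha> (fst p) * deriv \<beta> (snd p))) = - (LBINT p. g1 p * (\<alpha> (fst p) * \<beta> (snd p)))"
    "(LBINT p. f2 p * (\<alpha> (fst p) * deriv \<beta> (snd p))) = - (LBINT p. g2 p * (\<alpha> (fst p) * \<beta> (snd p)))"
    using assms(1,2) t unfolding weaky_def by blast+
  then show "(LBINT p. (f1 p - f2 p) * (\<alpha> (fst p) * deriv \<beta> (snd p))) = - (LBINT p. (g1 p - g2 p) * (\<alpha> (fst p) * \<beta> (snd p)))"
    using i assms(3-6) by (simp add: left_diff_distrib)
qed

text \<open>2 b^2 + 4 b^3 comes from the linear terms and the single b from the share b N of b W.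
  The fraction is the AM-GM factor 1 / (2 \<delta>) = (2 + b) / b times 1 + b, which majorises the
  weights of the trilinear terms.\<close>

definition energy_const :: "real \<Rightarrow> real" where
  "energy_const b = 2 * b\<^sup>2 + 4 * b^3 + b + (1 + b) * (2 + b) / b"

text \<open>With the nonlinear difference split as z u_1x + u_2 z_x, \<open>energy_estimate\<close>
  applies with \<open>a1 = P1\<close>, \<open>a2 = P2\<close> and \<open>u = U2\<close>; the linear
  relations pass to differences.\<close>

lemma slice_difference:
  assumes B: "B > 0" and b: "b > 0"
    and 1: "regular_slice B b U1 W1 P1 V1 Q1 vy1 qx1 qxx1 qy1 qyy1"
    and 2: "regular_slice B b U2 W2 P2 V2 Q2 vy2 qx2 qxx2 qy2 qyy2"
  shows "(LBINT p. (exp (b * fst p) * (U1 p - U2 p)) * (exp (b * fst p) * (W1 p - W2 p)))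
    \<le> energy_const b * (1 + (LBINT p. (P1 p)\<^sup>2) + (LBINT p. (P2 p)\<^sup>2) + (LBINT p. (U2 p)\<^sup>2)) *
      (LBINT p. (exp (b * fst p) * (U1 p - U2 p))\<^sup>2)"
proof -
  have all1: "\<forall>F \<in> {U1, P1, V1, Q1, vy1, qx1, qxx1, qy1, qyy1, \<lambda>p. exp (b * fst p) * W1 p}. sqint F \<and> (\<forall>p. p \<notin> strip B \<longrightarrow> F p = 0)"
    using 1 unfolding regular_slice_def by (elim conjE)
  have all2: "\<forall>F \<in> {U2, P2, V2, Q2, vy2, qx2, qxx2, qy2, qyy2, \<lambda>p. exp (b * fst p) * W2 p}. sqint F \<and> (\<forall>p. p \<notin> strip B \<longrightarrow> F p = 0)"
    using 2 unfolding regular_slice_def by (elim conjE)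
  have L1: "sqint U1" "sqint P1" "sqint V1" "sqint Q1" "sqint vy1" "sqint qx1" "sqint qxx1" "sqint qy1" "sqint qyy1"
      "sqint (\<lambda>p. exp (b * fst p) * W1 p)"
    and S1: "p \<notin> strip B \<Longrightarrow> U1 p = 0 \<and> P1 p = 0 \<and> V1 p = 0 \<and> Q1 p = 0 \<and> vy1 p = 0 \<and> qx1 p = 0 \<and> qxx1 p = 0 \<and> qy1 p = 0 \<and> qyy1 p = 0" for p
    using all1 by (simp_all del: split_paired_All)
  have L2: "sqint U2" "sqint P2" "sqint V2" "sqint Q2" "sqint vy2" "sqint qx2" "sqint qxx2" "sqint qy2" "sqint qyy2"
      "sqint (\<lambda>p. exp (b * fst p) * W2 p)"
    and S2: "p \<notin> strip B \<Longrightarrow> U2 p = 0 \<and> P2 p = 0 \<and> V2 p = 0 \<and> Q2 p = 0 \<and> vy2 p = 0 \<and> qx2 p = 0 \<and> qxx2 p = 0 \<and> qy2 p = 0 \<and> qyy2 p = 0" for p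
    using all2 by (simp_all del: split_paired_All)
  have V: "V1 = (\<lambda>p. exp (b * fst p) * U1 p)" "V2 = (\<lambda>p. exp (b * fst p) * U2 p)"
    and Q: "Q1 = (\<lambda>p. exp (b * fst p) * P1 p)" "Q2 = (\<lambda>p. exp (b * fst p) * P2 p)"
    and eq1: "AE p in lborel. exp (b * fst p) * W1 p = qx1 p - b * Q1 p - (qxx1 p - 2 * b * qx1 p + b\<^sup>2 * Q1 p) - qyy1 p - V1 p * P1 p"
    and eq2: "AE p in lborel. exp (b * fst p) * W2 p = qx2 p - b * Q2 p - (qxx2 p - 2 * b * qx2 p + b\<^sup>2 * Q2 p) - qyy2 p - V2 p * P2 p"
    using 1 2 unfolding regular_slice_def by - (elim conjE, assumption)+
  have w1: "weakx B V1 (\<lambda>p. Q1 p + b * V1 p)" "weakx B Q1 qx1" "weakx B qx1 qxx1" "weakx B vy1 (\<lambda>p. qy1 p + b * vy1 p)"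
      "weaky (-1) (B + 1) V1 vy1" "weaky 0 B qy1 qyy1"
    and w2: "weakx B V2 (\<lambda>p. Q2 p + b * V2 p)" "weakx B Q2 qx2" "weakx B qx2 qxx2" "weakx B vy2 (\<lambda>p. qy2 p + b * vy2 p)"
      "weaky (-1) (B + 1) V2 vy2" "weaky 0 B qy2 qyy2" "weakx B U2 P2"
    using 1 2 unfolding regular_slice_def by - (elim conjE, assumption)+
  define v q qx qxx qy qyy vy \<nu> where "v p = V1 p - V2 p" and "q p = Q1 p - Q2 p" and "qx p = qx1 p - qx2 p"
    and "qxx p = qxx1 p - qxx2 p" and "qy p = qy1 p - qy2 p" and "qyy p = qyy1 p - qyy2 p" and "vy p = vy1 p - vy2 p"
    and "\<nu> p = exp (b * fst p) * W1 p - exp (b * fst p) * W2 p" for p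
  note defs = v_def[abs_def] q_def[abs_def] qx_def[abs_def] qxx_def[abs_def] qy_def[abs_def] qyy_def[abs_def] vy_def[abs_def] \<nu>_def[abs_def]
  have sq: "sqint v" "sqint q" "sqint qx" "sqint qxx" "sqint qy" "sqint qyy" "sqint vy" "sqint \<nu>"
    unfolding defs by (intro sqint_diff L1 L2)+
  have sqa: "sqint (\<lambda>p. q p + b * v p)" "sqint (\<lambda>p. qy p + b * vy p)" by (intro sqint_add sqint_cmult sq)+
  have z: "v p = 0 \<and> q p = 0 \<and> qx p = 0 \<and> qxx p = 0 \<and> qy p = 0 \<and> qyy p = 0 \<and> vy p = 0" if "p \<notin> strip B" for p
    using S1[OF that] S2[OF that] by (simp add: v_def q_def qx_def qxx_def qy_def qyy_def vy_def)
  have e1: "(\<lambda>p. (Q1 p + b * V1 p) - (Q2 p + b * V2 p)) = (\<lambda>p. q p + b * v p)"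
    and e2: "(\<lambda>p. (qy1 p + b * vy1 p) - (qy2 p + b * vy2 p)) = (\<lambda>p. qy p + b * vy p)"
    by (simp_all add: defs algebra_simps)
  have wv: "weakx B v (\<lambda>p. q p + b * v p)"
    using weakx_diff[OF w1(1) w2(1)] L1 L2 unfolding e1 by (simp add: v_def[abs_def] sqint_add sqint_cmult)
  have wvy: "weakx B vy (\<lambda>p. qy p + b * vy p)"
    using weakx_diff[OF w1(4) w2(4)] L1 L2 unfolding e2 by (simp add: vy_def[abs_def] sqint_add sqint_cmult)
  have wq: "weakx B q qx" "weakx B qx qxx"
    unfolding q_def[abs_def] qx_def[abs_def] qxx_def[abs_def] by (intro weakx_diff w1 w2 L1 L2)+
  have wy: "weaky (-1) (B + 1) v vy" "weaky 0 B qy qyy"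
    unfolding defs by (intro weaky_diff w1 w2 L1 L2)+
  have "(LBINT p. v p * \<nu> p) \<le> energy_const b *
     (1 + (LBINT p. (P1 p)\<^sup>2) + (LBINT p. (P2 p)\<^sup>2) + (LBINT p. (U2 p)\<^sup>2)) * (LBINT p. (v p)\<^sup>2)"
    unfolding energy_const_def
  proof (rule energy_estimate[where q=q and qx=qx and qxx=qxx and qy=qy and qyy=qyy and vy=vy and B=B, OF b])
    show "acx v (\<lambda>p. q p + b * v p)" "acx q qx" "acx qx qxx" "acx vy (\<lambda>p. qy p + b * vy p)" "acx U2 P2"
      by (rule weakx_acx[where B=B]; use wv wq wvy w2 sq sqa L2 z S2 in simp)+
    show "acy0 B v vy" by (rule weaky_acy0[OF B wy(1)]; use sq z in simp)
    show "acy B qy qyy" by (rule weaky_acy[OF B wy(2)]; use sq z in simp)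
    show "AE p in lborel. \<nu> p = qx p - b * q p - (qxx p - 2 * b * qx p + b\<^sup>2 * q p) - qyy p - (v p * P1 p + U2 p * q p)"
      using eq1 eq2
    proof eventually_elim
      case (elim p)
      have "V1 p * P1 p - V2 p * P2 p = v p * P1 p + U2 p * q p"
        by (simp add: v_def q_def V Q algebra_simps)
      then show ?case unfolding \<nu>_def elim by (simp add: qx_def qxx_def q_def qyy_def algebra_simps)
    qed
  qed (use sq L1 L2 z in simp_all)
  moreover have "v = (\<lambda>p. exp (b * fst p) * (U1 p - U2 p))" "\<nu> = (\<lambda>p. exp (b * fst p) * (W1 p - W2 p))"
    by (simp_all add: defs V algebra_simps)
  ultimately show ?thesis by simp
qed

section \<open>Gronwall's inequality with an integrable kernel\<close>

lemma tail_integral_continuous: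
  fixes h :: "real \<Rightarrow> real"
  assumes h: "integrable lborel h" shows "isCont (\<lambda>t. \<integral>s. indicator {..<t} s * h s \<partial>lborel) \<tau>"
  unfolding continuous_at_sequentially
proof (intro allI impI)
  fix x assume x: "x \<longlonglongrightarrow> \<tau>"
  have [measurable]: "h \<in> borel_measurable borel" using h by auto
  have "(\<lambda>n. \<integral>s. indicator {..<x n} s * h s \<partial>lborel) \<longlonglongrightarrow> (LBINT s. indicator {..<\<tau>} s * h s)"
  proof (rule integral_dominated_convergence[where w="\<lambda>s. norm (h s)"])
    show "AE s in lborel. (\<lambda>n. indicator {..<x n} s * h s) \<longlonglongrightarrow> indicator {..<\<tau>} s * h s"
      using AE_lborel_singleton[of \<tau>]
    proof eventually_elim
      case (elim s)
      have "\<forall>\<^sub>F n in sequentially. indicator {..<x n} s * h s = indicator {..<\<tau>} s * h s"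
      proof (cases "s < \<tau>")
        case True
        from order_tendstoD(1)[OF x True] show ?thesis by eventually_elim (use True in simp)
      next
        case False
        then have s: "\<tau> < s" using elim by simp
        from order_tendstoD(2)[OF x s] show ?thesis by eventually_elim (use s in simp)
      qed
      then show ?case by (rule tendsto_eventually)
    qed
  qed (use h in \<open>auto simp: indicator_def\<close>)
  then show "((\<lambda>t. \<integral>s. indicator {..<t} s * h s \<partial>lborel) \<circ> x) \<longlonglongrightarrow> (LBINT s. indicator {..<\<tau>} s * h s)"
    by (simp add: o_def)
qed

text \<open>With \<Phi> the right-hand side of \<open>le\<close> and \<open>K\<close> the primitive
  of \<kappa>, monotonicity of \<Phi> gives \<Phi>(t) - \<Phi>(\<tau>) <= \<Phi>(t) (K(t) -
  K(\<tau>)). If the last zero \<tau> of \<Phi> lay before \<open>T\<close>, a short step beyond it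
  with K-increment at most 1/2 would give \<Phi>(t) <= \<Phi>(t) / 2, hence a later zero.\<close>

lemma gronwall_zero:
  fixes \<kappa> N :: "real \<Rightarrow> real"
  assumes T: "T > 0" and \<kappa>: "integrable lborel \<kappa>" "\<And>s. \<kappa> s \<ge> 0" "\<And>s. s \<le> 0 \<Longrightarrow> \<kappa> s = 0"
    and N [measurable]: "N \<in> borel_measurable borel" and N0: "\<And>s. N s \<ge> 0"
    and i: "integrable lborel (\<lambda>s. \<kappa> s * N s)"
    and le: "AE t in lborel. t \<in> {0<..<T} \<longrightarrow> N t \<le> (LBINT s. indicator {..<t} s * (\<kappa> s * N s))"
  shows "AE t in lborel. t \<in> {0<..<T} \<longrightarrow> N t = 0"
proof -
  have [measurable]: "\<kappa> \<in> borel_measurable borel" using \<kappa> by auto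
  define \<Phi> where "\<Phi> t = (LBINT s. indicator {..<t} s * (\<kappa> s * N s))" for t
  define K where "K t = (LBINT s. indicator {..<t} s * \<kappa> s)" for t
  have C: "isCont \<Phi> t" "isCont K t" for t
    unfolding \<Phi>_def[abs_def] K_def[abs_def] by (intro tail_integral_continuous i \<kappa>)+
  have ind: "integrable lborel (\<lambda>s. indicator A s * h s)" if "A \<in> sets borel" "integrable lborel h" for A and h :: "real \<Rightarrow> real"
    using integrable_mult_indicator[of A lborel h] that by simp
  have nn: "\<kappa> s * N s \<ge> 0" for s using \<kappa>(2) N0 by simp
  have mono: "\<Phi> s \<le> \<Phi> t" if "s \<le> t" for s t
    unfolding \<Phi>_def by (rule integral_mono[OF ind ind]) (use i nn that in \<open>auto simp: indicator_def\<close>)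
  have P0: "\<Phi> t \<ge> 0" for t unfolding \<Phi>_def by (rule integral_nonneg_AE) (use nn in auto)
  have Pz: "\<Phi> 0 = 0"
  proof -
    have "(\<lambda>s. indicator {..<0} s * (\<kappa> s * N s)) = (\<lambda>s. 0)" using \<kappa>(3) by (auto simp: indicator_def fun_eq_iff)
    then show ?thesis unfolding \<Phi>_def by simp
  qed
  have step: "\<Phi> t - \<Phi> \<tau> \<le> \<Phi> t * (K t - K \<tau>)" if "\<tau> \<le> t" "t \<le> T" for \<tau> t
  proof -
    have split: "(LBINT s. indicator {..<t} s * h s) - (LBINT s. indicator {..<\<tau>} s * h s) = (LBINT s. indicator {\<tau>..<t} s * h s)"
      if h: "integrable lborel h" for h :: "real \<Rightarrow> real"
    proof -
      have "(\<lambda>s. indicator {..<t} s * h s - indicator {..<\<tau>} s * h s) = (\<lambda>s. indicator {\<tau>..<t} s * h s)"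
        using \<open>\<tau> \<le> t\<close> by (auto simp: indicator_def fun_eq_iff)
      then show ?thesis using Bochner_Integration.integral_diff[OF ind[OF _ h, of "{..<t}"] ind[OF _ h, of "{..<\<tau>}"]] by simp
    qed
    have "\<Phi> t - \<Phi> \<tau> = (LBINT s. indicator {\<tau>..<t} s * (\<kappa> s * N s))"
      unfolding \<Phi>_def by (rule split[OF i])
    also have "\<dots> \<le> (LBINT s. \<Phi> t * (indicator {\<tau>..<t} s * \<kappa> s))"
    proof (rule integral_mono_AE[OF ind[OF _ i] integrable_mult_right[OF ind[OF _ \<kappa>(1)]]])
      show "AE s in lborel. indicator {\<tau>..<t} s * (\<kappa> s * N s) \<le> \<Phi> t * (indicator {\<tau>..<t} s * \<kappa> s)"
        using le
      proof eventually_elim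
        case (elim s)
        show ?case
        proof (cases "s \<in> {\<tau>..<t} \<and> s > 0")
          case True
          then have "N s \<le> \<Phi> s" using elim that by (simp add: \<Phi>_def)
          also have "\<dots> \<le> \<Phi> t" using mono True by simp
          finally have "N s * \<kappa> s \<le> \<Phi> t * \<kappa> s" using \<kappa>(2) by (rule mult_right_mono)
          then show ?thesis using True by (simp add: mult.commute)
        next
          case False
          then show ?thesis using \<kappa>(3)[of s] by (auto simp: indicator_def)
        qed
      qed
    qed auto
    also have "\<dots> = \<Phi> t * (K t - K \<tau>)" unfolding K_def split[OF \<kappa>(1)] by simp
    finally show ?thesis .
  qed
  \<comment> \<open>The zeros of \<Phi> form a closed set by continuity, so the supremum below is
    itself a zero.\<close>
  define A where "A = {t \<in> {0..T}. \<Phi> t = 0}"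
  have A: "0 \<in> A" using Pz T by (simp add: A_def)
  have "closed A"
  proof -
    have "A = {0..T} \<inter> \<Phi> -` {0}" by (auto simp: A_def)
    moreover have "continuous_on {0..T} \<Phi>" using C(1) by (simp add: continuous_at_imp_continuous_on)
    ultimately show ?thesis using continuous_closed_preimage[of "{0..T}" \<Phi> "{0}"] by simp
  qed
  moreover have bdd: "bdd_above A" by (rule bdd_aboveI[of _ T]) (simp add: A_def)
  ultimately have \<tau>: "Sup A \<in> A" using closed_contains_Sup A by blast
  define \<tau> where "\<tau> = Sup A"
  have \<tau>A: "0 \<le> \<tau>" "\<tau> \<le> T" "\<Phi> \<tau> = 0" using \<tau> by (auto simp: A_def \<tau>_def)
  have "\<tau> = T"
  proof (rule ccontr)
    assume "\<tau> \<noteq> T"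
    then have lt: "\<tau> < T" using \<tau>A by simp
    obtain d where d: "d > 0" "\<And>t. dist t \<tau> < d \<Longrightarrow> dist (K t) (K \<tau>) < 1/2"
      using C(2)[of \<tau>] unfolding continuous_at_eps_delta by (metis half_gt_zero zero_less_one)
    define t where "t = min T (\<tau> + d / 2)"
    have t: "\<tau> < t" "t \<le> T" "dist t \<tau> < d" using lt d(1) by (auto simp: t_def dist_real_def)
    have "\<bar>K t - K \<tau>\<bar> < 1/2" using d(2)[OF t(3)] by (simp add: dist_real_def)
    then have "K t - K \<tau> \<le> 1/2" by linarith
    then have "\<Phi> t * (K t - K \<tau>) \<le> \<Phi> t * (1/2)" by (intro mult_left_mono P0)
    then have "\<Phi> t = 0" using step[of \<tau> t] t \<tau>A P0[of t] by simp
    then have "t \<in> A" using t \<tau>A by (simp add: A_def)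
    then have "t \<le> \<tau>" unfolding \<tau>_def using bdd by (rule cSup_upper)
    then show False using t by simp
  qed
  then have "\<Phi> T = 0" using \<tau>A by simp
  then have "\<Phi> t = 0" if "t \<le> T" for t using mono[OF that] P0[of t] by simp
  then show ?thesis using le
    by (auto simp: \<Phi>_def[symmetric] elim!: eventually_mono) (metis N0 less_imp_le order_antisym)
qed

section \<open>Uniqueness\<close>

text \<open>The summand (0, 0) of the Sobolev norm belongs to the zeroth weak derivative, which is
  \<open>f\<close> itself almost everywhere.\<close>

lemma L2norm2_le_Hk_norm2:
  assumes U: "open U" and f: "Hk k U f"
  shows "L2norm2 U f \<le> Hk_norm2 k U f"
proof -
  have "0 + 0 \<le> k" by simp
  then obtain g where g: "weak_pd U f 0 0 g" using f unfolding Hk_def by blast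
  \<comment> \<open>The derivative \<open>g\<close> serves to make \<open>f\<close> locally
    integrable; the integral identity for \<open>f\<close> itself is trivial.\<close>
  then have "weak_pd U f 0 0 f" by (simp add: weak_op_single pd_simps)
  from wd_eq[OF U this] have ae: "AE p in lborel. p \<in> U \<longrightarrow> wd U f 0 0 p = f p" .
  obtain F where F: "rep U f F" using rep_exists[of U f] U f by (auto simp: Hk_def L2_def)
  have "L2norm2 U f = L2norm2 U (wd U f 0 0)"
    using rep_L2norm2[OF F] rep_L2norm2[OF rep_AE_eq[OF F ae]] by simp
  also have "\<dots> \<le> Hk_norm2 k U f"
  proof -
    have "finite {(i, j). i + j \<le> k}"
      by (rule finite_subset[of _ "{..k} \<times> {..k}"]) auto
    moreover have "0 \<le> L2norm2 U h" for h
      unfolding L2norm2_def set_lebesgue_integral_def by (rule integral_nonneg_AE) auto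
    ultimately have "(\<lambda>(i, j). L2norm2 U (wd U f i j)) (0, 0) \<le> Hk_norm2 k U f"
      unfolding Hk_norm2_def by (intro member_le_sum) auto
    then show ?thesis by simp
  qed
  finally show ?thesis .
qed

text \<open>Slice norms bounded by \<open>C\<close> over a bounded time interval are integrable in
  time, so Fubini's theorem applies to the square.\<close>

lemma sqint_fibres:
  fixes f :: "real \<times> 'b::euclidean_space \<Rightarrow> real"
  assumes [measurable]: "f \<in> borel_measurable borel" and z: "\<And>z. fst z \<notin> {0<..<T} \<Longrightarrow> f z = 0"
    and b: "AE t in lborel. t \<in> {0<..<T} \<longrightarrow> sqint (\<lambda>p. f (t, p)) \<and> (LBINT p. (f (t, p))\<^sup>2) \<le> C"
  shows "sqint f"
proof -
  have z': "f (t, p) = 0" if "t \<notin> {0<..<T}" for t p using z[of "(t, p)"] that by simp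
  have ae: "AE t in lborel. integrable lborel (\<lambda>p. (f (t, p))\<^sup>2)"
    using b
  proof eventually_elim
    case (elim t)
    then show ?case using z'[of t] by (cases "t \<in> {0<..<T}") (simp_all add: sqint_def)
  qed
  have m: "(\<lambda>t. \<integral>p. (f (t, p))\<^sup>2 \<partial>lborel) \<in> borel_measurable lborel"
    by (rule lborel.borel_measurable_lebesgue_integral) measurable
  have "integrable lborel (\<lambda>t. C * indicator {0<..<T} t)" by (intro integrable_mult_right integrable_indicator_Ioo)
  then have "integrable lborel (\<lambda>t. \<integral>p. (f (t, p))\<^sup>2 \<partial>lborel)"
  proof (rule Bochner_Integration.integrable_bound[OF _ m])
    show "AE t in lborel. norm (LBINT p. (f (t, p))\<^sup>2) \<le> norm (C * indicator {0<..<T} t)"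
      using b
    proof eventually_elim
      case (elim t)
      then show ?case using z'[of t]
        by (cases "t \<in> {0<..<T}") (auto intro: order_trans[OF _ abs_ge_self])
    qed
  qed
  moreover have "(\<lambda>z. (f z)\<^sup>2) \<in> borel_measurable (lborel \<Otimes>\<^sub>M lborel)"
    unfolding lborel_prod by measurable
  ultimately have "integrable (lborel \<Otimes>\<^sub>M lborel) (\<lambda>z. (f z)\<^sup>2)"
    using ae by (intro lborel_pair.Fubini_integrable) simp_all
  then show ?thesis by (simp add: sqint_def lborel_prod)
qed

text \<open>The weight is divided out of the test function: exp(-b x) \<phi> is again a test
  function, hence square integrable, and the product is unchanged.\<close>

lemma weighted_test_integrable:
  fixes F :: "real \<times> real \<times> real \<Rightarrow> real"
  assumes F: "sqint (\<lambda>z. exp (b * fst (snd z)) * F z)" and \<eta>: "ctest a c \<eta>" and \<phi>: "test2 U \<phi>"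
  shows "integrable lborel (\<lambda>z. F z * (\<eta> (fst z) * \<phi> (snd z)))"
proof -
  have \<psi>: "sqint (\<lambda>p. exp (- b * fst p) * \<phi> p)" by (rule sqint_test2[OF test2_exp_mult[OF \<phi>]])
  have "sqint (\<lambda>z. \<eta> (fst z) * (exp (- b * fst (snd z)) * \<phi> (snd z)))"
    by (rule sqint_mult_fst_snd) (use \<psi> ctest_square_integrable[OF \<eta>] ctest_integrable[OF \<eta>] in \<open>auto simp: sqint_def\<close>)
  from sqint_mult_integrable[OF F this]
  have "integrable lborel (\<lambda>z. exp (b * fst (snd z)) * F z * (\<eta> (fst z) * (exp (- b * fst (snd z)) * \<phi> (snd z))))" .
  moreover have "exp (b * x) * f * (e * (exp (- b * x) * h)) = f * (e * h)" for x f e h :: real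
  proof -
    have "exp (b * x) * f * (e * (exp (- b * x) * h)) = (exp (b * x) * exp (- b * x)) * (f * (e * h))" by (simp only: mult_ac)
    then show ?thesis by (simp add: mult_exp_exp)
  qed
  ultimately show ?thesis by (simp only:)
qed

text \<open>Joint measurability in time and space is recorded for \<open>U\<close> and
  \<open>W\<close>. The spatial derivatives are chosen separately at each time, which is why they
  stand under an existential quantifier and enter later only through integral bounds.
  \<open>M\<close> becomes part of the Gronwall kernel, and \<open>C\<close> keeps the norm bounded,
  so that kernel times norm is integrable. Time test functions live in (-1, T) and may be nonzero at
  t = 0.\<close>

definition solution_data ::
  "real \<Rightarrow> real \<Rightarrow> real \<Rightarrow> (real \<times> real \<Rightarrow> real) \<Rightarrow> (real \<Rightarrow> real \<times> real \<Rightarrow> real) \<Rightarrow>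
   (real \<times> real \<times> real \<Rightarrow> real) \<Rightarrow> (real \<times> real \<times> real \<Rightarrow> real) \<Rightarrow> (real \<Rightarrow> real) \<Rightarrow> real \<Rightarrow> bool" where
  "solution_data B T b u0 u U W M C \<longleftrightarrow>
    rep ({0<..<T} \<times> strip B) (\<lambda>z. u (fst z) (snd z)) U \<and>
    W \<in> borel_measurable borel \<and> (\<forall>z. z \<notin> {0<..<T} \<times> strip B \<longrightarrow> W z = 0) \<and>
    sqint (\<lambda>z. exp (b * fst (snd z)) * U z) \<and> sqint (\<lambda>z. exp (b * fst (snd z)) * W z) \<and>
    integrable lborel M \<and> (\<forall>t. M t \<ge> 0) \<and>
    (AE t in lborel. t \<in> {0<..<T} \<longrightarrow> (\<exists>P V Q vy qx qxx qy qyy.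
       regular_slice B b (\<lambda>p. U (t, p)) (\<lambda>p. W (t, p)) P V Q vy qx qxx qy qyy \<and>
       (LBINT p. (P p)\<^sup>2) + (LBINT p. (U (t, p))\<^sup>2) \<le> M t \<and>
       (LBINT p. (exp (b * fst p) * U (t, p))\<^sup>2) \<le> C)) \<and>
    (\<forall>\<phi> \<eta>. test2 (strip B) \<phi> \<longrightarrow> ctest (-1) T \<eta> \<longrightarrow>
       (LBINT z. U z * (deriv \<eta> (fst z) * \<phi> (snd z))) + (LINT p:strip B|lebesgue. u0 p * \<phi> p) * \<eta> 0
        = - (LBINT z. W z * (\<eta> (fst z) * \<phi> (snd z))))"

lemma solution_dataD:
  assumes "solution_data B T b u0 u U W M C"
  shows "rep ({0<..<T} \<times> strip B) (\<lambda>z. u (fst z) (snd z)) U"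
    "W \<in> borel_measurable borel" "z \<notin> {0<..<T} \<times> strip B \<Longrightarrow> W z = 0"
    "sqint (\<lambda>z. exp (b * fst (snd z)) * U z)" "sqint (\<lambda>z. exp (b * fst (snd z)) * W z)"
    "integrable lborel M" "M t \<ge> 0"
    "AE t in lborel. t \<in> {0<..<T} \<longrightarrow> (\<exists>P V Q vy qx qxx qy qyy.
       regular_slice B b (\<lambda>p. U (t, p)) (\<lambda>p. W (t, p)) P V Q vy qx qxx qy qyy \<and>
       (LBINT p. (P p)\<^sup>2) + (LBINT p. (U (t, p))\<^sup>2) \<le> M t \<and>
       (LBINT p. (exp (b * fst p) * U (t, p))\<^sup>2) \<le> C)"
    "test2 (strip B) \<phi> \<Longrightarrow> ctest (-1) T \<eta> \<Longrightarrow>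
       (LBINT z. U z * (deriv \<eta> (fst z) * \<phi> (snd z))) + (LINT p:strip B|lebesgue. u0 p * \<phi> p) * \<eta> 0
        = - (LBINT z. W z * (\<eta> (fst z) * \<phi> (snd z)))"
  using assms unfolding solution_data_def by blast+

text \<open>Conditions at almost every time are transferred from the completed measure to
  \<open>lborel\<close>, and joint Borel versions of u and u_t are sliced in time. The bound
  \<open>M\<close> combines u in L^inf(0,T;L^2) with u_x in L^2(0,T;L^2).\<close>

lemma regular_solution_data:
  assumes reg: "regular_solution B T b u0 u"
  shows "\<exists>U W M C. solution_data B T b u0 u U W M C"
  using reg unfolding regular_solution_def
proof (elim exE conjE)
  let ?S = "strip B" and ?\<Omega> = "{0<..<T} \<times> strip B"
  have oS: "open ?S" by (rule open_strip)
  fix w assume jm: "jmeas B T u" "jmeas B T w"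
    and l1: "Linf_time T (L2 ?S) (L2norm2 ?S) u"
    and l2: "L2_time T (\<lambda>f. \<exists>g. weak_pd ?S f 1 0 g \<and> L2 ?S g) (\<lambda>f. L2norm2 ?S (wd ?S f 1 0)) u"
    and l3: "Linf_time T (Hk 2 ?S) (Hk_norm2 2 ?S) (wt b u)"
    and l4: "L2_time T (Hk 3 ?S) (Hk_norm2 3 ?S) (wt b u)"
    and l6: "L2_time T (Hk 3 ?S) (Hk_norm2 3 ?S) (wt b (\<lambda>t. wd ?S (u t) 1 0))"
    and l7: "Linf_time T (L2 ?S) (L2norm2 ?S) (wt b w)"
    and bc: "AE t in lebesgue. t \<in> {0<..<T} \<longrightarrow> vanish_y B (u t)"
    and tw: "\<forall>\<phi> \<eta>. test2 ?S \<phi> \<longrightarrow> smooth1 \<eta> \<longrightarrow> (\<exists>K. compact K \<and> K \<subseteq> {..<T} \<and> (\<forall>t. t \<notin> K \<longrightarrow> \<eta> t = 0)) \<longrightarrow>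
        (LINT t:{0<..<T}|lebesgue. (LINT p:?S|lebesgue. u t p * \<phi> p) * deriv \<eta> t)
          + (LINT p:?S|lebesgue. u0 p * \<phi> p) * \<eta> 0
        = - (LINT t:{0<..<T}|lebesgue. (LINT p:?S|lebesgue. w t p * \<phi> p) * \<eta> t)"
    and pde: "AE t in lebesgue. t \<in> {0<..<T} \<longrightarrow>
        (\<forall>\<phi>. L2 ?S \<phi> \<longrightarrow>
          (LINT p:?S|lebesgue. exp (b * fst p) *
             (w t p - wd ?S (u t) 2 0 p + wd ?S (u t) 3 0 p
              + u t p * wd ?S (u t) 1 0 p + wd ?S (u t) 1 2 p) * \<phi> p) = 0)"
  have wt_eq: "wt b f t = (\<lambda>p. exp (b * fst p) * f t p)" for f t by (simp add: wt_def fun_eq_iff)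
  have bO: "?\<Omega> \<in> sets borel" using open_Times[OF _ oS, of "{0<..<T}"] by simp
  obtain U where rU: "rep ?\<Omega> (\<lambda>z. u (fst z) (snd z)) U"
    using rep_exists[OF bO jm(1)[unfolded jmeas_def]] by blast
  obtain W where rW: "rep ?\<Omega> (\<lambda>z. w (fst z) (snd z)) W"
    using rep_exists[OF bO jm(2)[unfolded jmeas_def]] by blast
  have [measurable]: "U \<in> borel_measurable borel" "W \<in> borel_measurable borel"
    using rep_measurable[OF rU] rep_measurable[OF rW] by auto
  have sec: "AE t in lborel. t \<in> {0<..<T} \<longrightarrow> rep ?S (f t) (\<lambda>p. F (t, p))"
    if r: "rep ?\<Omega> (\<lambda>z. f (fst z) (snd z)) F" for f F
  proof -
    have [measurable]: "F \<in> borel_measurable borel" by (rule rep_measurable[OF r])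
    have "AE z in lborel. z \<in> ?\<Omega> \<longrightarrow> f (fst z) (snd z) = F z" using r by (simp add: rep_def)
    from AE_lborel_pair(1)[OF this] show ?thesis
    proof eventually_elim
      case (elim t)
      show ?case
      proof
        assume t: "t \<in> {0<..<T}"
        have "(\<lambda>p. F (t, p)) \<in> borel_measurable borel" by measurable
        moreover have "F (t, p) = 0" if "p \<notin> ?S" for p using rep_outside[OF r, of "(t, p)"] that by simp
        moreover have "AE p in lborel. p \<in> ?S \<longrightarrow> f t p = F (t, p)" using elim t by simp
        ultimately show "rep ?S (f t) (\<lambda>p. F (t, p))" unfolding rep_def by blast
      qed
    qed
  qed
  obtain C1 where C1: "AE t in lborel. t \<in> {0<..<T} \<longrightarrow> L2norm2 ?S (u t) \<le> C1"
    using l1 unfolding Linf_time_def AE_completion_iff by blast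
  obtain C where C: "AE t in lborel. t \<in> {0<..<T} \<longrightarrow> Hk_norm2 2 ?S (wt b u t) \<le> C"
    using l3 unfolding Linf_time_def AE_completion_iff by blast
  obtain C2 where C2: "AE t in lborel. t \<in> {0<..<T} \<longrightarrow> L2norm2 ?S (wt b w t) \<le> C2"
    using l7 unfolding Linf_time_def AE_completion_iff by blast
  have h1: "AE t in lborel. t \<in> {0<..<T} \<longrightarrow> L2 ?S (u t)"
    and h2: "AE t in lborel. t \<in> {0<..<T} \<longrightarrow> (\<exists>g. weak_pd ?S (u t) 1 0 g \<and> L2 ?S g)"
    and h3: "AE t in lborel. t \<in> {0<..<T} \<longrightarrow> Hk 2 ?S (wt b u t)"
    and h4: "AE t in lborel. t \<in> {0<..<T} \<longrightarrow> Hk 3 ?S (wt b u t)"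
    and h6: "AE t in lborel. t \<in> {0<..<T} \<longrightarrow> Hk 3 ?S (wt b (\<lambda>t. wd ?S (u t) 1 0) t)"
    and h7: "AE t in lborel. t \<in> {0<..<T} \<longrightarrow> L2 ?S (wt b w t)"
    using l1 l2 l3 l4 l6 l7 unfolding Linf_time_def L2_time_def AE_completion_iff by blast+
  have me: "(\<lambda>p. exp (b * fst p)) \<in> borel_measurable (borel :: (real \<times> real) measure)" by measurable
  have bU: "AE t in lborel. t \<in> {0<..<T} \<longrightarrow> sqint (\<lambda>p. exp (b * fst p) * U (t, p)) \<and> (LBINT p. (exp (b * fst p) * U (t, p))\<^sup>2) \<le> C"
    using sec[OF rU] C h3
  proof eventually_elim
    case (elim t)
    show ?case
    proof
      assume t: "t \<in> {0<..<T}"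
      have r: "rep ?S (wt b u t) (\<lambda>p. exp (b * fst p) * U (t, p))"
        unfolding wt_eq using elim(1) t by (intro rep_cong_mult[OF _ me]) simp
      have "L2norm2 ?S (wt b u t) \<le> C"
        using L2norm2_le_Hk_norm2[OF oS, of 2 "wt b u t"] elim t by force
      then show "sqint (\<lambda>p. exp (b * fst p) * U (t, p)) \<and> (LBINT p. (exp (b * fst p) * U (t, p))\<^sup>2) \<le> C"
        using rep_L2[OF r] rep_L2norm2[OF r] elim(3) t by (simp add: Hk_def)
    qed
  qed
  have bW: "AE t in lborel. t \<in> {0<..<T} \<longrightarrow> sqint (\<lambda>p. exp (b * fst p) * W (t, p)) \<and> (LBINT p. (exp (b * fst p) * W (t, p))\<^sup>2) \<le> C2"
    using sec[OF rW] C2 h7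
  proof eventually_elim
    case (elim t)
    show ?case
    proof
      assume t: "t \<in> {0<..<T}"
      have r: "rep ?S (wt b w t) (\<lambda>p. exp (b * fst p) * W (t, p))"
        unfolding wt_eq using elim(1) t by (intro rep_cong_mult[OF _ me]) simp
      then show "sqint (\<lambda>p. exp (b * fst p) * W (t, p)) \<and> (LBINT p. (exp (b * fst p) * W (t, p))\<^sup>2) \<le> C2"
        using rep_L2[OF r] rep_L2norm2[OF r] elim t by simp
    qed
  qed
  have U0: "U z = 0" and W0: "W z = 0" if "z \<notin> ?\<Omega>" for z
    using rep_outside[OF rU that] rep_outside[OF rW that] by auto
  have sU: "sqint (\<lambda>z. exp (b * fst (snd z)) * U z)"
    by (rule sqint_fibres[where T=T and C=C]) (measurable, use U0 bU in auto)
  have sW: "sqint (\<lambda>z. exp (b * fst (snd z)) * W z)"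
    by (rule sqint_fibres[where T=T and C=C2]) (measurable, use W0 bW in auto)
  have li: "integrable lebesgue (\<lambda>t. indicator {0<..<T} t *\<^sub>R L2norm2 ?S (wd ?S (u t) 1 0))"
    using l2 unfolding L2_time_def set_integrable_def by blast
  \<comment> \<open>The squared norm of u_x is only Lebesgue measurable in time, so a Borel version
    is taken.\<close>
  obtain m where m: "m \<in> borel_measurable lborel" "AE t in lborel. indicator {0<..<T} t *\<^sub>R L2norm2 ?S (wd ?S (u t) 1 0) = m t"
    using completion_ex_borel_measurable_real borel_measurable_integrable[OF li] by blast
  have im: "integrable lborel m"
    using lebesgue_integrable_rep[OF _ m(2)] m(1) li by simp
  \<comment> \<open>The two terms cover the squared norms of u_x and u. Absolute values make
    \<open>M\<close> nonnegative at every time, and the indicator keeps the constant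
    integrable.\<close>
  define M where "M t = \<bar>m t\<bar> + \<bar>C1\<bar> * indicator {0<..<T} t" for t
  have iM: "integrable lborel M" unfolding M_def using im integrable_indicator_Ioo[of 0 T] by simp
  have M0: "M t \<ge> 0" for t by (simp add: M_def)
  have slices: "AE t in lborel. t \<in> {0<..<T} \<longrightarrow> (\<exists>P V Q vy qx qxx qy qyy.
       regular_slice B b (\<lambda>p. U (t, p)) (\<lambda>p. W (t, p)) P V Q vy qx qxx qy qyy \<and>
       (LBINT p. (P p)\<^sup>2) + (LBINT p. (U (t, p))\<^sup>2) \<le> M t \<and>
       (LBINT p. (exp (b * fst p) * U (t, p))\<^sup>2) \<le> C)"
    using sec[OF rU] sec[OF rW] h1 h2 h4 h6 h7 bc[unfolded AE_completion_iff] pde[unfolded AE_completion_iff] C1 m(2) bU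
  proof eventually_elim
    case (elim t)
    show ?case
    proof
      assume t: "t \<in> {0<..<T}"
      have rt: "rep ?S (u t) (\<lambda>p. U (t, p))" using elim(1) t by blast
      have "\<exists>P V Q vy qx qxx qy qyy. regular_slice B b (\<lambda>p. U (t, p)) (\<lambda>p. W (t, p)) P V Q vy qx qxx qy qyy \<and>
          (LBINT p. (P p)\<^sup>2) = L2norm2 ?S (wd ?S (u t) 1 0)"
        by (rule regular_slice_exists[OF rt elim(2)[rule_format, OF t]])
          (use elim t in \<open>simp_all add: wt_eq\<close>)
      then obtain P V Q vy qx qxx qy qyy where sl: "regular_slice B b (\<lambda>p. U (t, p)) (\<lambda>p. W (t, p)) P V Q vy qx qxx qy qyy"
        and P: "(LBINT p. (P p)\<^sup>2) = L2norm2 ?S (wd ?S (u t) 1 0)" by blast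
      have "(LBINT p. (P p)\<^sup>2) + (LBINT p. (U (t, p))\<^sup>2) \<le> M t"
        unfolding P using elim(11) elim(10) t rep_L2norm2[OF rt] by (simp add: M_def)
      moreover have "(LBINT p. (exp (b * fst p) * U (t, p))\<^sup>2) \<le> C" using elim(12) t by blast
      ultimately show "\<exists>P V Q vy qx qxx qy qyy.
         regular_slice B b (\<lambda>p. U (t, p)) (\<lambda>p. W (t, p)) P V Q vy qx qxx qy qyy \<and>
         (LBINT p. (P p)\<^sup>2) + (LBINT p. (U (t, p))\<^sup>2) \<le> M t \<and>
         (LBINT p. (exp (b * fst p) * U (t, p))\<^sup>2) \<le> C"
        by (intro exI conjI) (rule sl)
    qed
  qed
  \<comment> \<open>Iterated integrals in the completed measures become one integral over
    space-time, the form in which the du Bois-Reymond lemma is stated.\<close>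
  have conv: "(LINT t:{0<..<T}|lebesgue. (LINT p:?S|lebesgue. f t p * \<phi> p) * \<eta> t) = (LBINT z. F z * (\<eta> (fst z) * \<phi> (snd z)))"
    if r: "rep ?\<Omega> (\<lambda>z. f (fst z) (snd z)) F" and s: "sqint (\<lambda>z. exp (b * fst (snd z)) * F z)" and \<phi>: "test2 ?S \<phi>" and \<eta>: "ctest a c \<eta>"
    for f F \<phi> \<eta> a c
  proof -
    have [measurable]: "F \<in> borel_measurable borel" "\<phi> \<in> borel_measurable borel" "\<eta> \<in> borel_measurable borel"
      using rep_measurable[OF r] test2_measurable[OF \<phi>] ctest_integrable[OF \<eta>] by auto
    have i: "integrable lborel (\<lambda>z. F z * (\<eta> (fst z) * \<phi> (snd z)))" by (rule weighted_test_integrable[OF s \<eta> \<phi>])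
    define H where "H t = (LBINT p. F (t, p) * (\<eta> t * \<phi> p))" for t
    have H: "integrable lborel H" unfolding H_def[abs_def] using integrable_lborel_fst[OF i] by simp
    have "(LINT t:{0<..<T}|lebesgue. (LINT p:?S|lebesgue. f t p * \<phi> p) * \<eta> t) = integral\<^sup>L lborel H"
      unfolding set_lebesgue_integral_def[of lebesgue "{0<..<T}"]
    proof (rule lebesgue_integral_rep)
      show "H \<in> borel_measurable borel" using H by auto
      show "AE t in lborel. indicator {0<..<T} t *\<^sub>R ((LINT p:?S|lebesgue. f t p * \<phi> p) * \<eta> t) = H t"
        using sec[OF r]
      proof eventually_elim
        case (elim t)
        show ?case
        proof (cases "t \<in> {0<..<T}")
          case True
          then have "(LINT p:?S|lebesgue. f t p * \<phi> p) = (LBINT p. F (t, p) * \<phi> p)"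
            using elim by (intro rep_integral) auto
          moreover have "(\<lambda>p. F (t, p) * (\<eta> t * \<phi> p)) = (\<lambda>p. (F (t, p) * \<phi> p) * \<eta> t)" by (simp add: mult_ac)
          ultimately show ?thesis using True by (simp add: H_def)
        next
          case False
          then have "F (t, p) = 0" for p using rep_outside[OF r, of "(t, p)"] by blast
          then show ?thesis using False by (simp add: H_def)
        qed
      qed
    qed
    also have "\<dots> = (LBINT z. F z * (\<eta> (fst z) * \<phi> (snd z)))"
      unfolding H_def[abs_def] using integral_lborel_fst[OF i] by simp
    finally show ?thesis .
  qed
  have time: "(LBINT z. U z * (deriv \<eta> (fst z) * \<phi> (snd z))) + (LINT p:?S|lebesgue. u0 p * \<phi> p) * \<eta> 0
        = - (LBINT z. W z * (\<eta> (fst z) * \<phi> (snd z)))" if \<phi>: "test2 ?S \<phi>" and \<eta>: "ctest (-1) T \<eta>" for \<phi> \<eta>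
  proof -
    obtain r s where rs: "r \<le> s" "s < T" "\<forall>t. t < r \<or> s < t \<longrightarrow> \<eta> t = 0" using \<eta> unfolding ctest_def by metis
    have "compact {r..s} \<and> {r..s} \<subseteq> {..<T} \<and> (\<forall>t. t \<notin> {r..s} \<longrightarrow> \<eta> t = 0)"
      using rs by (auto simp: not_le)
    then have "\<exists>K. compact K \<and> K \<subseteq> {..<T} \<and> (\<forall>t. t \<notin> K \<longrightarrow> \<eta> t = 0)" by blast
    from tw[rule_format, OF \<phi> ctest_smooth1[OF \<eta>] this] show ?thesis
      unfolding conv[OF rU sU \<phi> ctest_deriv[OF \<eta>]] conv[OF rW sW \<phi> \<eta>] .
  qed
  have mW: "W \<in> borel_measurable borel" by measurable
  have W0': "\<forall>z. z \<notin> ?\<Omega> \<longrightarrow> W z = 0" using W0 by blast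
  have M0': "\<forall>t. M t \<ge> 0" using M0 by blast
  have time': "\<forall>\<phi> \<eta>. test2 ?S \<phi> \<longrightarrow> ctest (-1) T \<eta> \<longrightarrow>
       (LBINT z. U z * (deriv \<eta> (fst z) * \<phi> (snd z))) + (LINT p:?S|lebesgue. u0 p * \<phi> p) * \<eta> 0
        = - (LBINT z. W z * (\<eta> (fst z) * \<phi> (snd z)))" using time by blast
  have "solution_data B T b u0 u U W M C"
    unfolding solution_data_def by (intro conjI) (fact rU mW W0' sU sW iM M0' slices time')+
  then show ?thesis by blast
qed


text \<open>Extension by zero to negative times turns the common initial value of the two solutions into
  \<open>Z = 0\<close> on \<open>(-1, 0)\<close>, since the test functions in time need not vanish at \<open>0\<close>.\<close>
lemma time_derivative_square:
  fixes Z Om :: "real \<times> real \<times> real \<Rightarrow> real"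
  assumes T: "T > 0" and m [measurable]: "Z \<in> borel_measurable borel" "Om \<in> borel_measurable borel"
    and z: "\<And>z. z \<notin> {0<..<T} \<times> strip B \<Longrightarrow> Z z = 0" "\<And>z. z \<notin> {0<..<T} \<times> strip B \<Longrightarrow> Om z = 0"
    and L2: "sqint (\<lambda>z. exp (b * fst (snd z)) * Z z)" "sqint (\<lambda>z. exp (b * fst (snd z)) * Om z)"
    and weak: "\<And>\<phi> \<eta>. test2 (strip B) \<phi> \<Longrightarrow> ctest (-1) T \<eta> \<Longrightarrow>
       (LBINT z. Z z * (deriv \<eta> (fst z) * \<phi> (snd z))) = - (LBINT z. Om z * (\<eta> (fst z) * \<phi> (snd z)))"
  shows "AE p in lborel. AE t in lborel. t \<in> {0<..<T} \<longrightarrow>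
    (exp (b * fst p) * Z (t, p))\<^sup>2 = (LBINT s. indicator {..<t} s * (2 * ((exp (b * fst p) * Z (s, p)) * (exp (b * fst p) * Om (s, p)))))"
proof -
  have int: "integrable lborel (\<lambda>z. F z * indicator (box l u) (snd z))"
    if F: "sqint (\<lambda>z. exp (b * fst (snd z)) * F z)" and [measurable]: "F \<in> borel_measurable borel"
      and F0: "\<And>z. z \<notin> {0<..<T} \<times> strip B \<Longrightarrow> F z = 0" for F :: "real \<times> real \<times> real \<Rightarrow> real" and l u
  proof -
    \<comment> \<open>On a compact box the weight is bounded away from 0. \<open>?g\<close> undoes
      it there and, multiplied by a cutoff in time, is square integrable.\<close>
    let ?g = "\<lambda>p::real\<times>real. indicator (cbox l u) p * exp (- b * fst p)"
    have g: "sqint ?g" by (rule sqint_indicator_exp) simp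
    have "sqint (\<lambda>z. indicator {0<..<T} (fst z) * ?g (snd z))"
      by (rule sqint_mult_fst_snd) (use g integrable_indicator_Ioo_square[of 0 T] in \<open>auto simp: sqint_def\<close>)
    from sqint_mult_integrable[OF F this]
    have i: "integrable lborel (\<lambda>z. exp (b * fst (snd z)) * F z * (indicator {0<..<T} (fst z) * ?g (snd z)))" .
    have [measurable]: "box l u \<in> sets borel" by simp
    show ?thesis
    proof (rule Bochner_Integration.integrable_bound[OF i])
      show "AE z in lborel. norm (F z * indicator (box l u) (snd z)) \<le> norm (exp (b * fst (snd z)) * F z * (indicator {0<..<T} (fst z) * ?g (snd z)))"
      proof (intro AE_I2)
        fix z :: "real \<times> real \<times> real"
        show "norm (F z * indicator (box l u) (snd z)) \<le> norm (exp (b * fst (snd z)) * F z * (indicator {0<..<T} (fst z) * ?g (snd z)))"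
        proof (cases "F z = 0 \<or> snd z \<notin> box l u")
          case True
          then show ?thesis by auto
        next
          case False
          then have "fst z \<in> {0<..<T}" "snd z \<in> cbox l u" "snd z \<in> box l u"
            using F0[of z] box_subset_cbox[of l u] by (auto simp: mem_Times_iff)
          then show ?thesis by (simp add: abs_mult mult_exp_exp mult.assoc mult.left_commute[of _ "\<bar>F z\<bar>"])
        qed
      qed
    qed measurable
  qed
  have "AE p in lborel. p \<in> strip B \<longrightarrow> (\<exists>k l. acI (-1) T k l (\<lambda>t. Z (t, p)) (\<lambda>t. Om (t, p)))"
  proof (rule parametric_du_Bois_Reymond)
    show "Z z' = 0" "Om z' = 0" if "fst z' \<notin> {-1<..<T}" for z'
      using z[of z'] that by (auto simp: mem_Times_iff)
    show "integrable lborel (\<lambda>z. Z z * indicator (box l u) (snd z))" "integrable lborel (\<lambda>z. Om z * indicator (box l u) (snd z))" for l u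
      using int L2 m z by blast+
    show "(LBINT z. Z z * (deriv \<eta> (fst z) * bump n l u (snd z))) = - (LBINT z. Om z * (\<eta> (fst z) * bump n l u (snd z)))"
      if "cbox l u \<subseteq> strip B" "ctest (-1) T \<eta>" for n l u \<eta>
      by (rule weak[OF test2_bump[OF that(1)] that(2)])
  qed (use T open_strip in auto)
  then show ?thesis
  proof eventually_elim
    case (elim p)
    show ?case
    proof (cases "p \<in> strip B")
      case False
      then have "Z (t, p) = 0" for t using z(1)[of "(t, p)"] by blast
      then show ?thesis by simp
    next
      case True
      then obtain k l where ac: "acI (-1) T k l (\<lambda>t. Z (t, p)) (\<lambda>t. Om (t, p))" using elim by blast
      have z0: "Z (t, p) = 0" "Om (t, p) = 0" if "t \<le> 0" for t using z[of "(t, p)"] that by auto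
      \<comment> \<open>Both functions vanish for t <= 0, so on (-1, 0) the representation reads 0 =
        k.\<close>
      have "k = 0"
      proof (rule ccontr)
        assume k: "k \<noteq> 0"
        have "AE t in lborel. t \<in> {-1<..<T} \<longrightarrow> Z (t, p) = k + (LINT s:{-1<..<t}|lborel. Om (s, p))"
          using ac by (simp add: acI_def)
        then have "AE t in lborel. t \<notin> {-1<..<0::real}"
        proof eventually_elim
          case (elim t)
          have "t \<in> {-1<..<0} \<Longrightarrow> (LINT s:{-1<..<t}|lborel. Om (s, p)) = 0"
          proof -
            assume "t \<in> {-1<..<0}"
            then have "(\<lambda>s. indicator {-1<..<t} s *\<^sub>R Om (s, p)) = (\<lambda>s. 0)"
              using z0(2) by (auto simp: indicator_def fun_eq_iff)
            then show ?thesis unfolding set_lebesgue_integral_def by simp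
          qed
          then show ?case using elim z0(1)[of t] k T by auto
        qed
        then have "{-1<..<0::real} \<in> null_sets lborel" by (simp add: AE_iff_null_sets)
        then show False by (auto simp: null_sets_def)
      qed
      \<comment> \<open>The product rule for \<open>Z\<close> with itself. The weight depends on
        space alone and is constant along the line, so it can be inserted afterwards.\<close>
      have "acI (-1) T (k * k) (l * l) (\<lambda>t. Z (t, p) * Z (t, p)) (\<lambda>t. Om (t, p) * Z (t, p) + Z (t, p) * Om (t, p))"
        by (rule acI_product[OF ac ac]) measurable
      then have "AE t in lborel. t \<in> {-1<..<T} \<longrightarrow> Z (t, p) * Z (t, p) = (LINT s:{-1<..<t}|lborel. Om (s, p) * Z (s, p) + Z (s, p) * Om (s, p))"
        by (simp add: acI_def \<open>k = 0\<close>)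
      then show ?thesis
      proof eventually_elim
        case (elim t)
        show ?case
        proof
          assume t: "t \<in> {0<..<T}"
          have "(exp (b * fst p) * Z (t, p))\<^sup>2 = (exp (b * fst p))\<^sup>2 * (Z (t, p) * Z (t, p))"
            by (simp add: power2_eq_square)
          also have "Z (t, p) * Z (t, p) = (LBINT s. indicator {-1<..<t} s * (Om (s, p) * Z (s, p) + Z (s, p) * Om (s, p)))"
            by (rule elim[unfolded set_lebesgue_integral_def real_scaleR_def, rule_format]) (use t in simp)
          also have "(exp (b * fst p))\<^sup>2 * \<dots> = (LBINT s. (exp (b * fst p))\<^sup>2 * (indicator {-1<..<t} s * (Om (s, p) * Z (s, p) + Z (s, p) * Om (s, p))))"
            by simp
          also have "\<dots> = (LBINT s. indicator {..<t} s * (2 * ((exp (b * fst p) * Z (s, p)) * (exp (b * fst p) * Om (s, p)))))"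
          proof (rule Bochner_Integration.integral_cong[OF refl])
            fix s
            show "(exp (b * fst p))\<^sup>2 * (indicator {-1<..<t} s * (Om (s, p) * Z (s, p) + Z (s, p) * Om (s, p)))
              = indicator {..<t} s * (2 * ((exp (b * fst p) * Z (s, p)) * (exp (b * fst p) * Om (s, p))))"
              using z0[of s] by (cases "s \<le> 0") (auto simp: indicator_def power2_eq_square)
          qed
          finally show "(exp (b * fst p) * Z (t, p))\<^sup>2 = (LBINT s. indicator {..<t} s * (2 * ((exp (b * fst p) * Z (s, p)) * (exp (b * fst p) * Om (s, p)))))" .
        qed
      qed
    qed
  qed
qed

lemma regular_slice_sqint:
  assumes "regular_slice B b U W P V Q vy qx qxx qy qyy" shows "sqint (\<lambda>p. exp (b * fst p) * U p)"
proof -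
  have "V = (\<lambda>p. exp (b * fst p) * U p)" "sqint V" using assms by (auto simp: regular_slice_def)
  then show ?thesis by simp
qed

theorem theorem3p4:
  fixes B T b :: real
    and u0 :: "real \<times> real \<Rightarrow> real"
    and u1 u2 :: "real \<Rightarrow> real \<times> real \<Rightarrow> real"
  assumes "B > 0" and "T > 0" and "b > 0"
    and "initial_ok B b u0"
    and "regular_solution B T b u0 u1"
    and "regular_solution B T b u0 u2"
  shows "AE z in lebesgue. z \<in> {0<..<T} \<times> strip B \<longrightarrow> u1 (fst z) (snd z) = u2 (fst z) (snd z)"
proof -
  note B = assms(1) and T = assms(2) and b = assms(3)
  let ?\<Omega> = "{0<..<T} \<times> strip B"
  obtain U1 W1 M1 C1 where d1: "solution_data B T b u0 u1 U1 W1 M1 C1"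
    using regular_solution_data[OF assms(5)] by blast
  obtain U2 W2 M2 C2 where d2: "solution_data B T b u0 u2 U2 W2 M2 C2"
    using regular_solution_data[OF assms(6)] by blast
  note r1 = solution_dataD(1)[OF d1] and W1 = solution_dataD(2,3)[OF d1] and s1 = solution_dataD(4,5)[OF d1]
    and M1 = solution_dataD(6,7)[OF d1] and sl1 = solution_dataD(8)[OF d1] and w1 = solution_dataD(9)[OF d1]
  note r2 = solution_dataD(1)[OF d2] and W2 = solution_dataD(2,3)[OF d2] and s2 = solution_dataD(4,5)[OF d2]
    and M2 = solution_dataD(6,7)[OF d2] and sl2 = solution_dataD(8)[OF d2] and w2 = solution_dataD(9)[OF d2]
  note [measurable] = rep_measurable[OF r1] rep_measurable[OF r2] W1(1) W2(1)
  define Z Om where "Z z = U1 z - U2 z" and "Om z = W1 z - W2 z" for z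
  have [measurable]: "Z \<in> borel_measurable borel" "Om \<in> borel_measurable borel"
    unfolding Z_def[abs_def] Om_def[abs_def] by measurable
  have z0: "Z z = 0" "Om z = 0" if "z \<notin> ?\<Omega>" for z
    using rep_outside[OF r1 that] rep_outside[OF r2 that] W1(2)[OF that] W2(2)[OF that] by (simp_all add: Z_def Om_def)
  define Ze Oe where "Ze z = exp (b * fst (snd z)) * Z z" and "Oe z = exp (b * fst (snd z)) * Om z" for z
  have sZ: "sqint Ze" and sO: "sqint Oe"
    using sqint_diff[OF s1(1) s2(1)] sqint_diff[OF s1(2) s2(2)]
    unfolding Ze_def[abs_def] Oe_def[abs_def] by (simp_all add: Z_def Om_def right_diff_distrib)
  note [measurable] = sqint_measurable[OF sZ] sqint_measurable[OF sO]
  \<comment> \<open>Both solutions have the initial value \<open>u0\<close>, so the terms at t = 0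
    cancel.\<close>
  have weak: "(LBINT z. Z z * (deriv \<eta> (fst z) * \<phi> (snd z))) = - (LBINT z. Om z * (\<eta> (fst z) * \<phi> (snd z)))"
    if \<phi>: "test2 (strip B) \<phi>" and \<eta>: "ctest (-1) T \<eta>" for \<phi> \<eta>
    unfolding Z_def Om_def left_diff_distrib
    using w1[OF \<phi> \<eta>] w2[OF \<phi> \<eta>] weighted_test_integrable[OF s1(1) ctest_deriv[OF \<eta>] \<phi>]
      weighted_test_integrable[OF s2(1) ctest_deriv[OF \<eta>] \<phi>] weighted_test_integrable[OF s1(2) \<eta> \<phi>]
      weighted_test_integrable[OF s2(2) \<eta> \<phi>] by simp
  define h where "h z = 2 * (Ze z * Oe z)" for z
  have ih: "integrable lborel h" unfolding h_def[abs_def] using sqint_mult_integrable[OF sZ sO] by simp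
  note [measurable] = borel_measurable_integrable[OF ih, simplified]
  have h0: "h (s, p) = 0" if "s \<notin> {0<..<T}" for s p
  proof -
    have "(s, p) \<notin> ?\<Omega>" using that by blast
    from z0(1)[OF this] show ?thesis by (simp add: h_def Ze_def)
  qed
  have sq_p: "AE p in lborel. AE t in lborel. t \<in> {0<..<T} \<longrightarrow> (Ze (t, p))\<^sup>2 = (LBINT s. indicator {..<t} s * h (s, p))"
    unfolding h_def Ze_def Oe_def fst_conv snd_conv
    by (rule time_derivative_square[where B=B, OF T _ _ z0 sZ[unfolded Ze_def[abs_def]] sO[unfolded Oe_def[abs_def]] weak]) measurable
  \<comment> \<open>\<open>sq_p\<close> holds for almost every p and then almost every t. Exchanging
    the two passes through a measurable set in space-time; the \<open>if\<close> form gives the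
    joint measurability.\<close>
  have "AE z in lborel. fst z \<in> {0<..<T} \<longrightarrow> (Ze z)\<^sup>2 = (LBINT s. (if s < fst z then 1 else 0) * h (s, snd z))"
  proof (rule AE_lborel_pairI_snd)
    have "(\<lambda>z::real\<times>real\<times>real. \<integral>s. (if s < fst z then 1 else 0) * h (s, snd z) \<partial>lborel) \<in> borel_measurable (lborel \<Otimes>\<^sub>M lborel)"
      by (rule lborel.borel_measurable_lebesgue_integral) measurable
    then have [measurable]: "(\<lambda>z::real\<times>real\<times>real. \<integral>s. (if s < fst z then 1 else 0) * h (s, snd z) \<partial>lborel) \<in> borel_measurable borel"
      by (simp add: lborel_prod borel_prod)
    show "{z. fst z \<in> {0<..<T} \<longrightarrow> (Ze z)\<^sup>2 = (LBINT s. (if s < fst z then 1 else 0) * h (s, snd z))} \<in> sets borel"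
      by measurable
  qed (use sq_p in \<open>simp add: indicator_def of_bool_def\<close>)
  then have sq: "AE t in lborel. AE p in lborel. t \<in> {0<..<T} \<longrightarrow> (Ze (t, p))\<^sup>2 = (LBINT s. indicator {..<t} s * h (s, p))"
    using AE_lborel_pair(1) by (fastforce simp: indicator_def of_bool_def)
  define N where "N t = (LBINT p. (Ze (t, p))\<^sup>2)" for t
  have sZ2: "integrable lborel (\<lambda>z. (Ze z)\<^sup>2)" using sZ by (simp add: sqint_def)
  have iN: "integrable lborel N" unfolding N_def[abs_def] by (rule integrable_lborel_fst[OF sZ2])
  \<comment> \<open>In the integrated sense of \<open>ND\<close> below, this is the time derivative
    of \<open>N\<close>, namely 2 (v, exp(b x) z_t).\<close>
  define D where "D s = (LBINT p. h (s, p))" for s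
  have iD: "integrable lborel D" unfolding D_def[abs_def] by (rule integrable_lborel_fst[OF ih])
  have N0: "N t \<ge> 0" for t by (simp add: N_def)
  have ND: "AE t in lborel. t \<in> {0<..<T} \<longrightarrow> N t = (LBINT s. indicator {..<t} s * D s)"
    using sq
  proof eventually_elim
    case (elim t)
    show ?case
    proof
      assume t: "t \<in> {0<..<T}"
      have [measurable]: "{..<t} \<in> sets borel" by simp
      have i: "integrable lborel (\<lambda>z. indicator {..<t} (fst z) * h z)"
        by (rule Bochner_Integration.integrable_bound[OF ih]) (measurable, auto simp: indicator_def)
      have "N t = (LBINT p. (LBINT s. indicator {..<t} s * h (s, p)))"
        unfolding N_def
      proof (rule integral_cong_AE)
        show "(\<lambda>p. \<integral>s. indicator {..<t} s * h (s, p) \<partial>lborel) \<in> borel_measurable lborel"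
          using integrable_lborel_snd[OF i] by auto
        show "AE p in lborel. (Ze (t, p))\<^sup>2 = (LBINT s. indicator {..<t} s * h (s, p))"
          using elim t by simp
      qed measurable
      also have "\<dots> = (LBINT z. indicator {..<t} (fst z) * h z)" using integral_lborel_snd[OF i] by simp
      also have "\<dots> = (LBINT s. indicator {..<t} s * D s)" using integral_lborel_fst[OF i] by (simp add: D_def)
      finally show "N t = (LBINT s. indicator {..<t} s * D s)" .
    qed
  qed
  \<comment> \<open>The factor 2 is that of the derivative of a square, and \<open>M1 + M2\<close>
    dominates the norms of u_1x, u_2x and u_2. The indicator makes the kernel vanish for t <= 0, as
    \<open>gronwall_zero\<close> demands.\<close>
  define \<kappa> where "\<kappa> t = indicator {0<..<T} t * (2 * energy_const b * (1 + M1 t + M2 t))" for t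
  have e0: "energy_const b \<ge> 0" using b by (simp add: energy_const_def)
  have \<kappa>0: "\<kappa> t \<ge> 0" for t using e0 M1(2)[of t] M2(2)[of t] by (simp add: \<kappa>_def)
  have i\<kappa>: "integrable lborel \<kappa>"
  proof -
    have "integrable lborel (\<lambda>t. 2 * energy_const b * (indicator {0<..<T} t + indicator {0<..<T} t * M1 t + indicator {0<..<T} t * M2 t))"
      using integrable_indicator_Ioo[of 0 T] integrable_mult_indicator[OF _ M1(1), of "{0<..<T}"] integrable_mult_indicator[OF _ M2(1), of "{0<..<T}"] by simp
    then show ?thesis unfolding \<kappa>_def[abs_def] by (simp add: algebra_simps)
  qed
  \<comment> \<open>The second bound is what makes \<kappa> N integrable, \<kappa> itself being
    merely integrable.\<close>
  have bounds: "AE t in lborel. D t \<le> \<kappa> t * N t \<and> N t \<le> 2 * (\<bar>C1\<bar> + \<bar>C2\<bar>)"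
    using sl1 sl2
  proof eventually_elim
    case (elim t)
    show ?case
    proof (cases "t \<in> {0<..<T}")
      case False
      then have "Z (t, p) = 0" for p using z0(1)[of "(t, p)"] by blast
      then show ?thesis by (simp add: D_def N_def h_def Ze_def)
    next
      case True
      obtain P1 V1 Q1 vy1 qx1 qxx1 qy1 qyy1 where S1: "regular_slice B b (\<lambda>p. U1 (t, p)) (\<lambda>p. W1 (t, p)) P1 V1 Q1 vy1 qx1 qxx1 qy1 qyy1"
        and m1: "(LBINT p. (P1 p)\<^sup>2) + (LBINT p. (U1 (t, p))\<^sup>2) \<le> M1 t" and c1: "(LBINT p. (exp (b * fst p) * U1 (t, p))\<^sup>2) \<le> C1"
        using elim(1) True by blast
      obtain P2 V2 Q2 vy2 qx2 qxx2 qy2 qyy2 where S2: "regular_slice B b (\<lambda>p. U2 (t, p)) (\<lambda>p. W2 (t, p)) P2 V2 Q2 vy2 qx2 qxx2 qy2 qyy2"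
        and m2: "(LBINT p. (P2 p)\<^sup>2) + (LBINT p. (U2 (t, p))\<^sup>2) \<le> M2 t" and c2: "(LBINT p. (exp (b * fst p) * U2 (t, p))\<^sup>2) \<le> C2"
        using elim(2) True by blast
      have v1: "sqint (\<lambda>p. exp (b * fst p) * U1 (t, p))" and v2: "sqint (\<lambda>p. exp (b * fst p) * U2 (t, p))"
        using regular_slice_sqint S1 S2 by blast+
      have "D t = 2 * (LBINT p. (exp (b * fst p) * (U1 (t, p) - U2 (t, p))) * (exp (b * fst p) * (W1 (t, p) - W2 (t, p))))"
        unfolding D_def h_def Ze_def Oe_def Z_def Om_def by simp
      also have "\<dots> \<le> 2 * (energy_const b * (1 + (LBINT p. (P1 p)\<^sup>2) + (LBINT p. (P2 p)\<^sup>2) + (LBINT p. (U2 (t, p))\<^sup>2)) * N t)"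
        using slice_difference[OF B b S1 S2] by (simp add: N_def Ze_def Z_def)
      also have "\<dots> \<le> 2 * (energy_const b * (1 + M1 t + M2 t) * N t)"
      proof -
        have "0 \<le> (LBINT p. (U1 (t, p))\<^sup>2)" by simp
        then have "1 + (LBINT p. (P1 p)\<^sup>2) + (LBINT p. (P2 p)\<^sup>2) + (LBINT p. (U2 (t, p))\<^sup>2) \<le> 1 + M1 t + M2 t"
          using m1 m2 by linarith
        then show ?thesis using e0 N0[of t] by (intro mult_left_mono mult_right_mono) auto
      qed
      finally have "D t \<le> \<kappa> t * N t" using True by (simp add: \<kappa>_def)
      moreover have "N t \<le> 2 * (\<bar>C1\<bar> + \<bar>C2\<bar>)"
      proof -
        have "N t \<le> (LBINT p. 2 * (exp (b * fst p) * U1 (t, p))\<^sup>2 + 2 * (exp (b * fst p) * U2 (t, p))\<^sup>2)"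
          unfolding N_def
        proof (rule integral_mono)
          have "sqint (\<lambda>p. exp (b * fst p) * U1 (t, p) - exp (b * fst p) * U2 (t, p))" by (rule sqint_diff[OF v1 v2])
          then show "integrable lborel (\<lambda>p. (Ze (t, p))\<^sup>2)" by (simp add: sqint_def Ze_def Z_def right_diff_distrib)
          show "integrable lborel (\<lambda>p. 2 * (exp (b * fst p) * U1 (t, p))\<^sup>2 + 2 * (exp (b * fst p) * U2 (t, p))\<^sup>2)"
            using v1 v2 by (simp add: sqint_def)
          show "(Ze (t, p))\<^sup>2 \<le> 2 * (exp (b * fst p) * U1 (t, p))\<^sup>2 + 2 * (exp (b * fst p) * U2 (t, p))\<^sup>2" for p
          proof -
            have "(x - y)\<^sup>2 \<le> 2 * x\<^sup>2 + 2 * y\<^sup>2" for x y :: real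
              using zero_le_power2[of "x + y"] by (simp add: power2_sum power2_diff)
            then show ?thesis by (simp add: Ze_def Z_def right_diff_distrib)
          qed
        qed
        also have "\<dots> = 2 * (LBINT p. (exp (b * fst p) * U1 (t, p))\<^sup>2) + 2 * (LBINT p. (exp (b * fst p) * U2 (t, p))\<^sup>2)"
          using v1 v2 by (simp add: sqint_def)
        also have "\<dots> \<le> 2 * C1 + 2 * C2" by (intro add_mono mult_left_mono c1 c2) auto
        also have "\<dots> \<le> 2 * (\<bar>C1\<bar> + \<bar>C2\<bar>)" 
          unfolding distrib_left by (intro add_mono mult_left_mono abs_ge_self) auto
        finally show ?thesis .
      qed
      ultimately show ?thesis ..
    qed
  qed
  have mN: "N \<in> borel_measurable borel" using iN by auto
  have i\<kappa>N: "integrable lborel (\<lambda>s. \<kappa> s * N s)"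
  proof (rule Bochner_Integration.integrable_bound[OF integrable_mult_left[OF i\<kappa>, of "2 * (\<bar>C1\<bar> + \<bar>C2\<bar>)"]])
    show "(\<lambda>s. \<kappa> s * N s) \<in> borel_measurable lborel" using i\<kappa> iN by auto
    show "AE s in lborel. norm (\<kappa> s * N s) \<le> norm (\<kappa> s * (2 * (\<bar>C1\<bar> + \<bar>C2\<bar>)))"
      using bounds by eventually_elim (use \<kappa>0 N0 in \<open>auto simp: abs_mult intro!: mult_left_mono\<close>)
  qed
  have le: "AE t in lborel. t \<in> {0<..<T} \<longrightarrow> N t \<le> (LBINT s. indicator {..<t} s * (\<kappa> s * N s))"
    using ND
  proof eventually_elim
    case (elim t)
    have "(LBINT s. indicator {..<t} s * D s) \<le> (LBINT s. indicator {..<t} s * (\<kappa> s * N s))"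
    proof (rule integral_mono_AE)
      show "integrable lborel (\<lambda>s. indicator {..<t} s * D s)" "integrable lborel (\<lambda>s. indicator {..<t} s * (\<kappa> s * N s))"
        using integrable_mult_indicator[OF _ iD, of "{..<t}"] integrable_mult_indicator[OF _ i\<kappa>N, of "{..<t}"] by simp_all
      show "AE s in lborel. indicator {..<t} s * D s \<le> indicator {..<t} s * (\<kappa> s * N s)"
        using bounds by eventually_elim (auto simp: indicator_def)
    qed
    then show ?case using elim by simp
  qed
  have "AE t in lborel. t \<in> {0<..<T} \<longrightarrow> N t = 0"
    by (rule gronwall_zero[OF T i\<kappa> \<kappa>0 _ mN N0 i\<kappa>N le]) (simp add: \<kappa>_def)
  then have Z0: "AE t in lborel. AE p in lborel. Z (t, p) = 0"
    using AE_integrable_lborel_fst[OF sZ2]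
  proof eventually_elim
    case (elim t)
    show ?case
    proof (cases "t \<in> {0<..<T}")
      case True
      then have "AE p in lborel. (Ze (t, p))\<^sup>2 = 0"
        using elim integral_nonneg_eq_0_iff_AE[OF elim(2)] by (simp add: N_def)
      then show ?thesis by eventually_elim (simp add: Ze_def)
    next
      case False
      then show ?thesis using z0(1) by auto
    qed
  qed
  have "AE z in lborel. Z z = 0"
    by (rule AE_lborel_pairI[OF _ Z0]) measurable
  moreover have "AE z in lborel. z \<in> ?\<Omega> \<longrightarrow> u1 (fst z) (snd z) = U1 z" "AE z in lborel. z \<in> ?\<Omega> \<longrightarrow> u2 (fst z) (snd z) = U2 z"
    using r1 r2 by (simp_all add: rep_def)
  ultimately have "AE z in lborel. z \<in> ?\<Omega> \<longrightarrow> u1 (fst z) (snd z) = u2 (fst z) (snd z)"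
    by eventually_elim (simp add: Z_def)
  then show ?thesis by (rule AE_completion)
qed

end
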